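(* For every $n\geq 1$, the set theory $\mathsf{ReS}_0+\mathsf{Sep}(\Sigma_n)$ interprets the arithmetical theory $I\Sigma_n$.
   Context: Interpretability: for first-order theories $S,T$, "$T$ interprets $S$" means that a fixed finite family of parameter-free formulas in the language of $T$ defines, in every model of $T$, a nonempty quotient structure satisfying $S$; the formulas specify the domain, an equivalence relation on that domain (serving as equality), and the interpretations of the relations and functions of $S$. Arithmetic: $I\Sigma_n$ is $\mathsf{PA}^{-}$ (nonnegative parts of discretely ordered rings) plus induction for arithmetical $\Sigma_n$ formulas (with parameters). Set theories are in the first-order language $\{\in\}$. $\Delta_0$ formulas contain only quantifiers $\forall x\in a$, $\exists x\in a$; $\Sigma_n$ and $\Pi_n$ formulas (Lévy hierarchy) are obtained from $\Delta_0$ formulas by strict alternation of unbounded quantifier blocks in prenex form. $\mathsf{ReS}_0$ consists of Extensionality, Empty Set, Pairing, Set Difference ($x\setminus y$ exists), Union, and Separation for $\Delta_0$ formulas. $\mathsf{Sep}(\Gamma)$ is the Separation scheme: for every $\varphi\in\Gamma$, every set $a$ and parameters $\bar p$, the set $\{x\in a:\varphi(x,\bar p)\}$ exists. (No Foundation is assumed.) *)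

theory Defs
  imports Main "HOL-Library.Countable_Set"
begin

section \<open>First-order logic with equality\<close>

text \<open>Variables are de Bruijn indices. An arity \<open>None\<close> means that the symbol does not belong to
  the language, so that a language without function symbols is possible although HOL types are
  nonempty.\<close>

datatype 'f tm = Var nat | Fn 'f "'f tm list"

datatype ('f, 'r) fm =
    Rel 'r "'f tm list"
  | Eq "'f tm" "'f tm"
  | Neg "('f, 'r) fm"
  | Conj "('f, 'r) fm" "('f, 'r) fm"
  | Disj "('f, 'r) fm" "('f, 'r) fm"
  | Imp "('f, 'r) fm" "('f, 'r) fm"
  | All "('f, 'r) fm"
  | Ex "('f, 'r) fm"

abbreviation Iff :: "('f, 'r) fm \<Rightarrow> ('f, 'r) fm \<Rightarrow> ('f, 'r) fm" where
  "Iff \<phi> \<psi> \<equiv> Conj (Imp \<phi> \<psi>) (Imp \<psi> \<phi>)"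

record ('f, 'r) signature =
  fun_arity :: "'f \<Rightarrow> nat option"
  rel_arity :: "'r \<Rightarrow> nat option"

primrec wf_tm :: "('f, 'r) signature \<Rightarrow> 'f tm \<Rightarrow> bool" where
  "wf_tm L (Var i) = True"
| "wf_tm L (Fn f ts) = (fun_arity L f = Some (length ts) \<and> list_all (wf_tm L) ts)"

primrec wf_fm :: "('f, 'r) signature \<Rightarrow> ('f, 'r) fm \<Rightarrow> bool" where
  "wf_fm L (Rel r ts) = (rel_arity L r = Some (length ts) \<and> list_all (wf_tm L) ts)"
| "wf_fm L (Eq s t) = (wf_tm L s \<and> wf_tm L t)"
| "wf_fm L (Neg \<phi>) = wf_fm L \<phi>"
| "wf_fm L (Conj \<phi> \<psi>) = (wf_fm L \<phi> \<and> wf_fm L \<psi>)"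
| "wf_fm L (Disj \<phi> \<psi>) = (wf_fm L \<phi> \<and> wf_fm L \<psi>)"
| "wf_fm L (Imp \<phi> \<psi>) = (wf_fm L \<phi> \<and> wf_fm L \<psi>)"
| "wf_fm L (All \<phi>) = wf_fm L \<phi>"
| "wf_fm L (Ex \<phi>) = wf_fm L \<phi>"

primrec fv_tm :: "'f tm \<Rightarrow> nat set" where
  "fv_tm (Var i) = {i}"
| "fv_tm (Fn f ts) = \<Union> (set (map fv_tm ts))"

primrec fv :: "('f, 'r) fm \<Rightarrow> nat set" where
  "fv (Rel r ts) = \<Union> (set (map fv_tm ts))"
| "fv (Eq s t) = fv_tm s \<union> fv_tm t"
| "fv (Neg \<phi>) = fv \<phi>"
| "fv (Conj \<phi> \<psi>) = fv \<phi> \<union> fv \<psi>"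
| "fv (Disj \<phi> \<psi>) = fv \<phi> \<union> fv \<psi>"
| "fv (Imp \<phi> \<psi>) = fv \<phi> \<union> fv \<psi>"
| "fv (All \<phi>) = {i. Suc i \<in> fv \<phi>}"
| "fv (Ex \<phi>) = {i. Suc i \<in> fv \<phi>}"

primrec subst_tm :: "(nat \<Rightarrow> 'f tm) \<Rightarrow> 'f tm \<Rightarrow> 'f tm" where
  "subst_tm \<sigma> (Var i) = \<sigma> i"
| "subst_tm \<sigma> (Fn f ts) = Fn f (map (subst_tm \<sigma>) ts)"

abbreviation lift_tm :: "'f tm \<Rightarrow> 'f tm" where
  "lift_tm \<equiv> subst_tm (\<lambda>i. Var (Suc i))"

abbreviation up :: "(nat \<Rightarrow> 'f tm) \<Rightarrow> nat \<Rightarrow> 'f tm" where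
  "up \<sigma> \<equiv> case_nat (Var 0) (\<lambda>i. lift_tm (\<sigma> i))"

primrec subst_fm :: "(nat \<Rightarrow> 'f tm) \<Rightarrow> ('f, 'r) fm \<Rightarrow> ('f, 'r) fm" where
  "subst_fm \<sigma> (Rel r ts) = Rel r (map (subst_tm \<sigma>) ts)"
| "subst_fm \<sigma> (Eq s t) = Eq (subst_tm \<sigma> s) (subst_tm \<sigma> t)"
| "subst_fm \<sigma> (Neg \<phi>) = Neg (subst_fm \<sigma> \<phi>)"
| "subst_fm \<sigma> (Conj \<phi> \<psi>) = Conj (subst_fm \<sigma> \<phi>) (subst_fm \<sigma> \<psi>)"
| "subst_fm \<sigma> (Disj \<phi> \<psi>) = Disj (subst_fm \<sigma> \<phi>) (subst_fm \<sigma> \<psi>)"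
| "subst_fm \<sigma> (Imp \<phi> \<psi>) = Imp (subst_fm \<sigma> \<phi>) (subst_fm \<sigma> \<psi>)"
| "subst_fm \<sigma> (All \<phi>) = All (subst_fm (up \<sigma>) \<phi>)"
| "subst_fm \<sigma> (Ex \<phi>) = Ex (subst_fm (up \<sigma>) \<phi>)"

record ('f, 'r, 'a) struct =
  univ :: "'a set"
  fun_int :: "'f \<Rightarrow> 'a list \<Rightarrow> 'a"
  rel_int :: "'r \<Rightarrow> 'a list \<Rightarrow> bool"

primrec eval :: "('f, 'r, 'a) struct \<Rightarrow> (nat \<Rightarrow> 'a) \<Rightarrow> 'f tm \<Rightarrow> 'a" where
  "eval M e (Var i) = e i"
| "eval M e (Fn f ts) = fun_int M f (map (eval M e) ts)"

primrec sat :: "('f, 'r, 'a) struct \<Rightarrow> (nat \<Rightarrow> 'a) \<Rightarrow> ('f, 'r) fm \<Rightarrow> bool" where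
  "sat M e (Rel r ts) = rel_int M r (map (eval M e) ts)"
| "sat M e (Eq s t) = (eval M e s = eval M e t)"
| "sat M e (Neg \<phi>) = (\<not> sat M e \<phi>)"
| "sat M e (Conj \<phi> \<psi>) = (sat M e \<phi> \<and> sat M e \<psi>)"
| "sat M e (Disj \<phi> \<psi>) = (sat M e \<phi> \<or> sat M e \<psi>)"
| "sat M e (Imp \<phi> \<psi>) = (sat M e \<phi> \<longrightarrow> sat M e \<psi>)"
| "sat M e (All \<phi>) = (\<forall>a\<in>univ M. sat M (case_nat a e) \<phi>)"
| "sat M e (Ex \<phi>) = (\<exists>a\<in>univ M. sat M (case_nat a e) \<phi>)"

definition is_struct :: "('f, 'r) signature \<Rightarrow> ('f, 'r, 'a) struct \<Rightarrow> bool" where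
  "is_struct L M \<longleftrightarrow> univ M \<noteq> {} \<and>
     (\<forall>f xs. fun_arity L f = Some (length xs) \<longrightarrow> set xs \<subseteq> univ M \<longrightarrow> fun_int M f xs \<in> univ M)"

text \<open>Free variables of axioms are read as universally quantified.\<close>

definition models :: "('f, 'r) signature \<Rightarrow> ('f, 'r) fm set \<Rightarrow> ('f, 'r, 'a) struct \<Rightarrow> bool" where
  "models L T M \<longleftrightarrow> is_struct L M \<and>
     (\<forall>\<phi>\<in>T. \<forall>e. range e \<subseteq> univ M \<longrightarrow> sat M e \<phi>)"


section \<open>Interpretations\<close>

text \<open>The components are formulas of the interpreting language. A \<open>k\<close>-ary relation is given by a
  formula in the variables \<open>0, \<dots>, k - 1\<close>, and a \<open>k\<close>-ary function by a formula for its graph, with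
  arguments \<open>0, \<dots>, k - 1\<close> and value \<open>k\<close>.\<close>

record ('f, 'r, 'g, 's) interp =
  dom_fm :: "('f, 'r) fm"
  eq_fm :: "('f, 'r) fm"
  fun_fm :: "'g \<Rightarrow> ('f, 'r) fm"
  rel_fm :: "'s \<Rightarrow> ('f, 'r) fm"

definition wf_interp ::
  "('f, 'r) signature \<Rightarrow> ('g, 's) signature \<Rightarrow> ('f, 'r, 'g, 's) interp \<Rightarrow> bool" where
  "wf_interp L L' I \<longleftrightarrow>
     wf_fm L (dom_fm I) \<and> fv (dom_fm I) \<subseteq> {..<1} \<and>
     wf_fm L (eq_fm I) \<and> fv (eq_fm I) \<subseteq> {..<2} \<and>
     (\<forall>g k. fun_arity L' g = Some k \<longrightarrow> wf_fm L (fun_fm I g) \<and> fv (fun_fm I g) \<subseteq> {..<Suc k}) \<and>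
     (\<forall>s k. rel_arity L' s = Some k \<longrightarrow> wf_fm L (rel_fm I s) \<and> fv (rel_fm I s) \<subseteq> {..<k})"

text \<open>Only used when the free variables of the formula are \<open>< length xs\<close>.\<close>

abbreviation sat_list :: "('f, 'r, 'a) struct \<Rightarrow> 'a list \<Rightarrow> ('f, 'r) fm \<Rightarrow> bool" where
  "sat_list M xs \<phi> \<equiv> sat M (\<lambda>i. xs ! i) \<phi>"

definition idom :: "('f, 'r, 'g, 's) interp \<Rightarrow> ('f, 'r, 'a) struct \<Rightarrow> 'a set" where
  "idom I M = {x \<in> univ M. sat_list M [x] (dom_fm I)}"

definition ieq :: "('f, 'r, 'g, 's) interp \<Rightarrow> ('f, 'r, 'a) struct \<Rightarrow> ('a \<times> 'a) set" where
  "ieq I M = {(x, y). x \<in> idom I M \<and> y \<in> idom I M \<and> sat_list M [x, y] (eq_fm I)}"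

definition defines_quotient ::
  "('g, 's) signature \<Rightarrow> ('f, 'r, 'g, 's) interp \<Rightarrow> ('f, 'r, 'a) struct \<Rightarrow> bool" where
  "defines_quotient L' I M \<longleftrightarrow>
     idom I M \<noteq> {} \<and> equiv (idom I M) (ieq I M) \<and>
     (\<forall>s xs ys. rel_arity L' s = Some (length xs) \<longrightarrow>
        list_all2 (\<lambda>x y. (x, y) \<in> ieq I M) xs ys \<longrightarrow>
        sat_list M xs (rel_fm I s) \<longrightarrow> sat_list M ys (rel_fm I s)) \<and>
     (\<forall>g xs ys u v. fun_arity L' g = Some (length xs) \<longrightarrow>
        list_all2 (\<lambda>x y. (x, y) \<in> ieq I M) (xs @ [u]) (ys @ [v]) \<longrightarrow>
        sat_list M (xs @ [u]) (fun_fm I g) \<longrightarrow> sat_list M (ys @ [v]) (fun_fm I g)) \<and>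
     (\<forall>g xs. fun_arity L' g = Some (length xs) \<longrightarrow> set xs \<subseteq> idom I M \<longrightarrow>
        (\<exists>u\<in>idom I M. sat_list M (xs @ [u]) (fun_fm I g)) \<and>
        (\<forall>u\<in>idom I M. \<forall>v\<in>idom I M. sat_list M (xs @ [u]) (fun_fm I g) \<longrightarrow>
           sat_list M (xs @ [v]) (fun_fm I g) \<longrightarrow> (u, v) \<in> ieq I M))"

text \<open>If \<open>defines_quotient L' I M\<close> holds, then the set of all values of a function at given
  classes is itself an equivalence class.\<close>

definition quotient_struct ::
  "('f, 'r, 'g, 's) interp \<Rightarrow> ('f, 'r, 'a) struct \<Rightarrow> ('g, 's, 'a set) struct" where
  "quotient_struct I M =
     \<lparr> univ = idom I M // ieq I M,
       fun_int = (\<lambda>g cs. {u \<in> idom I M. \<exists>xs. list_all2 (\<in>) xs cs \<and> sat_list M (xs @ [u]) (fun_fm I g)}),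
       rel_int = (\<lambda>s cs. \<exists>xs. list_all2 (\<in>) xs cs \<and> sat_list M xs (rel_fm I s)) \<rparr>"

definition interprets_via ::
  "'a itself \<Rightarrow> ('f, 'r) signature \<Rightarrow> ('f, 'r) fm set \<Rightarrow>
   ('g, 's) signature \<Rightarrow> ('g, 's) fm set \<Rightarrow> ('f, 'r, 'g, 's) interp \<Rightarrow> bool" where
  "interprets_via (_ :: 'a itself) L T L' S I \<longleftrightarrow> wf_interp L L' I \<and>
     (\<forall>M :: ('f, 'r, 'a) struct. models L T M \<longrightarrow>
        defines_quotient L' I M \<and> models L' S (quotient_struct I M))"

text \<open>The same formulas have to work in all models of \<open>T\<close>, but HOL cannot quantify over the type
  of the elements of a model inside the existential quantifier. For every type \<open>'a\<close> we therefore ask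
  for formulas that work in all models with elements in \<open>'a\<close> and also in all models with elements in
  \<open>nat\<close>. By the lemma \<open>interprets_via_nat\<close> below, formulas of the latter kind work in the models over
  every type, so they do not depend on \<open>'a\<close>. (The hypotheses of that lemma hold here by
  \<open>wf_set_theory\<close> and \<open>wf_ISigma\<close>.)\<close>

definition interprets ::
  "'a itself \<Rightarrow> ('f, 'r) signature \<Rightarrow> ('f, 'r) fm set \<Rightarrow>
   ('g, 's) signature \<Rightarrow> ('g, 's) fm set \<Rightarrow> bool" where
  "interprets (_ :: 'a itself) L T L' S \<longleftrightarrow>
     (\<exists>I. interprets_via TYPE('a) L T L' S I \<and> interprets_via TYPE(nat) L T L' S I)"

subsection \<open>Countable models suffice\<close>

instance tm :: (countable) countable by countable_datatype

instance fm :: (countable, countable) countable by countable_datatype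

lemma finite_fv_tm: "finite (fv_tm t)"
  by (induction t) auto

lemma finite_fv: "finite (fv \<phi>)"
proof (induction \<phi>)
  case (All \<phi>)
  have "{i. Suc i \<in> fv \<phi>} = Suc -` fv \<phi>" by auto
  then show ?case using All by (simp add: finite_vimageI)
next
  case (Ex \<phi>)
  have "{i. Suc i \<in> fv \<phi>} = Suc -` fv \<phi>" by auto
  then show ?case using Ex by (simp add: finite_vimageI)
qed (auto simp: finite_fv_tm)

lemma eval_cong: "(\<And>i. i \<in> fv_tm t \<Longrightarrow> e i = e' i) \<Longrightarrow> eval M e t = eval M e' t"
proof (induction t)
  case (Fn f ts)
  have "map (eval M e) ts = map (eval M e') ts"
    using Fn by (auto intro!: Fn.IH)
  then show ?case by (simp del: map_eq_conv)
qed simp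

lemma sat_cong: "(\<And>i. i \<in> fv \<phi> \<Longrightarrow> e i = e' i) \<Longrightarrow> sat M e \<phi> = sat M e' \<phi>"
proof (induction \<phi> arbitrary: e e')
  case (Rel r ts)
  have "map (eval M e) ts = map (eval M e') ts"
    using Rel by (auto intro!: eval_cong)
  then show ?case by (simp del: map_eq_conv)
next
  case (Eq s t)
  have "eval M e s = eval M e' s" "eval M e t = eval M e' t"
    using Eq by (auto intro!: eval_cong)
  then show ?case by simp
next
  case (Neg \<phi>)
  have "sat M e \<phi> = sat M e' \<phi>" using Neg.prems by (auto intro!: Neg.IH)
  then show ?case by simp
next
  case (Conj \<phi> \<psi>)
  have "sat M e \<phi> = sat M e' \<phi>" "sat M e \<psi> = sat M e' \<psi>"
    using Conj.prems by (auto intro!: Conj.IH)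
  then show ?case by simp
next
  case (Disj \<phi> \<psi>)
  have "sat M e \<phi> = sat M e' \<phi>" "sat M e \<psi> = sat M e' \<psi>"
    using Disj.prems by (auto intro!: Disj.IH)
  then show ?case by simp
next
  case (Imp \<phi> \<psi>)
  have "sat M e \<phi> = sat M e' \<phi>" "sat M e \<psi> = sat M e' \<psi>"
    using Imp.prems by (auto intro!: Imp.IH)
  then show ?case by simp
next
  case (All \<phi>)
  have "sat M (case_nat a e) \<phi> = sat M (case_nat a e') \<phi>" for a
    using All.prems by (intro All.IH) (auto split: nat.split)
  then show ?case by simp
next
  case (Ex \<phi>)
  have "sat M (case_nat a e) \<phi> = sat M (case_nat a e') \<phi>" for a
    using Ex.prems by (intro Ex.IH) (auto split: nat.split)
  then show ?case by simp
qed

lemma eval_in_univ: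
  assumes "is_struct L M" "range e \<subseteq> univ M"
  shows "wf_tm L t \<Longrightarrow> eval M e t \<in> univ M"
proof (induction t)
  case (Fn f ts)
  then have "set (map (eval M e) ts) \<subseteq> univ M" by (auto simp: list_all_iff)
  moreover have "fun_arity L f = Some (length (map (eval M e) ts))" using Fn.prems by simp
  ultimately show ?case using assms(1) unfolding is_struct_def eval.simps by blast
qed (use assms in auto)

lemma tarski_vaught:
  assumes A: "is_struct L A"
    and j: "j ` univ A \<subseteq> univ B" "inj_on j (univ A)"
    and funs: "\<And>f xs. fun_arity L f = Some (length xs) \<Longrightarrow> set xs \<subseteq> univ A \<Longrightarrow>
                 fun_int B f (map j xs) = j (fun_int A f xs)"
    and rels: "\<And>r xs. rel_arity L r = Some (length xs) \<Longrightarrow> set xs \<subseteq> univ A \<Longrightarrow>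
                 rel_int B r (map j xs) = rel_int A r xs"
    and TV: "\<And>\<phi> e b. wf_fm L \<phi> \<Longrightarrow> range e \<subseteq> univ A \<Longrightarrow> b \<in> univ B \<Longrightarrow>
               sat B (case_nat b (j \<circ> e)) \<phi> \<Longrightarrow> \<exists>a\<in>univ A. sat B (case_nat (j a) (j \<circ> e)) \<phi>"
    and wf: "wf_fm L \<phi>" and e: "range e \<subseteq> univ A"
  shows "sat B (j \<circ> e) \<phi> = sat A e \<phi>"
proof -
  have ev: "eval B (j \<circ> e) t = j (eval A e t)" if "wf_tm L t" "range e \<subseteq> univ A" for e t
    using that(1)
  proof (induction t)
    case (Fn f ts)
    have *: "map (eval B (j \<circ> e)) ts = map j (map (eval A e) ts)"
      using Fn by (simp add: list_all_iff comp_def)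
    have "set (map (eval A e) ts) \<subseteq> univ A"
      using Fn.prems eval_in_univ[OF A that(2)] by (auto simp: list_all_iff)
    then have "fun_int B f (map j (map (eval A e) ts)) = j (fun_int A f (map (eval A e) ts))"
      using Fn.prems by (intro funs) auto
    then show ?case unfolding eval.simps * .
  qed simp
  have case_o: "j \<circ> case_nat a e = case_nat (j a) (j \<circ> e)" for a e
    by (rule ext) (simp split: nat.split)
  have rng: "range (case_nat a e) \<subseteq> univ A" if "a \<in> univ A" "range e \<subseteq> univ A" for a and e :: "nat \<Rightarrow> _"
    unfolding image_subset_iff using that by (simp add: image_subset_iff split: nat.split)
  show ?thesis
    using wf e
  proof (induction \<phi> arbitrary: e)
    case (Rel r ts)
    have *: "map (eval B (j \<circ> e)) ts = map j (map (eval A e) ts)"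
      using Rel ev by (auto simp: list_all_iff)
    have "set (map (eval A e) ts) \<subseteq> univ A"
      using Rel.prems eval_in_univ[OF A Rel.prems(2)] by (auto simp: list_all_iff)
    then have "rel_int B r (map j (map (eval A e) ts)) = rel_int A r (map (eval A e) ts)"
      using Rel.prems by (intro rels) auto
    then show ?case unfolding sat.simps * .
  next
    case (Eq s t)
    then have "eval A e s \<in> univ A" "eval A e t \<in> univ A"
      using eval_in_univ[OF A] by auto
    moreover have "eval B (j \<circ> e) s = j (eval A e s)" "eval B (j \<circ> e) t = j (eval A e t)"
      using Eq by (auto intro!: ev)
    ultimately show ?case unfolding sat.simps using j(2) by (metis inj_on_eq_iff)
  next
    case (All \<phi>)
    have IH: "sat B (case_nat (j a) (j \<circ> e)) \<phi> = sat A (case_nat a e) \<phi>" if "a \<in> univ A" for a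
      using All.IH[of "case_nat a e"] All.prems rng that unfolding case_o by simp
    have "\<exists>a\<in>univ A. \<not> sat B (case_nat (j a) (j \<circ> e)) \<phi>"
      if "b \<in> univ B" "\<not> sat B (case_nat b (j \<circ> e)) \<phi>" for b
      using TV[of "Neg \<phi>" e b] All.prems that by simp
    moreover have "j a \<in> univ B" if "a \<in> univ A" for a using that j(1) by blast
    ultimately show ?case using IH unfolding sat.simps by blast
  next
    case (Ex \<phi>)
    have IH: "sat B (case_nat (j a) (j \<circ> e)) \<phi> = sat A (case_nat a e) \<phi>" if "a \<in> univ A" for a
      using Ex.IH[of "case_nat a e"] Ex.prems rng that unfolding case_o by simp
    have "\<exists>a\<in>univ A. sat B (case_nat (j a) (j \<circ> e)) \<phi>"
      if "b \<in> univ B" "sat B (case_nat b (j \<circ> e)) \<phi>" for b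
      using TV[of \<phi> e b] Ex.prems that by simp
    moreover have "j a \<in> univ B" if "a \<in> univ A" for a using that j(1) by blast
    ultimately show ?case using IH unfolding sat.simps by blast
  next
    case (Neg \<phi>)
    have "sat B (j \<circ> e) \<phi> = sat A e \<phi>" by (rule Neg.IH[of e]) (use Neg.prems in simp_all)
    then show ?case unfolding sat.simps by blast
  next
    case (Conj \<phi> \<psi>)
    have "sat B (j \<circ> e) \<phi> = sat A e \<phi>" by (rule Conj.IH(1)[of e]) (use Conj.prems in simp_all)
    moreover have "sat B (j \<circ> e) \<psi> = sat A e \<psi>" by (rule Conj.IH(2)[of e]) (use Conj.prems in simp_all)
    ultimately show ?case unfolding sat.simps by blast
  next
    case (Disj \<phi> \<psi>)
    have "sat B (j \<circ> e) \<phi> = sat A e \<phi>" by (rule Disj.IH(1)[of e]) (use Disj.prems in simp_all)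
    moreover have "sat B (j \<circ> e) \<psi> = sat A e \<psi>" by (rule Disj.IH(2)[of e]) (use Disj.prems in simp_all)
    ultimately show ?case unfolding sat.simps by blast
  next
    case (Imp \<phi> \<psi>)
    have "sat B (j \<circ> e) \<phi> = sat A e \<phi>" by (rule Imp.IH(1)[of e]) (use Imp.prems in simp_all)
    moreover have "sat B (j \<circ> e) \<psi> = sat A e \<psi>" by (rule Imp.IH(2)[of e]) (use Imp.prems in simp_all)
    ultimately show ?case unfolding sat.simps by blast
  qed
qed

lemma countable_closure:
  fixes F :: "'i :: countable \<Rightarrow> 'a list \<Rightarrow> 'a"
  assumes "countable C" "C \<subseteq> U" and F: "\<And>i xs. set xs \<subseteq> U \<Longrightarrow> F i xs \<in> U"
  obtains X where "C \<subseteq> X" "X \<subseteq> U" "countable X" "\<And>i xs. set xs \<subseteq> X \<Longrightarrow> F i xs \<in> X"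
proof -
  define Y where "Y = rec_nat C (\<lambda>_ Z. Z \<union> (\<Union>i. F i ` lists Z))"
  have Y0: "Y 0 = C" and YS: "Y (Suc m) = Y m \<union> (\<Union>i. F i ` lists (Y m))" for m
    by (simp_all add: Y_def)
  have cnt: "countable (Y m)" for m
    by (induction m) (auto simp: Y0 YS assms)
  have sub: "Y m \<subseteq> U" for m
  proof (induction m)
    case (Suc m)
    then have "F i xs \<in> U" if "xs \<in> lists (Y m)" for i xs
      using that by (intro F) auto
    then show ?case using Suc by (auto simp: YS)
  qed (simp add: Y0 assms)
  have mono: "Y m \<subseteq> Y m'" if "m \<le> m'" for m m'
    by (rule lift_Suc_mono_le[OF _ that]) (auto simp: YS)
  have fin: "\<exists>m. set xs \<subseteq> Y m" if "set xs \<subseteq> (\<Union>m. Y m)" for xs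
    using that
  proof (induction xs)
    case (Cons x xs)
    then obtain m m' where "set xs \<subseteq> Y m" "x \<in> Y m'" by auto
    then have "set (x # xs) \<subseteq> Y (max m m')"
      using mono[of m "max m m'"] mono[of m' "max m m'"] by auto
    then show ?case by blast
  qed simp
  show ?thesis
  proof
    show "C \<subseteq> (\<Union>m. Y m)" using Y0 by blast
    show "(\<Union>m. Y m) \<subseteq> U" using sub by blast
    show "countable (\<Union>m. Y m)" using cnt by blast
    fix i xs assume "set xs \<subseteq> (\<Union>m. Y m)"
    then obtain m where "set xs \<subseteq> Y m" using fin by blast
    then have "F i xs \<in> Y (Suc m)" by (auto simp: YS)
    then show "F i xs \<in> (\<Union>m. Y m)" by blast
  qed
qed

definition pad :: "'a \<Rightarrow> 'a list \<Rightarrow> nat \<Rightarrow> 'a" where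
  "pad c xs i = (if i < length xs then xs ! i else c)"

lemma pad_agrees:
  obtains xs where "set xs \<subseteq> range e" "\<And>i. i \<in> fv \<phi> \<Longrightarrow> pad c xs i = e i"
    "\<And>i. Suc i \<in> fv \<phi> \<Longrightarrow> pad c xs i = e i"
proof
  let ?m = "Suc (Max (insert 0 (fv \<phi>)))"
  show "set (map e [0..<?m]) \<subseteq> range e" by auto
  have *: "i < ?m" if "i \<in> fv \<phi>" for i
    using that finite_fv[of \<phi>] by (simp add: less_Suc_eq_le)
  show "pad c (map e [0..<?m]) i = e i" if "i \<in> fv \<phi>" for i
    using *[OF that] by (simp add: pad_def del: upt_Suc)
  show "pad c (map e [0..<?m]) i = e i" if "Suc i \<in> fv \<phi>" for i
    using *[OF that] by (simp add: pad_def del: upt_Suc)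
qed

lemma loewenheim_skolem:
  fixes M :: "('f :: countable, 'r :: countable, 'a) struct" and G :: "'i :: countable \<Rightarrow> 'a list \<Rightarrow> 'a"
  assumes M: "is_struct L M" and C: "countable C" "C \<subseteq> univ M"
    and G: "\<And>i xs. set xs \<subseteq> univ M \<Longrightarrow> G i xs \<in> univ M"
  obtains X k and N :: "('f, 'r, nat) struct" where
    "C \<subseteq> X" "X \<subseteq> univ M" "\<And>i xs. set xs \<subseteq> X \<Longrightarrow> G i xs \<in> X"
    "bij_betw k (univ N) X" "is_struct L N"
    "\<And>\<phi> e. wf_fm L \<phi> \<Longrightarrow> range e \<subseteq> univ N \<Longrightarrow> sat M (k \<circ> e) \<phi> = sat N e \<phi>"
proof -
  obtain c where c: "c \<in> univ M" using M unfolding is_struct_def by blast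
  define P where "P \<phi> xs a \<longleftrightarrow> a \<in> univ M \<and> sat M (case_nat a (pad c xs)) \<phi>"
    for \<phi> :: "('f, 'r) fm" and xs a
  define F where "F = (\<lambda>i xs. case i of
      Inl \<phi> \<Rightarrow> if \<exists>a. P \<phi> xs a then SOME a. P \<phi> xs a else c
    | Inr (Inl f) \<Rightarrow> if fun_arity L f = Some (length xs) then fun_int M f xs else c
    | Inr (Inr i) \<Rightarrow> G i xs)"
  have F: "F i xs \<in> univ M" if "set xs \<subseteq> univ M" for i xs
  proof (cases i)
    case (Inl \<phi>)
    show ?thesis
    proof (cases "\<exists>a. P \<phi> xs a")
      case True
      then have "P \<phi> xs (F i xs)" using Inl someI_ex[OF True] by (simp add: F_def)
      then show ?thesis by (simp add: P_def)
    next
      case False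
      then have "F i xs = c" using Inl by (auto simp: F_def)
      then show ?thesis using c by simp
    qed
  next
    case (Inr i')
    then show ?thesis
      using that M c G by (auto simp: F_def is_struct_def split: sum.split)
  qed
  obtain X where X: "insert c C \<subseteq> X" "X \<subseteq> univ M" "countable X"
    and clF: "\<And>i xs. set xs \<subseteq> X \<Longrightarrow> F i xs \<in> X"
    using countable_closure[of "insert c C" "univ M" F] C c F by (metis countable_insert insert_subset)
  have clf: "fun_int M f xs \<in> X" if "set xs \<subseteq> X" "fun_arity L f = Some (length xs)" for f xs
    using clF[OF that(1), of "Inr (Inl f)"] that(2) by (simp add: F_def)
  define h where "h = to_nat_on X"
  define k where "k = from_nat_into X"
  have Xne: "X \<noteq> {}" using X by auto
  have kh: "k (h x) = x" if "x \<in> X" for x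
    using that X(3) by (simp add: h_def k_def)
  define N :: "('f, 'r, nat) struct" where
    "N = \<lparr> univ = h ` X, fun_int = (\<lambda>f xs. h (fun_int M f (map k xs))),
           rel_int = (\<lambda>r xs. rel_int M r (map k xs)) \<rparr>"
  have bij: "bij_betw k (univ N) X"
    unfolding bij_betw_def N_def using kh by (force simp: inj_on_def)
  have kX: "k x \<in> X" if "x \<in> univ N" for x
    using that kh by (auto simp: N_def)
  have sN: "is_struct L N"
    unfolding is_struct_def
  proof (intro conjI allI impI)
    show "univ N \<noteq> {}" using Xne by (simp add: N_def)
    fix f xs assume "fun_arity L f = Some (length xs)" "set xs \<subseteq> univ N"
    then have "fun_int M f (map k xs) \<in> X" using kX by (intro clf) auto
    then show "fun_int N f xs \<in> univ N" by (simp add: N_def)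
  qed
  show ?thesis
  proof (rule that[of X k N])
    show "C \<subseteq> X" "X \<subseteq> univ M" using X by auto
    show "G i xs \<in> X" if "set xs \<subseteq> X" for i xs
      using clF[OF that, of "Inr (Inr i)"] by (simp add: F_def)
    show "bij_betw k (univ N) X" "is_struct L N" by fact+
    fix \<phi> :: "('f, 'r) fm" and e :: "nat \<Rightarrow> nat"
    assume "wf_fm L \<phi>" "range e \<subseteq> univ N"
    then show "sat M (k \<circ> e) \<phi> = sat N e \<phi>"
    proof (rule tarski_vaught[OF sN, rotated -2])
      show "k ` univ N \<subseteq> univ M" using kX X(2) by blast
      show "inj_on k (univ N)" using bij by (simp add: bij_betw_def)
      show "fun_int M f (map k xs) = k (fun_int N f xs)"
        if "fun_arity L f = Some (length xs)" "set xs \<subseteq> univ N" for f xs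
      proof -
        have "fun_int M f (map k xs) \<in> X" using that kX by (intro clf) auto
        then show ?thesis by (simp add: N_def kh)
      qed
      show "rel_int M r (map k xs) = rel_int N r xs" for r xs by (simp add: N_def)
      fix \<phi> :: "('f, 'r) fm" and e :: "nat \<Rightarrow> nat" and b
      assume e: "range e \<subseteq> univ N" and b: "b \<in> univ M" "sat M (case_nat b (k \<circ> e)) \<phi>"
      obtain xs where xs: "set xs \<subseteq> range (k \<circ> e)" "\<And>i. Suc i \<in> fv \<phi> \<Longrightarrow> pad c xs i = (k \<circ> e) i"
        using pad_agrees[of "k \<circ> e" \<phi> c] by metis
      have eq: "sat M (case_nat a (pad c xs)) \<phi> = sat M (case_nat a (k \<circ> e)) \<phi>" for a
        using xs(2) by (intro sat_cong) (auto split: nat.split)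
      have ex: "\<exists>a. P \<phi> xs a" using b eq unfolding P_def by blast
      have "range (k \<circ> e) \<subseteq> X" using e kX by (simp add: image_subset_iff)
      then have "set xs \<subseteq> X" using xs(1) by blast
      then have "F (Inl \<phi>) xs \<in> X" by (rule clF)
      moreover have "P \<phi> xs (F (Inl \<phi>) xs)" using ex someI_ex[OF ex] by (simp add: F_def)
      ultimately have "F (Inl \<phi>) xs \<in> k ` univ N" "sat M (case_nat (F (Inl \<phi>) xs) (k \<circ> e)) \<phi>"
        using bij eq by (auto simp: P_def bij_betw_def)
      then show "\<exists>a\<in>univ N. sat M (case_nat (k a) (k \<circ> e)) \<phi>" by fastforce
    qed
  qed
qed

lemma quotient_struct_reps:
  assumes dq: "defines_quotient L' I M" and xs: "set xs \<subseteq> idom I M"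
  shows "rel_arity L' s = Some (length xs) \<Longrightarrow>
      rel_int (quotient_struct I M) s (map (\<lambda>x. ieq I M `` {x}) xs) = sat_list M xs (rel_fm I s)"
    and "fun_arity L' g = Some (length xs) \<Longrightarrow> u \<in> idom I M \<Longrightarrow> sat_list M (xs @ [u]) (fun_fm I g) \<Longrightarrow>
      fun_int (quotient_struct I M) g (map (\<lambda>x. ieq I M `` {x}) xs) = ieq I M `` {u}"
proof -
  let ?E = "ieq I M"
  have eqv: "equiv (idom I M) ?E" using dq by (simp add: defines_quotient_def)
  have refl: "(x, x) \<in> ?E" if "x \<in> idom I M" for x
    using eqv that by (auto simp: equiv_def refl_on_def)
  have mem: "list_all2 (\<in>) ys (map (\<lambda>x. ?E `` {x}) xs) \<longleftrightarrow> list_all2 (\<lambda>x y. (x, y) \<in> ?E) xs ys" for ys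
    by (auto simp: list_all2_conv_all_nth)
  have reflxs: "list_all2 (\<lambda>x y. (x, y) \<in> ?E) xs xs"
    using xs refl by (auto simp: list_all2_conv_all_nth subset_code(1))
  have sym: "list_all2 (\<lambda>x y. (x, y) \<in> ?E) ys xs" if "list_all2 (\<lambda>x y. (x, y) \<in> ?E) xs ys" for ys
    using that eqv by (auto simp: list_all2_conv_all_nth equiv_def sym_def)
  {
    assume ar: "rel_arity L' s = Some (length xs)"
    have cong: "sat_list M xs (rel_fm I s)"
      if "list_all2 (\<lambda>x y. (x, y) \<in> ?E) xs ys" "sat_list M ys (rel_fm I s)" for ys
      using dq ar sym[OF that(1)] that(2) list_all2_lengthD[OF that(1)] unfolding defines_quotient_def by metis
    show "rel_int (quotient_struct I M) s (map (\<lambda>x. ?E `` {x}) xs) = sat_list M xs (rel_fm I s)"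
      using cong reflxs by (auto simp: quotient_struct_def mem)
  }
  {
    assume ar: "fun_arity L' g = Some (length xs)" and u: "u \<in> idom I M" "sat_list M (xs @ [u]) (fun_fm I g)"
    have cong: "sat_list M (xs' @ [u']) (fun_fm I g) \<Longrightarrow> sat_list M (ys @ [v]) (fun_fm I g)"
      if "length xs' = length xs" "list_all2 (\<lambda>x y. (x, y) \<in> ?E) xs' ys" "(u', v) \<in> ?E" for xs' ys u' v
    proof -
      have "list_all2 (\<lambda>x y. (x, y) \<in> ?E) (xs' @ [u']) (ys @ [v])"
        using that by (simp add: list_all2_appendI)
      then show "sat_list M (xs' @ [u']) (fun_fm I g) \<Longrightarrow> sat_list M (ys @ [v]) (fun_fm I g)"
        using dq ar that(1) unfolding defines_quotient_def by metis
    qed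
    have uniq: "(u, v) \<in> ?E" if "v \<in> idom I M" "sat_list M (xs @ [v]) (fun_fm I g)" for v
      using dq ar u xs that unfolding defines_quotient_def by blast
    have "v \<in> fun_int (quotient_struct I M) g (map (\<lambda>x. ?E `` {x}) xs) \<longleftrightarrow> (u, v) \<in> ?E" for v
    proof
      assume "v \<in> fun_int (quotient_struct I M) g (map (\<lambda>x. ?E `` {x}) xs)"
      then obtain ys where v: "v \<in> idom I M" "list_all2 (\<lambda>x y. (x, y) \<in> ?E) xs ys"
        "sat_list M (ys @ [v]) (fun_fm I g)" by (auto simp: quotient_struct_def mem)
      then have "sat_list M (xs @ [v]) (fun_fm I g)"
        using cong[of ys xs v v] sym refl by (auto dest: list_all2_lengthD)
      then show "(u, v) \<in> ?E" using uniq v by blast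
    next
      assume uv: "(u, v) \<in> ?E"
      then have "sat_list M (xs @ [v]) (fun_fm I g)" using cong[of xs xs u v] reflxs u by blast
      moreover have "v \<in> idom I M" using uv by (simp add: ieq_def)
      ultimately show "v \<in> fun_int (quotient_struct I M) g (map (\<lambda>x. ?E `` {x}) xs)"
        using reflxs by (auto simp: quotient_struct_def mem)
    qed
    then show "fun_int (quotient_struct I M) g (map (\<lambda>x. ?E `` {x}) xs) = ?E `` {u}" by auto
  }
qed

lemma is_struct_quotient:
  assumes dq: "defines_quotient L' I M"
  shows "is_struct L' (quotient_struct I M)"
  unfolding is_struct_def
proof (intro conjI allI impI)
  show "univ (quotient_struct I M) \<noteq> {}"
    using dq by (auto simp: defines_quotient_def quotient_struct_def quotient_def)
  fix g cs assume ar: "fun_arity L' g = Some (length cs)" and "set cs \<subseteq> univ (quotient_struct I M)"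
  then have "\<forall>c\<in>set cs. \<exists>x\<in>idom I M. c = ieq I M `` {x}"
    by (auto simp: quotient_struct_def quotient_def)
  then obtain r where "\<And>c. c \<in> set cs \<Longrightarrow> r c \<in> idom I M \<and> c = ieq I M `` {r c}"
    by metis
  then have r: "cs = map (\<lambda>x. ieq I M `` {x}) (map r cs)" "set (map r cs) \<subseteq> idom I M"
    by (auto intro!: map_idI[symmetric])
  have ar': "fun_arity L' g = Some (length (map r cs))" using ar by simp
  then obtain u where u: "u \<in> idom I M" "sat_list M (map r cs @ [u]) (fun_fm I g)"
    using dq r(2) unfolding defines_quotient_def by meson
  have "fun_int (quotient_struct I M) g cs = ieq I M `` {u}"
    using quotient_struct_reps(2)[OF dq r(2) ar' u] r(1) by metis
  then show "fun_int (quotient_struct I M) g cs \<in> univ (quotient_struct I M)"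
    using u by (auto simp: quotient_struct_def intro: quotientI)
qed

lemma interprets_via_nat:
  fixes L :: "('f :: countable, 'r :: countable) signature"
    and L' :: "('g :: countable, 's :: countable) signature"
  assumes I: "interprets_via TYPE(nat) L T L' S I"
    and wfT: "\<And>\<phi>. \<phi> \<in> T \<Longrightarrow> wf_fm L \<phi>" and wfS: "\<And>\<phi>. \<phi> \<in> S \<Longrightarrow> wf_fm L' \<phi>"
  shows "interprets_via TYPE('a) L T L' S I"
  unfolding interprets_via_def
proof (intro conjI allI impI)
  show wfI: "wf_interp L L' I" using I by (simp add: interprets_via_def)
  fix M :: "('f, 'r, 'a) struct" assume M: "models L T M"
  let ?E = "ieq I M"
  let ?Q = "quotient_struct I M"
  have sM: "is_struct L M" using M by (simp add: models_def)
  then obtain c where c: "c \<in> univ M" unfolding is_struct_def by blast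
  define P where "P \<psi> xs a \<longleftrightarrow> a \<in> idom I M \<and>
      sat ?Q (case_nat (?E `` {a}) ((\<lambda>x. ?E `` {x}) \<circ> pad c xs)) \<psi>" for \<psi> :: "('g, 's) fm" and xs a
  define G where "G \<psi> xs = (if \<exists>a. P \<psi> xs a then SOME a. P \<psi> xs a else c)" for \<psi> xs
  have G: "G \<psi> xs \<in> univ M" for \<psi> xs
    using someI_ex[of "P \<psi> xs"] c by (auto simp: G_def P_def idom_def)
  have sub: "\<exists>X k (N :: ('f, 'r, nat) struct).
      C \<subseteq> X \<and> X \<subseteq> univ M \<and> (\<forall>\<psi> xs. set xs \<subseteq> X \<longrightarrow> G \<psi> xs \<in> X) \<and> bij_betw k (univ N) X \<and>
      (\<forall>xs \<phi>. set xs \<subseteq> univ N \<longrightarrow> wf_fm L \<phi> \<longrightarrow> fv \<phi> \<subseteq> {..<length xs} \<longrightarrow>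
         sat_list M (map k xs) \<phi> = sat_list N xs \<phi>) \<and>
      idom I N = {x \<in> univ N. k x \<in> idom I M} \<and>
      ieq I N = {(x, y). x \<in> univ N \<and> y \<in> univ N \<and> (k x, k y) \<in> ?E} \<and>
      defines_quotient L' I N \<and> models L' S (quotient_struct I N)"
    if C: "countable C" "C \<subseteq> univ M" for C
  proof -
    obtain X k and N :: "('f, 'r, nat) struct" where
      X: "C \<subseteq> X" "X \<subseteq> univ M" "\<And>\<psi> xs. set xs \<subseteq> X \<Longrightarrow> G \<psi> xs \<in> X"
      and k: "bij_betw k (univ N) X" and sN: "is_struct L N"
      and el: "\<And>\<phi> e. wf_fm L \<phi> \<Longrightarrow> range e \<subseteq> univ N \<Longrightarrow> sat M (k \<circ> e) \<phi> = sat N e \<phi>"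
      using loewenheim_skolem[OF sM C, of G] G by metis
    have kM: "k x \<in> univ M" if "x \<in> univ N" for x
      using that k X(2) by (auto simp: bij_betw_def)
    obtain d where d: "d \<in> univ N" using sN by (auto simp: is_struct_def)
    have el_list: "sat_list M (map k xs) \<phi> = sat_list N xs \<phi>"
      if "set xs \<subseteq> univ N" "wf_fm L \<phi>" "fv \<phi> \<subseteq> {..<length xs}" for xs \<phi>
    proof -
      have "range (pad d xs) \<subseteq> univ N" using that(1) d by (auto simp: pad_def)
      then have "sat M (k \<circ> pad d xs) \<phi> = sat N (pad d xs) \<phi>" by (intro el that)
      moreover have "sat M (k \<circ> pad d xs) \<phi> = sat_list M (map k xs) \<phi>"
        using that(3) by (intro sat_cong) (auto simp: pad_def)
      moreover have "sat N (pad d xs) \<phi> = sat_list N xs \<phi>"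
        using that(3) by (intro sat_cong) (auto simp: pad_def)
      ultimately show ?thesis by simp
    qed
    have dom: "idom I N = {x \<in> univ N. k x \<in> idom I M}"
    proof -
      have "sat_list M [k x] (dom_fm I) = sat_list N [x] (dom_fm I)" if "x \<in> univ N" for x
        using el_list[of "[x]" "dom_fm I"] wfI that by (simp add: wf_interp_def)
      then show ?thesis using kM by (auto simp: idom_def)
    qed
    have eq: "ieq I N = {(x, y). x \<in> univ N \<and> y \<in> univ N \<and> (k x, k y) \<in> ?E}"
    proof -
      have "sat_list M [k x, k y] (eq_fm I) = sat_list N [x, y] (eq_fm I)"
        if "x \<in> univ N" "y \<in> univ N" for x y
        using el_list[of "[x, y]" "eq_fm I"] wfI that by (simp add: wf_interp_def numeral_2_eq_2)
      then show ?thesis using dom by (auto simp: ieq_def)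
    qed
    have "models L T N"
      unfolding models_def
    proof (intro conjI ballI allI impI sN)
      fix \<phi> and e :: "nat \<Rightarrow> nat" assume "\<phi> \<in> T" "range e \<subseteq> univ N"
      moreover from this have "range (k \<circ> e) \<subseteq> univ M" using kM by auto
      ultimately show "sat N e \<phi>" using M el wfT unfolding models_def by blast
    qed
    then have "defines_quotient L' I N \<and> models L' S (quotient_struct I N)"
      using I by (simp add: interprets_via_def)
    then show ?thesis using X k el_list dom eq by (intro exI[of _ X] exI[of _ k] exI[of _ N]) blast
  qed
  have idomM: "idom I M \<subseteq> univ M" by (auto simp: idom_def)
  have E_dom: "x \<in> idom I M \<and> y \<in> idom I M" if "(x, y) \<in> ?E" for x y
    using that by (simp add: ieq_def)
  have lift_list: "\<exists>xs'. set xs' \<subseteq> B \<and> xs = map k xs'" if "set xs \<subseteq> k ` B"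
    for xs :: "'a list" and k :: "nat \<Rightarrow> 'a" and B
    using that
  proof (induction xs)
    case (Cons x xs)
    then obtain xs' y where "set xs' \<subseteq> B" "xs = map k xs'" "y \<in> B" "x = k y" by auto
    then show ?case by (intro exI[of _ "y # xs'"]) auto
  qed simp
  have lists_dom: "set xs \<subseteq> idom I M \<and> set ys \<subseteq> idom I M"
    if "list_all2 (\<lambda>x y. (x, y) \<in> ?E) xs ys" for xs ys
    using that by (induction rule: list_all2_induct) (auto dest: E_dom)
  have ne: "idom I M \<noteq> {}"
  proof -
    obtain k and N :: "('f, 'r, nat) struct" where "idom I N = {x \<in> univ N. k x \<in> idom I M}"
      "defines_quotient L' I N" using sub[of "{}"] by auto
    then show ?thesis unfolding defines_quotient_def by blast
  qed
  show dq: "defines_quotient L' I M"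
    unfolding defines_quotient_def
  proof (intro conjI allI impI)
    show "idom I M \<noteq> {}" by (rule ne)
  next
    have *: "(x, x) \<in> ?E \<and> ((x, y) \<in> ?E \<longrightarrow> (y, x) \<in> ?E) \<and> ((x, y) \<in> ?E \<longrightarrow> (y, z) \<in> ?E \<longrightarrow> (x, z) \<in> ?E)"
      if "x \<in> idom I M" "y \<in> idom I M" "z \<in> idom I M" for x y z
    proof -
      have "countable {x, y, z}" "{x, y, z} \<subseteq> univ M" using that idomM by auto
      from sub[OF this] obtain X k and N :: "('f, 'r, nat) struct" where
        X: "{x, y, z} \<subseteq> X" "bij_betw k (univ N) X"
        and dom: "idom I N = {x \<in> univ N. k x \<in> idom I M}"
        and eq: "ieq I N = {(x, y). x \<in> univ N \<and> y \<in> univ N \<and> (k x, k y) \<in> ?E}"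
        and dq: "defines_quotient L' I N" by blast
      have "x \<in> k ` univ N" "y \<in> k ` univ N" "z \<in> k ` univ N" using X by (auto simp: bij_betw_def)
      then obtain x' y' z' where xyz: "x' \<in> univ N" "y' \<in> univ N" "z' \<in> univ N" "x = k x'" "y = k y'" "z = k z'"
        by (elim imageE)
      have "equiv (idom I N) (ieq I N)" using dq by (simp add: defines_quotient_def)
      then have E: "refl_on (idom I N) (ieq I N)" "sym (ieq I N)" "trans (ieq I N)"
        by (auto simp: equiv_def)
      have "x' \<in> idom I N" using that(1) xyz dom by simp
      then have "(x', x') \<in> ieq I N" "(x', y') \<in> ieq I N \<longrightarrow> (y', x') \<in> ieq I N"
        "(x', y') \<in> ieq I N \<longrightarrow> (y', z') \<in> ieq I N \<longrightarrow> (x', z') \<in> ieq I N"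
        using E by (blast dest: refl_onD symD transD)+
      then show ?thesis using xyz eq by simp
    qed
    show "equiv (idom I M) ?E"
    proof (rule equivI)
      show "?E \<subseteq> idom I M \<times> idom I M" using E_dom by auto
      show "refl_on (idom I M) ?E" using * by (auto intro: refl_onI)
      show "sym ?E" using * E_dom by (meson symI)
      show "trans ?E"
      proof (rule transI)
        fix x y z assume "(x, y) \<in> ?E" "(y, z) \<in> ?E"
        then show "(x, z) \<in> ?E" using *[of x y z] E_dom[of x y] E_dom[of y z] by simp
      qed
    qed
  next
    fix s xs ys
    assume ar: "rel_arity L' s = Some (length xs)" and E: "list_all2 (\<lambda>x y. (x, y) \<in> ?E) xs ys"
      and sat: "sat_list M xs (rel_fm I s)"
    have "countable (set xs \<union> set ys)" "set xs \<union> set ys \<subseteq> univ M"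
      using lists_dom[OF E] idomM by (auto intro: countable_finite)
    from sub[OF this] obtain X k and N :: "('f, 'r, nat) struct" where
      X: "set xs \<union> set ys \<subseteq> X" "bij_betw k (univ N) X"
      and el: "\<And>xs \<phi>. set xs \<subseteq> univ N \<Longrightarrow> wf_fm L \<phi> \<Longrightarrow> fv \<phi> \<subseteq> {..<length xs} \<Longrightarrow>
         sat_list M (map k xs) \<phi> = sat_list N xs \<phi>"
      and eq: "ieq I N = {(x, y). x \<in> univ N \<and> y \<in> univ N \<and> (k x, k y) \<in> ?E}"
      and dq: "defines_quotient L' I N" by blast
    obtain xs' ys' where xs': "set xs' \<subseteq> univ N" "xs = map k xs'"
      and ys': "set ys' \<subseteq> univ N" "ys = map k ys'"
      using lift_list[of xs k "univ N"] lift_list[of ys k "univ N"] X by (auto simp: bij_betw_def)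
    have wf: "wf_fm L (rel_fm I s)" "fv (rel_fm I s) \<subseteq> {..<length xs}"
      using wfI ar by (auto simp: wf_interp_def)
    have len: "length ys = length xs" using E by (simp add: list_all2_lengthD)
    have "list_all2 (\<lambda>x y. (x, y) \<in> ieq I N) xs' ys'"
      using E xs' ys' unfolding eq by (auto simp: list_all2_conv_all_nth subset_code(1))
    moreover have "sat_list N xs' (rel_fm I s)" using el[OF xs'(1) wf(1)] wf(2) sat xs' by simp
    moreover have "rel_arity L' s = Some (length xs')" using ar xs' by simp
    ultimately have "sat_list N ys' (rel_fm I s)" using dq unfolding defines_quotient_def by blast
    then show "sat_list M ys (rel_fm I s)" using el[OF ys'(1) wf(1)] wf(2) ys' len by simp
  next
    fix g xs ys u v
    assume ar: "fun_arity L' g = Some (length xs)"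
      and E: "list_all2 (\<lambda>x y. (x, y) \<in> ?E) (xs @ [u]) (ys @ [v])"
      and sat: "sat_list M (xs @ [u]) (fun_fm I g)"
    have "countable (set (xs @ [u]) \<union> set (ys @ [v]))" "set (xs @ [u]) \<union> set (ys @ [v]) \<subseteq> univ M"
      using lists_dom[OF E] idomM by (auto intro: countable_finite)
    from sub[OF this] obtain X k and N :: "('f, 'r, nat) struct" where
      X: "set (xs @ [u]) \<union> set (ys @ [v]) \<subseteq> X" "bij_betw k (univ N) X"
      and el: "\<And>xs \<phi>. set xs \<subseteq> univ N \<Longrightarrow> wf_fm L \<phi> \<Longrightarrow> fv \<phi> \<subseteq> {..<length xs} \<Longrightarrow>
         sat_list M (map k xs) \<phi> = sat_list N xs \<phi>"
      and eq: "ieq I N = {(x, y). x \<in> univ N \<and> y \<in> univ N \<and> (k x, k y) \<in> ?E}"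
      and dq: "defines_quotient L' I N" by blast
    obtain xs' ys' where xs': "set xs' \<subseteq> univ N" "xs = map k xs'"
      and ys': "set ys' \<subseteq> univ N" "ys = map k ys'"
      using lift_list[of xs k "univ N"] lift_list[of ys k "univ N"] X by (auto simp: bij_betw_def)
    obtain u' v' where uv': "u' \<in> univ N" "u = k u'" "v' \<in> univ N" "v = k v'"
      using X by (auto simp: bij_betw_def)
    have wf: "wf_fm L (fun_fm I g)" "fv (fun_fm I g) \<subseteq> {..<Suc (length xs)}"
      using wfI ar by (auto simp: wf_interp_def)
    have len: "length ys = length xs" using list_all2_lengthD[OF E] by simp
    have sN: "set (xs' @ [u']) \<subseteq> univ N" "set (ys' @ [v']) \<subseteq> univ N" using xs' ys' uv' by auto
    have m: "xs @ [u] = map k (xs' @ [u'])" "ys @ [v] = map k (ys' @ [v'])" using xs' ys' uv' by auto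
    have "list_all2 (\<lambda>x y. (x, y) \<in> ieq I N) (xs' @ [u']) (ys' @ [v'])"
    proof -
      have "list_all2 (\<lambda>x y. (k x, k y) \<in> ?E) (xs' @ [u']) (ys' @ [v'])"
        using E unfolding m list.rel_map .
      then show ?thesis
        by (rule list.rel_mono_strong) (use sN in \<open>auto simp: eq\<close>)
    qed
    moreover have "sat_list N (xs' @ [u']) (fun_fm I g)"
      using el[OF sN(1) wf(1)] wf(2) sat xs' unfolding m by simp
    moreover have "fun_arity L' g = Some (length xs')" using ar xs' by simp
    ultimately have "sat_list N (ys' @ [v']) (fun_fm I g)" using dq unfolding defines_quotient_def by blast
    then show "sat_list M (ys @ [v]) (fun_fm I g)"
      using el[OF sN(2) wf(1)] wf(2) ys' len unfolding m by simp
  next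
    fix g xs
    assume ar: "fun_arity L' g = Some (length xs)" and xs: "set xs \<subseteq> idom I M"
    have wf: "wf_fm L (fun_fm I g)" "fv (fun_fm I g) \<subseteq> {..<Suc (length xs)}"
      using wfI ar by (auto simp: wf_interp_def)
    have *: "(\<exists>w\<in>idom I M. sat_list M (xs @ [w]) (fun_fm I g)) \<and>
       (sat_list M (xs @ [u]) (fun_fm I g) \<longrightarrow> sat_list M (xs @ [v]) (fun_fm I g) \<longrightarrow> (u, v) \<in> ?E)"
      if uv: "u \<in> idom I M" "v \<in> idom I M" for u v
    proof -
      have "countable (set xs \<union> {u, v})" "set xs \<union> {u, v} \<subseteq> univ M"
        using xs uv idomM by (auto intro: countable_finite)
      from sub[OF this] obtain X k and N :: "('f, 'r, nat) struct" where
        X: "set xs \<union> {u, v} \<subseteq> X" "bij_betw k (univ N) X"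
        and el: "\<And>xs \<phi>. set xs \<subseteq> univ N \<Longrightarrow> wf_fm L \<phi> \<Longrightarrow> fv \<phi> \<subseteq> {..<length xs} \<Longrightarrow>
           sat_list M (map k xs) \<phi> = sat_list N xs \<phi>"
        and dom: "idom I N = {x \<in> univ N. k x \<in> idom I M}"
        and eq: "ieq I N = {(x, y). x \<in> univ N \<and> y \<in> univ N \<and> (k x, k y) \<in> ?E}"
        and dq: "defines_quotient L' I N" by blast
      obtain xs' where xs': "set xs' \<subseteq> univ N" "xs = map k xs'"
        using lift_list[of xs k "univ N"] X by (auto simp: bij_betw_def)
      obtain u' v' where uv': "u' \<in> univ N" "u = k u'" "v' \<in> univ N" "v = k v'"
        using X by (auto simp: bij_betw_def)
      have el': "sat_list M (xs @ [k w]) (fun_fm I g) = sat_list N (xs' @ [w]) (fun_fm I g)"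
        if "w \<in> univ N" for w
        using el[of "xs' @ [w]" "fun_fm I g"] wf xs' that by simp
      have "set xs' \<subseteq> idom I N" using xs' xs dom by auto
      moreover have "fun_arity L' g = Some (length xs')" using ar xs' by simp
      ultimately have "\<exists>w\<in>idom I N. sat_list N (xs' @ [w]) (fun_fm I g)"
        and "\<forall>u\<in>idom I N. \<forall>v\<in>idom I N. sat_list N (xs' @ [u]) (fun_fm I g) \<longrightarrow>
           sat_list N (xs' @ [v]) (fun_fm I g) \<longrightarrow> (u, v) \<in> ieq I N"
        using dq unfolding defines_quotient_def by blast+
      then show ?thesis using el' uv uv' unfolding dom eq by auto
    qed
    show "\<exists>u\<in>idom I M. sat_list M (xs @ [u]) (fun_fm I g)" using * ne by blast
    show "\<forall>u\<in>idom I M. \<forall>v\<in>idom I M. sat_list M (xs @ [u]) (fun_fm I g) \<longrightarrow>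
           sat_list M (xs @ [v]) (fun_fm I g) \<longrightarrow> (u, v) \<in> ?E" using * by blast
  qed
  have eqvM: "equiv (idom I M) ?E" using dq by (simp add: defines_quotient_def)
  show "models L' S ?Q"
    unfolding models_def
  proof (intro conjI ballI allI impI is_struct_quotient[OF dq])
    fix \<psi> and E :: "nat \<Rightarrow> 'a set" assume \<psi>: "\<psi> \<in> S" and E: "range E \<subseteq> univ ?Q"
    have "\<exists>x\<in>idom I M. E i = ?E `` {x}" for i
    proof -
      have "E i \<in> idom I M // ?E" using E by (auto simp: quotient_struct_def)
      then show ?thesis by (auto simp: quotient_def)
    qed
    then obtain r where r: "\<And>i. r i \<in> idom I M" "\<And>i. E i = ?E `` {r i}" by metis
    have "countable (range r)" "range r \<subseteq> univ M" using r idomM by auto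
    from sub[OF this] obtain X k and N :: "('f, 'r, nat) struct" where
      X: "range r \<subseteq> X" and clG: "\<And>\<psi> xs. set xs \<subseteq> X \<Longrightarrow> G \<psi> xs \<in> X" and k: "bij_betw k (univ N) X"
      and el: "\<And>xs \<phi>. set xs \<subseteq> univ N \<Longrightarrow> wf_fm L \<phi> \<Longrightarrow> fv \<phi> \<subseteq> {..<length xs} \<Longrightarrow>
         sat_list M (map k xs) \<phi> = sat_list N xs \<phi>"
      and dom: "idom I N = {x \<in> univ N. k x \<in> idom I M}"
      and eq: "ieq I N = {(x, y). x \<in> univ N \<and> y \<in> univ N \<and> (k x, k y) \<in> ?E}"
      and dqN: "defines_quotient L' I N" and QN: "models L' S (quotient_struct I N)" by blast
    let ?F = "ieq I N"
    let ?QN = "quotient_struct I N"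
    have eqvN: "equiv (idom I N) ?F" using dqN by (simp add: defines_quotient_def)
    define j where "j c = ?E `` (k ` c)" for c
    have j: "j (?F `` {x}) = ?E `` {k x}" if "x \<in> idom I N" for x
    proof -
      have kx: "x \<in> univ N" "k x \<in> idom I M" using that dom by auto
      then have "(x, x) \<in> ?F" using eqvN that by (auto simp: equiv_def refl_on_def)
      moreover have "(k x, z) \<in> ?E" if "(x, y) \<in> ?F" "(k y, z) \<in> ?E" for y z
        using that eqvM unfolding eq equiv_def trans_def by blast
      ultimately show ?thesis unfolding j_def by blast
    qed
    have reps: "\<exists>x\<in>idom I N. c = ?F `` {x}" if "c \<in> univ ?QN" for c
      using that by (auto simp: quotient_struct_def quotient_def)
    have reps_list: "\<exists>xs. set xs \<subseteq> idom I N \<and> cs = map (\<lambda>x. ?F `` {x}) xs" if "set cs \<subseteq> univ ?QN" for cs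
      using that
    proof (induction cs)
      case (Cons c cs)
      then have "c \<in> univ ?QN" "\<exists>xs. set xs \<subseteq> idom I N \<and> cs = map (\<lambda>x. ?F `` {x}) xs" by auto
      moreover from this(1) obtain x where "x \<in> idom I N" "c = ?F `` {x}" using reps by blast
      ultimately obtain xs x where "set xs \<subseteq> idom I N" "cs = map (\<lambda>x. ?F `` {x}) xs"
        "x \<in> idom I N" "c = ?F `` {x}" by blast
      then show ?case by (intro exI[of _ "x # xs"]) auto
    qed simp
    have map_j: "map j (map (\<lambda>x. ?F `` {x}) xs) = map (\<lambda>x. ?E `` {x}) (map k xs)" if "set xs \<subseteq> idom I N" for xs
      using that j by auto
    have kdom: "set (map k xs) \<subseteq> idom I M" "set xs \<subseteq> univ N" if "set xs \<subseteq> idom I N" for xs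
      using that dom by auto
    have main: "sat ?Q (j \<circ> e) \<phi> = sat ?QN e \<phi>" if "wf_fm L' \<phi>" "range e \<subseteq> univ ?QN" for \<phi> e
      using that
    proof (rule tarski_vaught[OF is_struct_quotient[OF dqN], rotated -2])
      show "j ` univ ?QN \<subseteq> univ ?Q"
      proof
        fix z assume "z \<in> j ` univ ?QN"
        then obtain x where "x \<in> idom I N" "z = ?E `` {k x}" using reps j by blast
        then show "z \<in> univ ?Q" using dom by (auto simp: quotient_struct_def intro: quotientI)
      qed
      show "inj_on j (univ ?QN)"
      proof (rule inj_onI)
        fix c d assume "c \<in> univ ?QN" "d \<in> univ ?QN" and jj: "j c = j d"
        then obtain x y where x: "x \<in> idom I N" "c = ?F `` {x}" and y: "y \<in> idom I N" "d = ?F `` {y}"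
          using reps by meson
        then have "?E `` {k x} = ?E `` {k y}" using jj j by simp
        then have "(k x, k y) \<in> ?E" using x y dom eq_equiv_class[OF _ eqvM] by blast
        then have "(x, y) \<in> ?F" using x y dom eq by auto
        then show "c = d" using x y equiv_class_eq[OF eqvN] by simp
      qed
      show "fun_int ?Q g (map j cs) = j (fun_int ?QN g cs)"
        if ar: "fun_arity L' g = Some (length cs)" and cs: "set cs \<subseteq> univ ?QN" for g cs
      proof -
        obtain xs where xs: "set xs \<subseteq> idom I N" "cs = map (\<lambda>x. ?F `` {x}) xs" using reps_list[OF cs] by blast
        have arx: "fun_arity L' g = Some (length xs)" using ar xs by simp
        then obtain u where u: "u \<in> idom I N" "sat_list N (xs @ [u]) (fun_fm I g)"
          using dqN xs(1) unfolding defines_quotient_def by meson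
        have "wf_fm L (fun_fm I g)" "fv (fun_fm I g) \<subseteq> {..<Suc (length xs)}"
          using wfI arx by (auto simp: wf_interp_def)
        then have uM: "sat_list M (map k xs @ [k u]) (fun_fm I g)"
          using el[of "xs @ [u]" "fun_fm I g"] xs u dom by auto
        have arM: "fun_arity L' g = Some (length (map k xs))" using arx by simp
        have kuM: "k u \<in> idom I M" using u dom by simp
        have "fun_int ?QN g cs = ?F `` {u}"
          unfolding xs(2) by (rule quotient_struct_reps(2)[OF dqN xs(1) arx u])
        moreover have "fun_int ?Q g (map j cs) = ?E `` {k u}"
          unfolding xs(2) map_j[OF xs(1)]
          by (rule quotient_struct_reps(2)[OF dq kdom(1)[OF xs(1)] arM kuM uM])
        ultimately show ?thesis using j u by simp
      qed
      show "rel_int ?Q s (map j cs) = rel_int ?QN s cs"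
        if ar: "rel_arity L' s = Some (length cs)" and cs: "set cs \<subseteq> univ ?QN" for s cs
      proof -
        obtain xs where xs: "set xs \<subseteq> idom I N" "cs = map (\<lambda>x. ?F `` {x}) xs" using reps_list[OF cs] by blast
        have arx: "rel_arity L' s = Some (length xs)" using ar xs by simp
        have arM: "rel_arity L' s = Some (length (map k xs))" using arx by simp
        have "wf_fm L (rel_fm I s)" "fv (rel_fm I s) \<subseteq> {..<length xs}"
          using wfI arx by (auto simp: wf_interp_def)
        then have "sat_list M (map k xs) (rel_fm I s) = sat_list N xs (rel_fm I s)"
          by (intro el kdom(2) xs)
        then show ?thesis
          unfolding xs(2) map_j[OF xs(1)] quotient_struct_reps(1)[OF dqN xs(1) arx]
            quotient_struct_reps(1)[OF dq kdom(1)[OF xs(1)] arM] .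
      qed
      fix \<phi> :: "('g, 's) fm" and e :: "nat \<Rightarrow> nat set" and b
      assume e: "range e \<subseteq> univ ?QN" and b: "b \<in> univ ?Q" "sat ?Q (case_nat b (j \<circ> e)) \<phi>"
      have "\<exists>x\<in>idom I N. e i = ?F `` {x}" for i using e reps by blast
      then obtain q where q: "\<And>i. q i \<in> idom I N" "\<And>i. e i = ?F `` {q i}" by metis
      obtain a where a: "a \<in> idom I M" "b = ?E `` {a}"
        using b(1) by (auto simp: quotient_struct_def quotient_def)
      obtain xs where xs: "set xs \<subseteq> range (k \<circ> q)" "\<And>i. Suc i \<in> fv \<phi> \<Longrightarrow> pad c xs i = (k \<circ> q) i"
        using pad_agrees[of "k \<circ> q" \<phi> c] by metis
      have eqs: "sat ?Q (case_nat z ((\<lambda>x. ?E `` {x}) \<circ> pad c xs)) \<phi> = sat ?Q (case_nat z (j \<circ> e)) \<phi>" for z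
        using xs(2) q j by (intro sat_cong) (auto split: nat.split)
      have ex: "\<exists>a. P \<phi> xs a" using a b(2) eqs unfolding P_def by blast
      have "k (q i) \<in> X" for i using q(1)[of i] dom k by (auto simp: bij_betw_def)
      then have "range (k \<circ> q) \<subseteq> X" by auto
      then have "set xs \<subseteq> X" using xs(1) by (rule subset_trans[rotated])
      then have "G \<phi> xs \<in> X" by (rule clG)
      then obtain w where w: "w \<in> univ N" "G \<phi> xs = k w" using k unfolding bij_betw_def by blast
      have "P \<phi> xs (G \<phi> xs)" using ex someI_ex[OF ex] by (simp add: G_def)
      then have "P \<phi> xs (k w)" using w(2) by simp
      then have "w \<in> idom I N" "sat ?Q (case_nat (?E `` {k w}) (j \<circ> e)) \<phi>"
        using w(1) dom eqs by (auto simp: P_def)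
      then show "\<exists>a\<in>univ ?QN. sat ?Q (case_nat (j a) (j \<circ> e)) \<phi>"
        using j by (intro bexI[of _ "?F `` {w}"]) (auto simp: quotient_struct_def intro: quotientI)
    qed
    have "r i \<in> k ` univ N" for i using X k by (auto simp: bij_betw_def)
    then have "\<exists>x. x \<in> univ N \<and> k x = r i" for i by (metis imageE)
    then obtain q where q: "\<And>i. q i \<in> univ N" "\<And>i. k (q i) = r i" by metis
    then have qd: "q i \<in> idom I N" for i using r(1) dom by simp
    let ?e = "\<lambda>i. ?F `` {q i}"
    have rng: "range ?e \<subseteq> univ ?QN" using qd by (auto simp: quotient_struct_def intro: quotientI)
    then have "sat ?QN ?e \<psi>" using QN \<psi> unfolding models_def by blast
    then have "sat ?Q (j \<circ> ?e) \<psi>" using main[OF wfS[OF \<psi>] rng] by simp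
    moreover have "j \<circ> ?e = E" using j[OF qd] q r by (auto simp: fun_eq_iff)
    ultimately show "sat ?Q E \<psi>" by simp
  qed
qed


section \<open>Formula hierarchies\<close>

text \<open>\<open>G\<close> is the set of guards of bounded quantifiers; the bound variable is \<open>0\<close>.\<close>

inductive_set Delta0 :: "('f, 'r) fm set \<Rightarrow> ('f, 'r) fm set" for G :: "('f, 'r) fm set" where
  "Rel r ts \<in> Delta0 G"
| "Eq s t \<in> Delta0 G"
| "\<phi> \<in> Delta0 G \<Longrightarrow> Neg \<phi> \<in> Delta0 G"
| "\<phi> \<in> Delta0 G \<Longrightarrow> \<psi> \<in> Delta0 G \<Longrightarrow> Conj \<phi> \<psi> \<in> Delta0 G"
| "\<phi> \<in> Delta0 G \<Longrightarrow> \<psi> \<in> Delta0 G \<Longrightarrow> Disj \<phi> \<psi> \<in> Delta0 G"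
| "\<phi> \<in> Delta0 G \<Longrightarrow> \<psi> \<in> Delta0 G \<Longrightarrow> Imp \<phi> \<psi> \<in> Delta0 G"
| "\<gamma> \<in> G \<Longrightarrow> \<phi> \<in> Delta0 G \<Longrightarrow> All (Imp \<gamma> \<phi>) \<in> Delta0 G"
| "\<gamma> \<in> G \<Longrightarrow> \<phi> \<in> Delta0 G \<Longrightarrow> Ex (Conj \<gamma> \<phi>) \<in> Delta0 G"

text \<open>Quantifier blocks may be empty.\<close>

fun Sigma_over :: "('f, 'r) fm set \<Rightarrow> nat \<Rightarrow> ('f, 'r) fm set"
  and Pi_over :: "('f, 'r) fm set \<Rightarrow> nat \<Rightarrow> ('f, 'r) fm set" where
  "Sigma_over D 0 = D"
| "Sigma_over D (Suc n) = {(Ex ^^ k) \<phi> | k \<phi>. \<phi> \<in> Pi_over D n}"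
| "Pi_over D 0 = D"
| "Pi_over D (Suc n) = {(All ^^ k) \<phi> | k \<phi>. \<phi> \<in> Sigma_over D n}"


section \<open>Set theory\<close>

datatype set_rel = Elem

definition set_lang :: "(unit, set_rel) signature" where
  "set_lang = \<lparr> fun_arity = (\<lambda>_. None), rel_arity = (\<lambda>_. Some 2) \<rparr>"

type_synonym set_fm = "(unit, set_rel) fm"

abbreviation Mem :: "nat \<Rightarrow> nat \<Rightarrow> set_fm" where
  "Mem i j \<equiv> Rel Elem [Var i, Var j]"

abbreviation EqV :: "nat \<Rightarrow> nat \<Rightarrow> set_fm" where
  "EqV i j \<equiv> Eq (Var i) (Var j)"

definition set_Delta0 :: "set_fm set" where
  "set_Delta0 = {\<phi>. wf_fm set_lang \<phi> \<and> \<phi> \<in> Delta0 {Mem 0 (Suc j) | j. True}}"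

definition set_Sigma :: "nat \<Rightarrow> set_fm set" where
  "set_Sigma n = Sigma_over set_Delta0 n"

definition ax_extensionality :: set_fm where
  "ax_extensionality = Imp (All (Iff (Mem 0 1) (Mem 0 2))) (EqV 0 1)"

definition ax_empty :: set_fm where
  "ax_empty = Ex (All (Neg (Mem 0 1)))"

definition ax_pairing :: set_fm where
  "ax_pairing = Ex (All (Iff (Mem 0 1) (Disj (EqV 0 2) (EqV 0 3))))"

definition ax_difference :: set_fm where
  "ax_difference = Ex (All (Iff (Mem 0 1) (Conj (Mem 0 2) (Neg (Mem 0 3)))))"

definition ax_union :: set_fm where
  "ax_union = Ex (All (Iff (Mem 0 1) (Ex (Conj (Mem 0 3) (Mem 1 0)))))"

text \<open>In \<open>\<phi>\<close>, variable \<open>0\<close> is the element \<open>x\<close> to be tested, variable \<open>1\<close> is the given set \<open>a\<close>, and the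
  others are further parameters. The substitution makes room for the separated set, which is
  variable \<open>1\<close> inside the axiom and thus does not occur in the instance of \<open>\<phi>\<close>.\<close>

definition ax_separation :: "set_fm \<Rightarrow> set_fm" where
  "ax_separation \<phi> =
     Ex (All (Iff (Mem 0 1)
       (Conj (Mem 0 2) (subst_fm (case_nat (Var 0) (\<lambda>i. Var (Suc (Suc i)))) \<phi>))))"

definition Sep :: "set_fm set \<Rightarrow> set_fm set" where
  "Sep \<Gamma> = ax_separation ` \<Gamma>"

definition ReS0 :: "set_fm set" where
  "ReS0 = {ax_extensionality, ax_empty, ax_pairing, ax_difference, ax_union} \<union> Sep set_Delta0"

instance set_rel :: countable by countable_datatype

lemma wf_subst_tm: "wf_tm L t \<Longrightarrow> (\<And>i. wf_tm L (\<sigma> i)) \<Longrightarrow> wf_tm L (subst_tm \<sigma> t)"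
  by (induction t) (auto simp: list_all_iff)

lemma wf_subst_fm: "wf_fm L \<phi> \<Longrightarrow> (\<And>i. wf_tm L (\<sigma> i)) \<Longrightarrow> wf_fm L (subst_fm \<sigma> \<phi>)"
  by (induction \<phi> arbitrary: \<sigma>) (auto simp: list_all_iff wf_subst_tm split: nat.split)

lemma wf_quantifiers: "wf_fm L ((Ex ^^ k) \<phi>) = wf_fm L \<phi>" "wf_fm L ((All ^^ k) \<phi>) = wf_fm L \<phi>"
  by (induction k) auto

lemma wf_hierarchy:
  assumes "\<And>\<phi>. \<phi> \<in> D \<Longrightarrow> wf_fm L \<phi>"
  shows "(\<forall>\<phi>\<in>Sigma_over D n. wf_fm L \<phi>) \<and> (\<forall>\<phi>\<in>Pi_over D n. wf_fm L \<phi>)"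
  using assms by (induction n) (auto simp: wf_quantifiers)

lemma wf_set_theory: "\<phi> \<in> ReS0 \<union> Sep (set_Sigma n) \<Longrightarrow> wf_fm set_lang \<phi>"
proof -
  have "wf_fm set_lang (ax_separation \<psi>)" if "wf_fm set_lang \<psi>" for \<psi>
  proof -
    have "wf_fm set_lang (subst_fm (case_nat (Var 0) (\<lambda>i. Var (Suc (Suc i)))) \<psi>)"
      by (rule wf_subst_fm[OF that]) (simp split: nat.split)
    then show ?thesis by (simp add: ax_separation_def) (simp add: set_lang_def)
  qed
  moreover have "wf_fm set_lang \<psi>" if "\<psi> \<in> set_Delta0 \<union> set_Sigma n" for \<psi>
  proof -
    have D: "wf_fm set_lang \<phi>" if "\<phi> \<in> set_Delta0" for \<phi>
      using that by (simp add: set_Delta0_def)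
    then have "\<forall>\<phi>\<in>set_Sigma n. wf_fm set_lang \<phi>"
      unfolding set_Sigma_def using wf_hierarchy by blast
    then show ?thesis using D that by blast
  qed
  moreover have "\<forall>\<psi>\<in>{ax_extensionality, ax_empty, ax_pairing, ax_difference, ax_union}. wf_fm set_lang \<psi>"
    by (simp add: ax_extensionality_def ax_empty_def ax_pairing_def ax_difference_def ax_union_def
        set_lang_def)
  ultimately show "\<phi> \<in> ReS0 \<union> Sep (set_Sigma n) \<Longrightarrow> wf_fm set_lang \<phi>"
    unfolding ReS0_def Sep_def by blast
qed


section \<open>Arithmetic\<close>

datatype arith_fun = Zero | One | Add | Mult

datatype arith_rel = Less

definition arith_lang :: "(arith_fun, arith_rel) signature" where
  "arith_lang =
     \<lparr> fun_arity = (\<lambda>f. case f of Zero \<Rightarrow> Some 0 | One \<Rightarrow> Some 0 | Add \<Rightarrow> Some 2 | Mult \<Rightarrow> Some 2),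
       rel_arity = (\<lambda>_. Some 2) \<rparr>"

type_synonym arith_tm = "arith_fun tm"
type_synonym arith_fm = "(arith_fun, arith_rel) fm"

abbreviation zero_tm :: arith_tm where "zero_tm \<equiv> Fn Zero []"
abbreviation one_tm :: arith_tm where "one_tm \<equiv> Fn One []"
abbreviation add_tm :: "arith_tm \<Rightarrow> arith_tm \<Rightarrow> arith_tm" where "add_tm s t \<equiv> Fn Add [s, t]"
abbreviation mult_tm :: "arith_tm \<Rightarrow> arith_tm \<Rightarrow> arith_tm" where "mult_tm s t \<equiv> Fn Mult [s, t]"
abbreviation less_fm :: "arith_tm \<Rightarrow> arith_tm \<Rightarrow> arith_fm" where "less_fm s t \<equiv> Rel Less [s, t]"

text \<open>The bound of a bounded quantifier is a term in which the bound variable does not occur.\<close>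

definition arith_Delta0 :: "arith_fm set" where
  "arith_Delta0 = {\<phi>. wf_fm arith_lang \<phi> \<and> \<phi> \<in> Delta0 {less_fm (Var 0) (lift_tm t) | t. True}}"

definition arith_Sigma :: "nat \<Rightarrow> arith_fm set" where
  "arith_Sigma n = Sigma_over arith_Delta0 n"

text \<open>The usual axioms for the nonnegative parts of discretely ordered rings (as in Kaye's
  \<^emph>\<open>Models of Peano Arithmetic\<close>).\<close>

definition PA_minus :: "arith_fm set" where
  "PA_minus =
    (let x = Var 0; y = Var 1; z = Var 2 in
     { Eq (add_tm (add_tm x y) z) (add_tm x (add_tm y z)),
       Eq (add_tm x y) (add_tm y x),
       Eq (mult_tm (mult_tm x y) z) (mult_tm x (mult_tm y z)),
       Eq (mult_tm x y) (mult_tm y x),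
       Eq (mult_tm x (add_tm y z)) (add_tm (mult_tm x y) (mult_tm x z)),
       Eq (add_tm x zero_tm) x,
       Eq (mult_tm x zero_tm) zero_tm,
       Eq (mult_tm x one_tm) x,
       Imp (Conj (less_fm x y) (less_fm y z)) (less_fm x z),
       Neg (less_fm x x),
       Disj (less_fm x y) (Disj (Eq x y) (less_fm y x)),
       Imp (less_fm x y) (less_fm (add_tm x z) (add_tm y z)),
       Imp (Conj (less_fm zero_tm z) (less_fm x y)) (less_fm (mult_tm x z) (mult_tm y z)),
       Imp (less_fm x y) (Ex (Eq (add_tm (lift_tm x) (Var 0)) (lift_tm y))),
       less_fm zero_tm one_tm,
       Imp (less_fm zero_tm x) (Disj (less_fm one_tm x) (Eq one_tm x)),
       Disj (less_fm zero_tm x) (Eq zero_tm x) })"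

text \<open>Induction on variable \<open>0\<close> of \<open>\<phi>\<close>; the other variables are parameters.\<close>

definition ax_induction :: "arith_fm \<Rightarrow> arith_fm" where
  "ax_induction \<phi> =
     Imp (Conj (subst_fm (case_nat zero_tm Var) \<phi>)
           (All (Imp \<phi> (subst_fm (case_nat (add_tm (Var 0) one_tm) (\<lambda>i. Var (Suc i))) \<phi>))))
       (All \<phi>)"

definition ISigma :: "nat \<Rightarrow> arith_fm set" where
  "ISigma n = PA_minus \<union> ax_induction ` arith_Sigma n"

instance arith_fun :: countable by countable_datatype

instance arith_rel :: countable by countable_datatype

lemma wf_ISigma: "\<phi> \<in> ISigma n \<Longrightarrow> wf_fm arith_lang \<phi>"
proof -
  have "wf_fm arith_lang (ax_induction \<psi>)" if "wf_fm arith_lang \<psi>" for \<psi>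
    unfolding ax_induction_def wf_fm.simps
    by (intro conjI wf_subst_fm that) (simp_all add: arith_lang_def split: nat.split)
  moreover have "wf_fm arith_lang \<psi>" if "\<psi> \<in> arith_Sigma n" for \<psi>
  proof -
    have D: "wf_fm arith_lang \<phi>" if "\<phi> \<in> arith_Delta0" for \<phi>
      using that by (simp add: arith_Delta0_def)
    then have "\<forall>\<phi>\<in>arith_Sigma n. wf_fm arith_lang \<phi>"
      unfolding arith_Sigma_def using wf_hierarchy by blast
    then show ?thesis using D that by blast
  qed
  moreover have "\<forall>\<psi>\<in>PA_minus. wf_fm arith_lang \<psi>"
    by (simp add: PA_minus_def Let_def arith_lang_def)
  ultimately show "\<phi> \<in> ISigma n \<Longrightarrow> wf_fm arith_lang \<phi>"
    unfolding ISigma_def by blast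
qed

end

theory Submission
  imports Defs
begin

text \<open>Call \<open>x\<close> a number if \<open>\<emptyset> \<in> x + 1\<close> and \<open>y + 1 \<in> x + 1\<close> for all \<open>y \<in> x\<close>, where \<open>y + 1 = y \<union> {y}\<close>, and
  if \<open>x\<close> belongs to every set that contains \<open>\<emptyset>\<close> and contains \<open>y + 1\<close> whenever it contains \<open>y \<in> x\<close>.
  Separation on \<open>x + 1\<close> yields induction on numbers for \<open>\<Sigma>\<^sub>n\<close> and \<open>\<Pi>\<^sub>n\<close> formulas of set theory.

  Without Foundation this definition is \<open>\<Pi>\<^sub>1\<close>, so that relativising the quantifiers of an arithmetical
  \<open>\<Sigma>\<^sub>n\<close> formula to the numbers seems to lead out of \<open>\<Sigma>\<^sub>n\<close>. But in every model the numbers are \<open>\<Delta>\<^sub>0\<close>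
  with a parameter: either the first, \<open>\<Delta>\<^sub>0\<close> part of the definition suffices, or some \<open>x\<close> satisfies it
  without being a number. In the latter case every number is an element of \<open>x\<close> by induction, and so
  the numbers form a set by \<open>\<Pi>\<^sub>1\<close> separation.

  Addition and multiplication are defined by recursion along set functions. Their graphs are \<open>\<Sigma>\<^sub>1\<close>, and
  \<open>\<Sigma>\<^sub>1\<close> induction gives totality as well as \<open>\<Sigma>\<^sub>1\<close> collection on numbers. Hence arithmetical \<open>\<Delta>\<^sub>0\<close>
  formulas become \<open>\<Delta>\<^sub>1\<close> on numbers and \<open>\<Sigma>\<^sub>n\<close> formulas become \<open>\<Sigma>\<^sub>n\<close>.\<close>

section \<open>Definability with parameters\<close>

lemma eval_subst: "eval M e (subst_tm \<sigma> t) = eval M (\<lambda>i. eval M e (\<sigma> i)) t"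
proof (induction t)
  case (Fn f ts)
  then have "map (eval M e) (map (subst_tm \<sigma>) ts) = map (eval M (\<lambda>i. eval M e (\<sigma> i))) ts"
    by simp
  then show ?case by (simp del: map_map map_eq_conv)
qed simp

lemma eval_up: "eval M (case_nat a e) (up \<sigma> i) = case_nat a (\<lambda>i. eval M e (\<sigma> i)) i"
  by (simp add: eval_subst split: nat.split)

lemma sat_subst: "sat M e (subst_fm \<sigma> \<phi>) = sat M (\<lambda>i. eval M e (\<sigma> i)) \<phi>"
proof (induction \<phi> arbitrary: e \<sigma>)
  case (Rel r ts)
  have "map (eval M e) (map (subst_tm \<sigma>) ts) = map (eval M (\<lambda>i. eval M e (\<sigma> i))) ts"
    by (simp add: eval_subst)
  then show ?case by (simp del: map_map map_eq_conv)
qed (simp_all only: subst_fm.simps sat.simps eval_subst eval_up)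

abbreviation rename :: "(nat \<Rightarrow> nat) \<Rightarrow> ('f, 'r) fm \<Rightarrow> ('f, 'r) fm" where
  "rename r \<equiv> subst_fm (\<lambda>i. Var (r i))"

lemma up_rename: "case_nat (Var 0) (\<lambda>i. Var (Suc (r i))) = (\<lambda>i. Var (case_nat 0 (\<lambda>i. Suc (r i)) i))"
  by (rule ext) (simp split: nat.split)

text \<open>Under a binder a renaming fixes 0 and sends successors to successors, so a guard
  \<open>Mem 0 (Suc j)\<close> becomes another guard of this form.\<close>

lemma rename_set_Delta0:
  assumes "\<phi> \<in> set_Delta0"
  shows "rename r \<phi> \<in> set_Delta0"
proof -
  have "rename r \<phi> \<in> Delta0 {Mem 0 (Suc j) | j. True}"
    if "\<phi> \<in> Delta0 {Mem 0 (Suc j) | j. True}" for \<phi> :: set_fm and r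
    using that
  proof (induction \<phi> arbitrary: r)
    case (7 \<gamma> \<phi>)
    then show ?case by (auto simp: up_rename intro!: Delta0.intros(7))
  next
    case (8 \<gamma> \<phi>)
    then show ?case by (auto simp: up_rename intro!: Delta0.intros(8))
  qed (auto intro: Delta0.intros)
  then show ?thesis using assms by (auto simp: set_Delta0_def intro: wf_subst_fm)
qed

lemma rename_quantifiers:
  "\<exists>r'. rename r ((Ex ^^ k) \<phi>) = (Ex ^^ k) (rename r' \<phi>)"
  "\<exists>r'. rename r ((All ^^ k) \<phi>) = (All ^^ k) (rename r' \<phi>)"
  by (induction k arbitrary: r) (simp_all add: up_rename exI[of _ r], metis+)

lemma rename_hierarchy:
  assumes "\<And>\<phi> r. \<phi> \<in> D \<Longrightarrow> rename r \<phi> \<in> D"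
  shows "(\<forall>\<phi>\<in>Sigma_over D k. \<forall>r. rename r \<phi> \<in> Sigma_over D k) \<and>
    (\<forall>\<phi>\<in>Pi_over D k. \<forall>r. rename r \<phi> \<in> Pi_over D k)"
proof (induction k)
  case (Suc k)
  show ?case
  proof (intro conjI ballI allI)
    fix \<phi> r assume "\<phi> \<in> Sigma_over D (Suc k)"
    then obtain m \<psi> where "\<phi> = (Ex ^^ m) \<psi>" "\<psi> \<in> Pi_over D k" by auto
    then show "rename r \<phi> \<in> Sigma_over D (Suc k)"
      using rename_quantifiers(1)[of r m \<psi>] Suc by fastforce
  next
    fix \<phi> r assume "\<phi> \<in> Pi_over D (Suc k)"
    then obtain m \<psi> where "\<phi> = (All ^^ m) \<psi>" "\<psi> \<in> Sigma_over D k" by auto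
    then show "rename r \<phi> \<in> Pi_over D (Suc k)"
      using rename_quantifiers(2)[of r m \<psi>] Suc by fastforce
  qed
qed (use assms in auto)

section \<open>Predicates definable with parameters\<close>

locale set_struct =
  fixes M :: "(unit, set_rel, 'a) struct"
begin

abbreviation U :: "'a set" where "U \<equiv> univ M"

abbreviation E :: "'a \<Rightarrow> 'a \<Rightarrow> bool" where "E x y \<equiv> rel_int M Elem [x, y]"

text \<open>Definable predicates on environments are handled without syntax: the free variables of the defining
  formula are filled either with entries of the environment or with parameters from the model.\<close>

definition tv :: "((nat \<Rightarrow> 'a) \<Rightarrow> 'a) \<Rightarrow> bool" where
  "tv t \<longleftrightarrow> (\<exists>i. t = (\<lambda>e. e i)) \<or> (\<exists>c\<in>U. t = (\<lambda>_. c))"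

definition Def :: "set_fm set \<Rightarrow> ((nat \<Rightarrow> 'a) \<Rightarrow> bool) \<Rightarrow> bool" where
  "Def C P \<longleftrightarrow> (\<exists>\<phi>\<in>C. \<exists>\<tau>. (\<forall>i. tv (\<tau> i)) \<and> (\<forall>e. range e \<subseteq> U \<longrightarrow> P e = sat M (\<lambda>i. \<tau> i e) \<phi>))"

abbreviation "D0 \<equiv> Def set_Delta0"

lemma tv_proj [intro!, simp]: "tv (\<lambda>e. e i)"
  by (auto simp: tv_def)

lemma tv_const [intro, simp]: "c \<in> U \<Longrightarrow> tv (\<lambda>_. c)"
  by (auto simp: tv_def)

lemma tv_in: "tv t \<Longrightarrow> range e \<subseteq> U \<Longrightarrow> t e \<in> U"
  by (auto simp: tv_def)

lemma tv_shift: "tv t \<Longrightarrow> tv (\<lambda>e. t (\<lambda>i. e (Suc i)))"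
  by (auto simp: tv_def)

lemma tv_comp: "tv t \<Longrightarrow> (\<And>i. tv (\<tau> i)) \<Longrightarrow> tv (\<lambda>e. t (\<lambda>i. \<tau> i e))"
  by (auto simp: tv_def)

lemma env_cons: "a \<in> U \<Longrightarrow> range e \<subseteq> U \<Longrightarrow> range (case_nat a e) \<subseteq> U"
  by (simp add: image_subset_iff split: nat.split)

lemma Def_cong: "Def C P \<Longrightarrow> (\<And>e. range e \<subseteq> U \<Longrightarrow> P e = Q e) \<Longrightarrow> Def C Q"
  unfolding Def_def by metis

lemma DefI: "\<phi> \<in> C \<Longrightarrow> (\<And>i. tv (\<tau> i)) \<Longrightarrow> (\<And>e. range e \<subseteq> U \<Longrightarrow> P e = sat M (\<lambda>i. \<tau> i e) \<phi>) \<Longrightarrow> Def C P"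
  unfolding Def_def by blast

lemma Def_subst:
  assumes "Def C P" "\<And>i. tv (\<tau> i)"
  shows "Def C (\<lambda>e. P (\<lambda>i. \<tau> i e))"
proof -
  obtain \<phi> \<rho> where \<phi>: "\<phi> \<in> C" "\<And>i. tv (\<rho> i)"
    "\<And>e. range e \<subseteq> U \<Longrightarrow> P e = sat M (\<lambda>i. \<rho> i e) \<phi>"
    using assms(1) unfolding Def_def by blast
  have "range (\<lambda>i. \<tau> i e) \<subseteq> U" if "range e \<subseteq> U" for e using tv_in[OF assms(2) that] by auto
  then show ?thesis unfolding Def_def
    using \<phi> assms(2) by (intro bexI[of _ \<phi>] exI[of _ "\<lambda>i e. \<rho> i (\<lambda>i. \<tau> i e)"]) (auto intro: tv_comp)
qed

text \<open>The variables of the two formulas are made disjoint by sending them to even and odd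
  indices; a single assignment \<open>\<tau>\<close> then serves both.\<close>

lemma Def_combine:
  assumes C: "\<And>\<phi> r. \<phi> \<in> C \<Longrightarrow> rename r \<phi> \<in> C" and P: "Def C P" and Q: "Def C Q"
  shows "\<exists>\<phi>\<in>C. \<exists>\<psi>\<in>C. \<exists>\<tau>. (\<forall>i. tv (\<tau> i)) \<and> (\<forall>e. range e \<subseteq> U \<longrightarrow>
    P e = sat M (\<lambda>i. \<tau> i e) \<phi> \<and> Q e = sat M (\<lambda>i. \<tau> i e) \<psi>)"
proof -
  obtain \<phi> \<rho> where \<phi>: "\<phi> \<in> C" "\<And>i. tv (\<rho> i)"
    "\<And>e. range e \<subseteq> U \<Longrightarrow> P e = sat M (\<lambda>i. \<rho> i e) \<phi>"
    using P unfolding Def_def by blast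
  obtain \<psi> \<pi> where \<psi>: "\<psi> \<in> C" "\<And>i. tv (\<pi> i)"
    "\<And>e. range e \<subseteq> U \<Longrightarrow> Q e = sat M (\<lambda>i. \<pi> i e) \<psi>"
    using Q unfolding Def_def by blast
  show ?thesis
    by (rule bexI[of _ "rename (\<lambda>i. 2 * i) \<phi>"], rule bexI[of _ "rename (\<lambda>i. Suc (2 * i)) \<psi>"],
        rule exI[of _ "\<lambda>i. if even i then \<rho> (i div 2) else \<pi> (i div 2)"])
      (simp_all add: C \<phi> \<psi> sat_subst)
qed

text \<open>Prepares \<open>P\<close> for binding entry 0 of the environment. All variables of the
  formula that stand for this entry are merged into variable 0, and variable 1 is handed to
  \<open>t\<close>, which later is the bound of a guarded quantifier or the set to separate
  from.\<close>

lemma Def_bind: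
  assumes C: "\<And>\<phi> r. \<phi> \<in> C \<Longrightarrow> rename r \<phi> \<in> C" and P: "Def C P" and t: "tv t"
  shows "\<exists>\<phi>\<in>C. \<exists>\<tau>. (\<forall>i. tv (\<tau> i)) \<and> \<tau> 0 = t \<and>
    (\<forall>e z. range e \<subseteq> U \<longrightarrow> z \<in> U \<longrightarrow> P (case_nat z e) = sat M (case_nat z (\<lambda>i. \<tau> i e)) \<phi>)"
proof -
  obtain \<phi> \<rho> where \<phi>: "\<phi> \<in> C" "\<And>i. tv (\<rho> i)"
    "\<And>e. range e \<subseteq> U \<Longrightarrow> P e = sat M (\<lambda>i. \<rho> i e) \<phi>"
    using P unfolding Def_def by blast
  \<comment> \<open>A term other than the projection to entry 0 does not depend on the new entry
    \<open>z\<close>; \<open>\<pi>\<close> is this term read in the environment without it.\<close>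
  have "\<exists>\<pi>. tv \<pi> \<and> (\<rho> i \<noteq> (\<lambda>e. e 0) \<longrightarrow> (\<forall>z e. \<rho> i (case_nat z e) = \<pi> e))" for i
  proof (cases "\<exists>c\<in>U. \<rho> i = (\<lambda>_. c)")
    case True
    then obtain c where "c \<in> U" "\<rho> i = (\<lambda>_. c)" by blast
    then show ?thesis by (intro exI[of _ "\<lambda>_. c"]) simp
  next
    case False
    then obtain j where "\<rho> i = (\<lambda>e. e j)" using \<phi>(2)[of i] unfolding tv_def by blast
    then show ?thesis by (cases j) auto
  qed
  then obtain \<pi> where \<pi>: "\<And>i. tv (\<pi> i)" "\<And>i z e. \<rho> i \<noteq> (\<lambda>e. e 0) \<Longrightarrow> \<rho> i (case_nat z e) = \<pi> i e"
    by metis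
  \<comment> \<open>The shift by two keeps variable 1 free for \<open>t\<close>.\<close>
  let ?r = "\<lambda>i. if \<rho> i = (\<lambda>e. e 0) then 0 else Suc (Suc i)"
  have *: "(\<lambda>i. \<rho> i (case_nat z e)) = (\<lambda>i. case_nat z (\<lambda>i. case_nat t \<pi> i e) (?r i))" for z e
    using \<pi>(2) by (auto simp: fun_eq_iff)
  have "P (case_nat z e) = sat M (case_nat z (\<lambda>i. case_nat t \<pi> i e)) (rename ?r \<phi>)"
    if "range e \<subseteq> U" "z \<in> U" for e z
    unfolding sat_subst eval.simps *[symmetric] using that by (intro \<phi>(3) env_cons)
  moreover have "tv (case_nat t \<pi> i)" for i using t \<pi>(1) by (simp split: nat.split)
  ultimately show ?thesis
    by (intro bexI[of _ "rename ?r \<phi>"] exI[of _ "case_nat t \<pi>"] conjI allI impI C \<phi>(1)) simp_all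
qed

section \<open>Closure properties of \<open>\<Delta>\<^sub>0\<close> predicates\<close>

lemma D0_mem: "tv s \<Longrightarrow> tv t \<Longrightarrow> D0 (\<lambda>e. E (s e) (t e))"
  unfolding Def_def set_Delta0_def
  by (intro bexI[of _ "Mem 0 1"] exI[of _ "case_nat s (\<lambda>_. t)"])
    (auto intro: Delta0.intros simp: set_lang_def split: nat.split)

lemma D0_eq: "tv s \<Longrightarrow> tv t \<Longrightarrow> D0 (\<lambda>e. s e = t e)"
  unfolding Def_def set_Delta0_def
  by (intro bexI[of _ "EqV 0 1"] exI[of _ "case_nat s (\<lambda>_. t)"])
    (auto intro: Delta0.intros simp: set_lang_def split: nat.split)

lemma D0_not: "D0 P \<Longrightarrow> D0 (\<lambda>e. \<not> P e)"
  unfolding Def_def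
proof safe
  fix \<phi> \<tau> assume \<phi>: "\<phi> \<in> set_Delta0" "\<forall>i. tv (\<tau> i)" "\<forall>e. range e \<subseteq> U \<longrightarrow> P e = sat M (\<lambda>i. \<tau> i e) \<phi>"
  then have "Neg \<phi> \<in> set_Delta0" by (auto simp: set_Delta0_def intro: Delta0.intros)
  then show "\<exists>\<phi>\<in>set_Delta0. \<exists>\<tau>. (\<forall>i. tv (\<tau> i)) \<and> (\<forall>e. range e \<subseteq> U \<longrightarrow> (\<not> P e) = sat M (\<lambda>i. \<tau> i e) \<phi>)"
    using \<phi> by (intro bexI[of _ "Neg \<phi>"] exI[of _ \<tau>]) auto
qed

lemma D0_conj: assumes "D0 P" "D0 Q" shows "D0 (\<lambda>e. P e \<and> Q e)"
proof -
  obtain \<phi> \<psi> \<tau> where *: "\<phi> \<in> set_Delta0" "\<psi> \<in> set_Delta0" "\<And>i. tv (\<tau> i)"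
    "\<And>e. range e \<subseteq> U \<Longrightarrow> P e = sat M (\<lambda>i. \<tau> i e) \<phi>"
    "\<And>e. range e \<subseteq> U \<Longrightarrow> Q e = sat M (\<lambda>i. \<tau> i e) \<psi>"
    using Def_combine[OF rename_set_Delta0 assms] by blast
  have "Conj \<phi> \<psi> \<in> set_Delta0" using *(1,2) by (auto simp: set_Delta0_def intro: Delta0.intros)
  then show ?thesis by (rule DefI[OF _ *(3)]) (simp add: *(4,5))
qed

lemma D0_disj: assumes "D0 P" "D0 Q" shows "D0 (\<lambda>e. P e \<or> Q e)"
  by (rule Def_cong[OF D0_not[OF D0_conj[OF D0_not[OF assms(1)] D0_not[OF assms(2)]]]]) simp

lemma D0_imp: assumes "D0 P" "D0 Q" shows "D0 (\<lambda>e. P e \<longrightarrow> Q e)"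
  by (rule Def_cong[OF D0_disj[OF D0_not[OF assms(1)] assms(2)]]) blast

text \<open>The guard is \<open>Mem 0 1\<close>, since \<open>Def_bind\<close> assigns
  \<open>t\<close> to variable 1. Passing the environment and the element to \<open>P\<close>
  separately lets resolution decompose nested bounded quantifiers, with the terms inside shifted by
  one entry.\<close>

lemma D0_ex:
  assumes P: "D0 (\<lambda>e. P (\<lambda>i. e (Suc i)) (e 0))" and t: "tv t"
  shows "D0 (\<lambda>e. \<exists>x\<in>U. E x (t e) \<and> P e x)"
proof -
  obtain \<phi> \<tau> where *: "\<phi> \<in> set_Delta0" "\<And>i. tv (\<tau> i)" "\<tau> 0 = t"
    "\<And>e z. range e \<subseteq> U \<Longrightarrow> z \<in> U \<Longrightarrow>
      P (\<lambda>i. case_nat z e (Suc i)) (case_nat z e 0) = sat M (case_nat z (\<lambda>i. \<tau> i e)) \<phi>"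
    using Def_bind[OF rename_set_Delta0 P t] by blast
  have "Ex (Conj (Mem 0 (Suc 0)) \<phi>) \<in> set_Delta0"
    using *(1) by (auto simp: set_Delta0_def set_lang_def intro!: Delta0.intros(8))
  then show ?thesis by (rule DefI[where \<tau> = \<tau>]) (use * in simp_all)
qed

lemma D0_all:
  assumes P: "D0 (\<lambda>e. P (\<lambda>i. e (Suc i)) (e 0))" and t: "tv t"
  shows "D0 (\<lambda>e. \<forall>x\<in>U. E x (t e) \<longrightarrow> P e x)"
proof (rule Def_cong)
  show "D0 (\<lambda>e. \<not> (\<exists>x\<in>U. E x (t e) \<and> \<not> P e x))"
    by (intro D0_not D0_ex P t)
qed blast

lemmas D0_connectives = D0_not D0_conj D0_disj D0_imp D0_ex D0_all
lemmas D0_atoms = D0_mem D0_eq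

section \<open>The Levy hierarchy of predicates\<close>

text \<open>The flag selects \<open>\<Sigma>\<^sub>k\<close> (\<open>True\<close>) or \<open>\<Pi>\<^sub>k\<close> (\<open>False\<close>).\<close>

inductive H :: "bool \<Rightarrow> nat \<Rightarrow> ((nat \<Rightarrow> 'a) \<Rightarrow> bool) \<Rightarrow> bool" where
  H_D0: "D0 P \<Longrightarrow> H b 0 P"
| H_Suc: "H (\<not> b) k P \<Longrightarrow> H b (Suc k) P"
| H_ex: "H True (Suc k) P \<Longrightarrow> H True (Suc k) (\<lambda>e. \<exists>x\<in>U. P (case_nat x e))"
| H_all: "H False (Suc k) P \<Longrightarrow> H False (Suc k) (\<lambda>e. \<forall>x\<in>U. P (case_nat x e))"
| H_cong: "H b k P \<Longrightarrow> (\<And>e. range e \<subseteq> U \<Longrightarrow> P e = Q e) \<Longrightarrow> H b k Q"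

text \<open>Each rule has a syntactic counterpart: \<open>H_Suc\<close> adds an empty quantifier
  block, and \<open>H_ex\<close> and \<open>H_all\<close> lengthen the outermost block after
  \<open>Def_bind\<close> has moved the quantified entry to variable 0.\<close>

lemma H_representable:
  "H b k P \<Longrightarrow> Def (if b then Sigma_over set_Delta0 k else Pi_over set_Delta0 k) P"
proof (induction rule: H.induct)
  case (H_Suc b k P)
  have "\<phi> \<in> (if b then Sigma_over set_Delta0 (Suc k) else Pi_over set_Delta0 (Suc k))"
    if "\<phi> \<in> (if \<not> b then Sigma_over set_Delta0 k else Pi_over set_Delta0 k)" for \<phi>
    using that by (auto split: if_splits intro: exI[of _ 0])
  then show ?case using H_Suc.IH unfolding Def_def by blast
next
  case (H_ex k P)
  then have D: "Def (Sigma_over set_Delta0 (Suc k)) P" by simp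
  have C: "rename r \<phi> \<in> Sigma_over set_Delta0 (Suc k)" if "\<phi> \<in> Sigma_over set_Delta0 (Suc k)" for \<phi> r
    using that rename_hierarchy[OF rename_set_Delta0] by blast
  obtain \<phi> \<tau> where *: "\<phi> \<in> Sigma_over set_Delta0 (Suc k)" "\<And>i. tv (\<tau> i)"
    "\<And>e z. range e \<subseteq> U \<Longrightarrow> z \<in> U \<Longrightarrow> P (case_nat z e) = sat M (case_nat z (\<lambda>i. \<tau> i e)) \<phi>"
    using Def_bind[OF C D tv_proj[of 0]] by blast
  obtain m \<psi> where "\<phi> = (Ex ^^ m) \<psi>" "\<psi> \<in> Pi_over set_Delta0 k" using *(1) by auto
  then have "Ex \<phi> = (Ex ^^ Suc m) \<psi>" "\<psi> \<in> Pi_over set_Delta0 k" by simp_all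
  then have "Ex \<phi> \<in> Sigma_over set_Delta0 (Suc k)" unfolding Sigma_over.simps by blast
  then have "Def (Sigma_over set_Delta0 (Suc k)) (\<lambda>e. \<exists>x\<in>U. P (case_nat x e))"
    by (rule DefI[where \<tau> = \<tau>]) (use *(2,3) in simp_all)
  then show ?case by simp
next
  case (H_all k P)
  then have D: "Def (Pi_over set_Delta0 (Suc k)) P" by simp
  have C: "rename r \<phi> \<in> Pi_over set_Delta0 (Suc k)" if "\<phi> \<in> Pi_over set_Delta0 (Suc k)" for \<phi> r
    using that rename_hierarchy[OF rename_set_Delta0] by blast
  obtain \<phi> \<tau> where *: "\<phi> \<in> Pi_over set_Delta0 (Suc k)" "\<And>i. tv (\<tau> i)"
    "\<And>e z. range e \<subseteq> U \<Longrightarrow> z \<in> U \<Longrightarrow> P (case_nat z e) = sat M (case_nat z (\<lambda>i. \<tau> i e)) \<phi>"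
    using Def_bind[OF C D tv_proj[of 0]] by blast
  obtain m \<psi> where "\<phi> = (All ^^ m) \<psi>" "\<psi> \<in> Sigma_over set_Delta0 k" using *(1) by auto
  then have "All \<phi> = (All ^^ Suc m) \<psi>" "\<psi> \<in> Sigma_over set_Delta0 k" by simp_all
  then have "All \<phi> \<in> Pi_over set_Delta0 (Suc k)" unfolding Pi_over.simps by blast
  then have "Def (Pi_over set_Delta0 (Suc k)) (\<lambda>e. \<forall>x\<in>U. P (case_nat x e))"
    by (rule DefI[where \<tau> = \<tau>]) (use *(2,3) in simp_all)
  then show ?case by simp
next
  case (H_cong b k P Q)
  show ?case by (rule Def_cong[OF H_cong.IH H_cong.hyps(2)])
qed simp

text \<open>By duality of the rules. Predicates are closed under equivalence by
  \<open>H_cong\<close>, so negations can be pushed through the prefix without computing a prenex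
  form.\<close>

lemma H_not: "H b k P \<Longrightarrow> H (\<not> b) k (\<lambda>e. \<not> P e)"
proof (induction rule: H.induct)
  case (H_ex k P)
  then have "H False (Suc k) (\<lambda>e. \<not> P e)" by simp
  from H_all[OF this] show ?case by (simp only: not_True_eq_False bex_simps(8))
next
  case (H_all k P)
  then have "H True (Suc k) (\<lambda>e. \<not> P e)" by simp
  from H_ex[OF this] show ?case by (simp only: not_False_eq_True ball_simps(10))
next
  case (H_cong b k P Q)
  show ?case by (rule H.H_cong[OF H_cong.IH]) (use H_cong.hyps in simp)
qed (auto intro: H_D0 H_Suc D0_not)

lemma H_D0_any: "D0 P \<Longrightarrow> H b k P"
  by (induction k arbitrary: b) (auto intro: H_D0 H_Suc)

lemma H_mono: "H b k P \<Longrightarrow> k \<le> m \<Longrightarrow> H b m P"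
proof (induction arbitrary: m rule: H.induct)
  case (H_Suc b k P)
  then obtain m' where "m = Suc m'" "k \<le> m'" by (cases m) auto
  then show ?case using H_Suc.IH by (simp add: H.H_Suc)
next
  case (H_ex k P)
  then obtain m' where "m = Suc m'" "k \<le> m'" by (cases m) auto
  then show ?case using H_ex.IH by (simp add: H.H_ex)
next
  case (H_all k P)
  then obtain m' where "m = Suc m'" "k \<le> m'" by (cases m) auto
  then show ?case using H_all.IH by (simp add: H.H_all)
next
  case (H_cong b k P Q)
  show ?case by (rule H.H_cong[OF H_cong.IH[OF H_cong.prems] H_cong.hyps(2)])
qed (rule H_D0_any)

text \<open>The conjunct \<open>Q\<close> moves inside the quantifier prefix; for a universal
  quantifier this relies on a nonempty universe. It will relativise existential quantifiers to the
  numbers.\<close>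

lemma H_conj_D0: "H b k P \<Longrightarrow> D0 Q \<Longrightarrow> U \<noteq> {} \<Longrightarrow> H b k (\<lambda>e. P e \<and> Q e)"
proof (induction arbitrary: Q rule: H.induct)
  case (H_D0 P b)
  then show ?case by (intro H.H_D0 D0_conj)
next
  case (H_Suc b k P)
  show ?case by (rule H.H_Suc[OF H_Suc.IH[OF H_Suc.prems]])
next
  case (H_ex k P)
  have "D0 (\<lambda>e. Q (\<lambda>i. e (Suc i)))" by (rule Def_subst[OF H_ex.prems(1)]) simp
  from H.H_ex[OF H_ex.IH[OF this H_ex.prems(2)]] show ?case by (rule H.H_cong) auto
next
  case (H_all k P)
  have "D0 (\<lambda>e. Q (\<lambda>i. e (Suc i)))" by (rule Def_subst[OF H_all.prems(1)]) simp
  from H.H_all[OF H_all.IH[OF this H_all.prems(2)]] show ?case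
    by (rule H.H_cong) (use H_all.prems(2) in auto)
next
  case (H_cong b k P Q')
  from H_cong.IH[OF H_cong.prems] show ?case by (rule H.H_cong) (use H_cong.hyps in auto)
qed

end

lemma arith_arity [simp]:
  "fun_arity arith_lang Zero = Some 0" "fun_arity arith_lang One = Some 0"
  "fun_arity arith_lang Add = Some (Suc (Suc 0))" "fun_arity arith_lang Mult = Some (Suc (Suc 0))"
  "rel_arity arith_lang r = Some (Suc (Suc 0))"
  by (simp_all add: arith_lang_def)

section \<open>Sets and numbers in a model\<close>

locale set_theory_model = set_struct M for M :: "(unit, set_rel, 'a) struct" +
  fixes n :: nat
  assumes n_pos: "n \<ge> 1"
    and model: "models set_lang (ReS0 \<union> Sep (set_Sigma n)) M"
begin

lemma U_nonempty: "U \<noteq> {}"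
  using model by (auto simp: models_def is_struct_def)

lemma axiom_sat: "\<phi> \<in> ReS0 \<union> Sep (set_Sigma n) \<Longrightarrow> range e \<subseteq> U \<Longrightarrow> sat M e \<phi>"
  using model unfolding models_def by blast

lemma extensionality:
  assumes "x \<in> U" "y \<in> U" "\<And>z. z \<in> U \<Longrightarrow> E z x \<longleftrightarrow> E z y"
  shows "x = y"
proof -
  have "sat M (case_nat x (\<lambda>_. y)) ax_extensionality"
    using assms by (intro axiom_sat env_cons) (auto simp: ReS0_def)
  then show ?thesis using assms(3) by (auto simp: ax_extensionality_def)
qed

lemma empty_exists: "\<exists>z\<in>U. \<forall>x\<in>U. \<not> E x z"
proof -
  obtain c where "c \<in> U" using U_nonempty by blast
  then have "sat M (\<lambda>_. c) ax_empty" by (intro axiom_sat) (auto simp: ReS0_def)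
  then show ?thesis by (simp add: ax_empty_def)
qed

lemma pairing: "a \<in> U \<Longrightarrow> b \<in> U \<Longrightarrow> \<exists>z\<in>U. \<forall>x\<in>U. E x z \<longleftrightarrow> x = a \<or> x = b"
proof -
  assume "a \<in> U" "b \<in> U"
  then have "sat M (case_nat a (\<lambda>_. b)) ax_pairing"
    by (intro axiom_sat env_cons) (auto simp: ReS0_def)
  then show ?thesis by (simp add: ax_pairing_def numeral_2_eq_2 numeral_3_eq_3) blast
qed

lemma difference: "a \<in> U \<Longrightarrow> b \<in> U \<Longrightarrow> \<exists>z\<in>U. \<forall>x\<in>U. E x z \<longleftrightarrow> E x a \<and> \<not> E x b"
proof -
  assume "a \<in> U" "b \<in> U"
  then have "sat M (case_nat a (\<lambda>_. b)) ax_difference"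
    by (intro axiom_sat env_cons) (auto simp: ReS0_def)
  then show ?thesis by (simp add: ax_difference_def numeral_2_eq_2 numeral_3_eq_3) blast
qed

lemma union: "a \<in> U \<Longrightarrow> \<exists>z\<in>U. \<forall>x\<in>U. E x z \<longleftrightarrow> (\<exists>y\<in>U. E y a \<and> E x y)"
proof -
  assume "a \<in> U"
  then have "sat M (\<lambda>_. a) ax_union" by (intro axiom_sat) (auto simp: ReS0_def)
  then show ?thesis by (simp add: ax_union_def numeral_3_eq_3) blast
qed

section \<open>Separation for definable predicates\<close>

definition separable :: "('a \<Rightarrow> bool) \<Rightarrow> bool" where
  "separable Q \<longleftrightarrow> (\<forall>a\<in>U. \<exists>b\<in>U. \<forall>x\<in>U. E x b \<longleftrightarrow> E x a \<and> Q x)"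

lemma separableD: "separable Q \<Longrightarrow> a \<in> U \<Longrightarrow> \<exists>b\<in>U. \<forall>x\<in>U. E x b \<longleftrightarrow> E x a \<and> Q x"
  by (simp add: separable_def)

text \<open>\<open>Def_bind\<close> with the constant term \<open>a\<close> produces the format of
  \<open>ax_separation\<close>: the tested element is variable 0 and the given set is variable
  1.\<close>

lemma separable_Def:
  assumes C: "\<And>\<phi>. \<phi> \<in> C \<Longrightarrow> ax_separation \<phi> \<in> ReS0 \<union> Sep (set_Sigma n)"
    and ren: "\<And>\<phi> r. \<phi> \<in> C \<Longrightarrow> rename r \<phi> \<in> C"
    and P: "Def C P" and e: "range e \<subseteq> U"
  shows "separable (\<lambda>x. P (case_nat x e))"
  unfolding separable_def
proof
  fix a assume a: "a \<in> U"
  obtain \<phi> \<tau> where *: "\<phi> \<in> C" "\<And>i. tv (\<tau> i)" "\<tau> 0 = (\<lambda>_. a)"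
    "\<And>e z. range e \<subseteq> U \<Longrightarrow> z \<in> U \<Longrightarrow> P (case_nat z e) = sat M (case_nat z (\<lambda>i. \<tau> i e)) \<phi>"
    using Def_bind[OF ren P tv_const[OF a]] by blast
  have "sat M (\<lambda>i. \<tau> i e) (ax_separation \<phi>)"
    using tv_in[OF *(2) e] by (intro axiom_sat C *(1)) auto
  then obtain b where b: "b \<in> U" "\<And>x. x \<in> U \<Longrightarrow> E x b \<longleftrightarrow> E x a \<and>
      sat M (\<lambda>i. eval M (case_nat x (case_nat b (\<lambda>i. \<tau> i e)))
        (case_nat (Var 0) (\<lambda>i. Var (Suc (Suc i))) i)) \<phi>"
    by (auto simp: ax_separation_def sat_subst numeral_2_eq_2 *(3))
  have "(\<lambda>i. eval M (case_nat x (case_nat b (\<lambda>i. \<tau> i e)))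
      (case_nat (Var 0) (\<lambda>i. Var (Suc (Suc i))) i)) = case_nat x (\<lambda>i. \<tau> i e)" for x
    by (rule ext) (simp split: nat.split)
  then show "\<exists>b\<in>U. \<forall>x\<in>U. E x b \<longleftrightarrow> E x a \<and> P (case_nat x e)"
    using b *(4)[OF e] by auto
qed

lemma separable_D0: "D0 P \<Longrightarrow> range e \<subseteq> U \<Longrightarrow> separable (\<lambda>x. P (case_nat x e))"
  by (rule separable_Def[where C = set_Delta0]) (auto simp: ReS0_def Sep_def rename_set_Delta0)

text \<open>Subtract the separated subset from \<open>a\<close> by the axiom of Set Difference. This
  turns \<open>\<Sigma>\<^sub>n\<close> separation into \<open>\<Pi>\<^sub>n\<close>
  separation.\<close>

lemma separable_not: "separable Q \<Longrightarrow> separable (\<lambda>x. \<not> Q x)"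
  unfolding separable_def
proof
  fix a assume Q: "\<forall>a\<in>U. \<exists>b\<in>U. \<forall>x\<in>U. E x b \<longleftrightarrow> E x a \<and> Q x" and a: "a \<in> U"
  then obtain b where "b \<in> U" "\<forall>x\<in>U. E x b \<longleftrightarrow> E x a \<and> Q x" by blast
  then show "\<exists>b\<in>U. \<forall>x\<in>U. E x b \<longleftrightarrow> E x a \<and> \<not> Q x"
    using difference[OF a, of b] by auto
qed

lemma separable_H:
  assumes "H b k P" "k \<le> n" "range e \<subseteq> U"
  shows "separable (\<lambda>x. P (case_nat x e))"
proof -
  have *: "separable (\<lambda>x. P (case_nat x e))" if "H True n P" for P
  proof (rule separable_Def[OF _ _ _ assms(3)])
    show "Def (set_Sigma n) P" using H_representable[OF that] by (simp add: set_Sigma_def)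
  qed (use rename_hierarchy[OF rename_set_Delta0] in \<open>auto simp: Sep_def set_Sigma_def\<close>)
  have Hn: "H b n P" by (rule H_mono[OF assms(1,2)])
  show ?thesis
  proof (cases b)
    case False
    then have "H True n (\<lambda>e. \<not> P e)" using H_not[OF Hn] by simp
    from separable_not[OF *[OF this]] show ?thesis by simp
  qed (use * Hn in simp)
qed

lemma separable_D0_unary: "D0 (\<lambda>e. Q (e 0)) \<Longrightarrow> separable Q"
proof -
  assume D: "D0 (\<lambda>e. Q (e 0))"
  obtain c where "c \<in> U" using U_nonempty by blast
  then show ?thesis using separable_D0[OF D, of "\<lambda>_. c"] by simp
qed

lemma separable_H_unary: "H b k (\<lambda>e. Q (e 0)) \<Longrightarrow> k \<le> n \<Longrightarrow> separable Q"
proof -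
  assume D: "H b k (\<lambda>e. Q (e 0))" "k \<le> n"
  obtain c where "c \<in> U" using U_nonempty by blast
  then show ?thesis using separable_H[OF D, of "\<lambda>_. c"] by simp
qed

section \<open>Basic set operations\<close>

definition coll :: "('a \<Rightarrow> bool) \<Rightarrow> 'a" where
  "coll Q = (THE b. b \<in> U \<and> (\<forall>x\<in>U. E x b \<longleftrightarrow> Q x))"

text \<open>Extensionality makes the described set unique, so that the description denotes it as
  soon as one such set exists.\<close>

lemma coll:
  assumes "\<exists>b\<in>U. \<forall>x\<in>U. E x b \<longleftrightarrow> Q x"
  shows "coll Q \<in> U" "x \<in> U \<Longrightarrow> E x (coll Q) \<longleftrightarrow> Q x"
proof -
  have "\<exists>!b. b \<in> U \<and> (\<forall>x\<in>U. E x b \<longleftrightarrow> Q x)"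
    using assms extensionality by (metis (no_types, lifting))
  from theI'[OF this] show "coll Q \<in> U" "x \<in> U \<Longrightarrow> E x (coll Q) \<longleftrightarrow> Q x"
    unfolding coll_def by blast+
qed

definition emp :: 'a where "emp = coll (\<lambda>_. False)"
definition upair :: "'a \<Rightarrow> 'a \<Rightarrow> 'a" where "upair a b = coll (\<lambda>x. x = a \<or> x = b)"
definition un :: "'a \<Rightarrow> 'a \<Rightarrow> 'a" where "un a b = coll (\<lambda>x. E x a \<or> E x b)"

abbreviation sing :: "'a \<Rightarrow> 'a" where "sing a \<equiv> upair a a"

definition suc :: "'a \<Rightarrow> 'a" where "suc a = un a (sing a)"
text \<open>The Kuratowski pair.\<close>

definition pr :: "'a \<Rightarrow> 'a \<Rightarrow> 'a" where "pr a b = upair (sing a) (upair a b)"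

lemma emp [simp]: "emp \<in> U" "x \<in> U \<Longrightarrow> \<not> E x emp"
  using coll[of "\<lambda>_. False"] empty_exists by (auto simp: emp_def)

lemma upair_in [simp]: "a \<in> U \<Longrightarrow> b \<in> U \<Longrightarrow> upair a b \<in> U"
  and E_upair [simp]: "x \<in> U \<Longrightarrow> a \<in> U \<Longrightarrow> b \<in> U \<Longrightarrow> E x (upair a b) \<longleftrightarrow> x = a \<or> x = b"
  using coll[OF pairing[of a b]] by (auto simp: upair_def)

lemma un_exists: "a \<in> U \<Longrightarrow> b \<in> U \<Longrightarrow> \<exists>z\<in>U. \<forall>x\<in>U. E x z \<longleftrightarrow> E x a \<or> E x b"
  using union[of "upair a b"] by auto

lemma un_in [simp]: "a \<in> U \<Longrightarrow> b \<in> U \<Longrightarrow> un a b \<in> U"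
  and E_un [simp]: "x \<in> U \<Longrightarrow> a \<in> U \<Longrightarrow> b \<in> U \<Longrightarrow> E x (un a b) \<longleftrightarrow> E x a \<or> E x b"
  using coll[OF un_exists[of a b]] by (auto simp: un_def)

lemma suc_in [simp]: "a \<in> U \<Longrightarrow> suc a \<in> U"
  and E_suc [simp]: "x \<in> U \<Longrightarrow> a \<in> U \<Longrightarrow> E x (suc a) \<longleftrightarrow> E x a \<or> x = a"
  by (auto simp: suc_def)

lemma pr_in [simp]: "a \<in> U \<Longrightarrow> b \<in> U \<Longrightarrow> pr a b \<in> U"
  and E_pr [simp]: "x \<in> U \<Longrightarrow> a \<in> U \<Longrightarrow> b \<in> U \<Longrightarrow> E x (pr a b) \<longleftrightarrow> x = sing a \<or> x = upair a b"
  by (auto simp: pr_def)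

text \<open>In this and the next two characterisations all quantifiers are bounded by
  \<open>c\<close> or \<open>a\<close>; they yield \<open>\<Delta>\<^sub>0\<close> definitions of
  the graphs.\<close>

lemma upair_eq_iff: "a \<in> U \<Longrightarrow> b \<in> U \<Longrightarrow> c \<in> U \<Longrightarrow>
    c = upair a b \<longleftrightarrow> E a c \<and> E b c \<and> (\<forall>x\<in>U. E x c \<longrightarrow> x = a \<or> x = b)"
  by (auto intro!: extensionality)

lemma suc_eq_iff: "a \<in> U \<Longrightarrow> c \<in> U \<Longrightarrow>
    c = suc a \<longleftrightarrow> E a c \<and> (\<forall>x\<in>U. E x a \<longrightarrow> E x c) \<and> (\<forall>x\<in>U. E x c \<longrightarrow> E x a \<or> x = a)"
  by (auto intro!: extensionality)

lemma pr_eq_iff: "a \<in> U \<Longrightarrow> b \<in> U \<Longrightarrow> c \<in> U \<Longrightarrow>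
    c = pr a b \<longleftrightarrow> (\<exists>s\<in>U. E s c \<and> s = sing a \<and> (\<exists>d\<in>U. E d c \<and> d = upair a b \<and>
      (\<forall>x\<in>U. E x c \<longrightarrow> x = s \<or> x = d)))"
  by (auto intro!: extensionality)

lemma sing_eq_upair: "a \<in> U \<Longrightarrow> b \<in> U \<Longrightarrow> c \<in> U \<Longrightarrow> sing a = upair b c \<Longrightarrow> a = b \<and> a = c"
  using E_upair[of b a a] E_upair[of c a a] by auto

lemma upair_inject: "a \<in> U \<Longrightarrow> b \<in> U \<Longrightarrow> c \<in> U \<Longrightarrow> upair a b = upair a c \<Longrightarrow> b = c"
  by (metis E_upair)

lemma pr_snd: "a \<in> U \<Longrightarrow> b \<in> U \<Longrightarrow> c \<in> U \<Longrightarrow> pr a b = pr a c \<Longrightarrow> b = c"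
  by (metis E_pr upair_in upair_inject)

text \<open>If \<open>{c} = {a, b}\<close>, then \<open>a = b = c\<close>; hence \<open>{a}\<close>
  is the only singleton in the pair. Containing a given singleton is thus a
  \<open>\<Delta>\<^sub>0\<close> test for the first component.\<close>

lemma pr_fst: "a \<in> U \<Longrightarrow> b \<in> U \<Longrightarrow> c \<in> U \<Longrightarrow> E (sing c) (pr a b) \<Longrightarrow> c = a"
  by (metis E_pr upair_in sing_eq_upair)

section \<open>\<open>\<Delta>\<^sub>0\<close> definability of the set operations\<close>

lemma D0_upair:
  assumes [simp]: "tv c" "tv a" "tv b"
  shows "D0 (\<lambda>e. c e = upair (a e) (b e))"
proof (rule Def_cong)
  show "D0 (\<lambda>e. E (a e) (c e) \<and> E (b e) (c e) \<and> (\<forall>x\<in>U. E x (c e) \<longrightarrow> x = a e \<or> x = b e))"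
    by (intro D0_connectives;
        ((rule D0_atoms; simp add: assms[THEN tv_shift]) | simp add: assms[THEN tv_shift]))
qed (simp add: upair_eq_iff tv_in)

lemma D0_suc:
  assumes [simp]: "tv c" "tv a"
  shows "D0 (\<lambda>e. c e = suc (a e))"
proof (rule Def_cong)
  show "D0 (\<lambda>e. E (a e) (c e) \<and> (\<forall>x\<in>U. E x (a e) \<longrightarrow> E x (c e)) \<and>
      (\<forall>x\<in>U. E x (c e) \<longrightarrow> E x (a e) \<or> x = a e))"
    by (intro D0_connectives;
        ((rule D0_atoms; simp add: assms[THEN tv_shift]) | simp add: assms[THEN tv_shift]))
qed (simp add: suc_eq_iff tv_in)

lemma D0_pr:
  assumes [simp]: "tv c" "tv a" "tv b"
  shows "D0 (\<lambda>e. c e = pr (a e) (b e))"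
proof (rule Def_cong)
  show "D0 (\<lambda>e. \<exists>s\<in>U. E s (c e) \<and> s = sing (a e) \<and> (\<exists>d\<in>U. E d (c e) \<and>
      d = upair (a e) (b e) \<and> (\<forall>x\<in>U. E x (c e) \<longrightarrow> x = s \<or> x = d)))"
    by (intro D0_connectives;
        ((rule D0_upair D0_atoms; simp add: assms[THEN tv_shift] assms[THEN tv_shift, THEN tv_shift] assms[THEN tv_shift, THEN tv_shift, THEN tv_shift]) | simp add: assms[THEN tv_shift] assms[THEN tv_shift, THEN tv_shift] assms[THEN tv_shift, THEN tv_shift, THEN tv_shift]))
qed (simp add: pr_eq_iff tv_in)

text \<open>The value of \<open>g\<close> is named by a quantifier bounded by \<open>c\<close>, so a
  \<open>\<Delta>\<^sub>0\<close> graph is enough.\<close>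

lemma D0_mem_fun:
  assumes "D0 (\<lambda>e. e 0 = g (\<lambda>i. e (Suc i)))" "tv c" "\<And>e. range e \<subseteq> U \<Longrightarrow> g e \<in> U"
  shows "D0 (\<lambda>e. E (g e) (c e))"
  by (rule Def_cong[OF D0_ex[where P = "\<lambda>e x. x = g e", OF assms(1,2)]]) (use assms(3) in auto)

lemma D0_suc_mem: "tv c \<Longrightarrow> tv a \<Longrightarrow> D0 (\<lambda>e. E (suc (a e)) (c e))"
  by (rule D0_mem_fun) (simp_all add: D0_suc tv_shift tv_in)

lemma D0_pr_mem: "tv c \<Longrightarrow> tv a \<Longrightarrow> tv b \<Longrightarrow> D0 (\<lambda>e. E (pr (a e) (b e)) (c e))"
  by (rule D0_mem_fun) (simp_all add: D0_pr tv_shift tv_in)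

lemma D0_sing_mem: "tv c \<Longrightarrow> tv a \<Longrightarrow> D0 (\<lambda>e. E (sing (a e)) (c e))"
  by (rule D0_mem_fun) (simp_all add: D0_upair tv_shift tv_in)

lemmas D0_set_atoms = D0_suc D0_suc_mem D0_pr D0_pr_mem D0_upair D0_sing_mem D0_atoms

section \<open>Finite functions as sets of pairs\<close>

text \<open>\<open>f\<close> need not be a function: \<open>val f i u\<close> only asks that \<open>f\<close> has exactly one element whose first
  component is \<open>i\<close>.\<close>

definition val :: "'a \<Rightarrow> 'a \<Rightarrow> 'a \<Rightarrow> bool" where
  "val f i u \<longleftrightarrow> E (pr i u) f \<and> (\<forall>q\<in>U. E q f \<longrightarrow> E (sing i) q \<longrightarrow> q = pr i u)"

lemma D0_val:
  assumes "tv f" "tv i" "tv u"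
  shows "D0 (\<lambda>e. val (f e) (i e) (u e))"
  unfolding val_def
  by (intro D0_connectives;
        ((rule D0_set_atoms; simp add: assms assms[THEN tv_shift]) | simp add: assms assms[THEN tv_shift]))

lemma val_functional:
  "f \<in> U \<Longrightarrow> i \<in> U \<Longrightarrow> u \<in> U \<Longrightarrow> v \<in> U \<Longrightarrow> val f i u \<Longrightarrow> val f i v \<Longrightarrow> u = v"
  unfolding val_def using pr_snd by (metis E_pr pr_in upair_in)

text \<open>Remove from \<open>f\<close> every element that contains \<open>{i}\<close>, then add
  the pair of \<open>i\<close> and \<open>u\<close>. By \<open>pr_fst\<close> neither operation
  affects the pairs with another first component.\<close>

lemma val_update:
  assumes "f \<in> U" "i \<in> U" "u \<in> U"
  shows "\<exists>g\<in>U. val g i u \<and> (\<forall>j\<in>U. \<forall>w\<in>U. j \<noteq> i \<longrightarrow> val f j w \<longrightarrow> val g j w)"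
proof -
  have "separable (\<lambda>q. \<not> E (sing i) q)"
    using assms by (intro separable_D0_unary D0_not D0_sing_mem; simp)
  then obtain g where g: "g \<in> U" "\<And>q. q \<in> U \<Longrightarrow> E q g \<longleftrightarrow> E q f \<and> \<not> E (sing i) q"
    using separableD[OF _ assms(1)] by blast
  show ?thesis
  proof (intro bexI conjI ballI impI)
    show "un g (sing (pr i u)) \<in> U" using g assms by auto
    show "val (un g (sing (pr i u))) i u" using g assms by (auto simp: val_def)
    fix j w assume j: "j \<in> U" "w \<in> U" "j \<noteq> i" "val f j w"
    then have "\<not> E (sing i) (pr j w)" "\<not> E (sing j) (pr i u)"
      using pr_fst assms by blast+
    then show "val (un g (sing (pr i u))) j w"
      using j g assms by (auto simp: val_def simp del: E_pr)
  qed
qed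

section \<open>Numbers and induction\<close>

definition Loc :: "'a \<Rightarrow> bool" where
  "Loc x \<longleftrightarrow> E emp (suc x) \<and> (\<forall>y\<in>U. E y x \<longrightarrow> E (suc y) (suc x))"

text \<open>Closure of \<open>s\<close> is demanded only at elements of \<open>x\<close>. Hence
  \<open>s\<close> may be a subset of \<open>suc x\<close>, which is what separation
  provides.\<close>

definition Num :: "'a \<Rightarrow> bool" where
  "Num x \<longleftrightarrow> x \<in> U \<and> Loc x \<and>
    (\<forall>s\<in>U. E emp s \<longrightarrow> (\<forall>y\<in>U. E y x \<longrightarrow> E y s \<longrightarrow> E (suc y) s) \<longrightarrow> E x s)"

lemma Num_in [simp]: "Num x \<Longrightarrow> x \<in> U"
  by (simp add: Num_def)

lemma Num_emp [simp]: "Num emp"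
  by (simp add: Num_def Loc_def del: Num_in)

lemma Num_suc [simp]: assumes "Num x" shows "Num (suc x)"
proof -
  have x: "x \<in> U" "E emp (suc x)" "\<And>y. y \<in> U \<Longrightarrow> E y x \<Longrightarrow> E (suc y) (suc x)"
    "\<And>s. s \<in> U \<Longrightarrow> E emp s \<Longrightarrow> (\<And>y. y \<in> U \<Longrightarrow> E y x \<Longrightarrow> E y s \<Longrightarrow> E (suc y) s) \<Longrightarrow> E x s"
    using assms unfolding Num_def Loc_def by blast+
  show ?thesis unfolding Num_def
  proof (intro conjI ballI impI)
    show "Loc (suc x)" using x(1-3) by (auto simp: Loc_def)
    fix s assume s: "s \<in> U" "E emp s" "\<forall>y\<in>U. E y (suc x) \<longrightarrow> E y s \<longrightarrow> E (suc y) s"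
    then have "E x s" using x(1) by (intro x(4)) auto
    then show "E (suc x) s" using s x(1) by simp
  qed (use x in simp)
qed

text \<open>Apply the definition of \<open>Num\<close> to the set of all elements of
  \<open>suc x\<close> that satisfy \<open>Q\<close>. The step is restricted to elements of
  \<open>x\<close>, because these are not yet known to be numbers.\<close>

lemma Num_induct_local:
  assumes x: "Num x" and sep: "separable Q" and zero: "Q emp"
    and step: "\<And>y. y \<in> U \<Longrightarrow> E y x \<Longrightarrow> Q y \<Longrightarrow> Q (suc y)"
  shows "Q x"
proof -
  have xU: "x \<in> U" using x by simp
  then obtain s where s: "s \<in> U" "\<And>z. z \<in> U \<Longrightarrow> E z s \<longleftrightarrow> E z (suc x) \<and> Q z"
    using separableD[OF sep suc_in[OF xU]] by blast
  have L: "E emp (suc x)" "\<And>y. y \<in> U \<Longrightarrow> E y x \<Longrightarrow> E (suc y) (suc x)"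
    using x unfolding Num_def Loc_def by blast+
  have "E emp s" using s(2)[of emp] L(1) zero by simp
  moreover have "E (suc y) s" if "y \<in> U" "E y x" "E y s" for y
    using s(2)[of "suc y"] s(2)[of y] L(2) step that by simp
  ultimately have "E x s" using x s(1) unfolding Num_def by blast
  then show ?thesis using s xU by blast
qed

lemma D0_Loc:
  assumes [simp]: "tv t"
  shows "D0 (\<lambda>e. Loc (t e))"
proof (rule Def_cong)
  show "D0 (\<lambda>e. (E emp (t e) \<or> t e = emp) \<and>
      (\<forall>y\<in>U. E y (t e) \<longrightarrow> E (suc y) (t e) \<or> t e = suc y))"
    by (intro D0_connectives;
        ((rule D0_set_atoms; simp add: assms[THEN tv_shift]) | simp add: assms[THEN tv_shift]))
qed (auto simp: Loc_def tv_in)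

text \<open>In the matrix, \<open>s\<close> is variable 0 and \<open>x\<close> is variable 1.
  \<open>Loc\<close> is put in the scope of the quantifier over \<open>s\<close>, which is harmless
  in a nonempty universe.\<close>

lemma H_Num: "H False 1 (\<lambda>e. Num (e 0))"
proof -
  let ?R = "\<lambda>e. Loc (e (Suc 0)) \<and> (E emp (e 0) \<longrightarrow>
      (\<forall>y\<in>U. E y (e (Suc 0)) \<longrightarrow> E y (e 0) \<longrightarrow> E (suc y) (e 0)) \<longrightarrow> E (e (Suc 0)) (e 0))"
  have "D0 ?R"
    by (intro D0_connectives;
        ((rule D0_Loc D0_set_atoms; simp) | simp))
  then have "H False (Suc 0) ?R" by (intro H_Suc H_D0)
  from H_all[OF this] show ?thesis
    unfolding One_nat_def by (rule H_cong) (use U_nonempty in \<open>auto simp: Num_def simp del: Num_in\<close>)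
qed

text \<open>Induction on \<open>?Q\<close>. Its bounded quantifier stands in front of a
  \<open>\<Pi>\<^sub>1\<close> predicate, so separability is shown by hand: take the numbers
  \<open>b\<close> in \<open>a\<close>, their union \<open>c\<close>, and the numbers
  \<open>d\<close> in \<open>c\<close>. For \<open>y\<close> in \<open>b\<close>, having only
  numbers as elements means being a subset of \<open>d\<close>, which is
  \<open>\<Delta>\<^sub>0\<close> in the parameter \<open>d\<close>.\<close>

lemma Num_elem: assumes "Num x" "y \<in> U" "E y x" shows "Num y"
proof -
  let ?Q = "\<lambda>y. Num y \<and> (\<forall>z\<in>U. E z y \<longrightarrow> Num z)"
  have sep: "separable Num" using H_Num n_pos by (rule separable_H_unary)
  have "separable ?Q"
    unfolding separable_def
  proof
    fix a assume a: "a \<in> U"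
    obtain b where b: "b \<in> U" "\<And>x. x \<in> U \<Longrightarrow> E x b \<longleftrightarrow> E x a \<and> Num x"
      using separableD[OF sep a] by blast
    obtain c where c: "c \<in> U" "\<And>x. x \<in> U \<Longrightarrow> E x c \<longleftrightarrow> (\<exists>y\<in>U. E y b \<and> E x y)"
      using union[OF b(1)] by blast
    obtain d where d: "d \<in> U" "\<And>x. x \<in> U \<Longrightarrow> E x d \<longleftrightarrow> E x c \<and> Num x"
      using separableD[OF sep c(1)] by blast
    have "separable (\<lambda>y. \<forall>z\<in>U. E z y \<longrightarrow> E z d)"
      by (intro separable_D0_unary D0_connectives;
        ((rule D0_atoms; simp add: d(1)) | simp))
    then obtain f where "f \<in> U" "\<And>x. x \<in> U \<Longrightarrow> E x f \<longleftrightarrow> E x b \<and> (\<forall>z\<in>U. E z x \<longrightarrow> E z d)"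
      using separableD[OF _ b(1)] by blast
    then show "\<exists>b\<in>U. \<forall>x\<in>U. E x b \<longleftrightarrow> E x a \<and> ?Q x"
      using b c d by (intro bexI[of _ f]) auto
  qed
  from assms(1) this have "?Q x" by (rule Num_induct_local) auto
  then show ?thesis using assms by blast
qed

lemma Num_induct:
  assumes "Num x" "separable Q" "Q emp" "\<And>y. Num y \<Longrightarrow> Q y \<Longrightarrow> Q (suc y)"
  shows "Q x"
  using assms by (intro Num_induct_local[of x Q]) (auto intro: Num_elem)

lemma D0_Num: "tv t \<Longrightarrow> D0 (\<lambda>e. Num (t e))"
proof (cases "\<exists>x\<in>U. Loc x \<and> \<not> Num x")
  case True
  assume t: "tv t"
  from True obtain x where x: "x \<in> U" "Loc x" "\<not> Num x" by blast
  \<comment> \<open>\<open>Loc x\<close> places 0 and the successors of numbers below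
    \<open>x\<close> in \<open>suc x\<close>. They differ from \<open>x\<close> because they are
    numbers, and so they are elements of \<open>x\<close>.\<close>
  have *: "E y x" if "Num y" for y
    using that
  proof (rule Num_induct)
    show "separable (\<lambda>y. E y x)" using x(1) by (intro separable_D0_unary D0_mem; simp)
    show "E emp x" using x by (auto simp: Loc_def)
    fix y assume y: "Num y" "E y x"
    then have "E (suc y) (suc x)" using x(2) Num_in[OF y(1)] by (simp add: Loc_def)
    then have "E (suc y) x \<or> suc y = x" using x(1) Num_in[OF y(1)] by simp
    then show "E (suc y) x" using x(3) Num_suc[OF y(1)] by blast
  qed
  \<comment> \<open>The set of all numbers; membership in this parameter is a
    \<open>\<Delta>\<^sub>0\<close> definition of \<open>Num\<close>.\<close>
  obtain w where "w \<in> U" "\<And>y. y \<in> U \<Longrightarrow> E y w \<longleftrightarrow> E y x \<and> Num y"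
    using separableD[OF separable_H_unary[OF H_Num n_pos] x(1)] by blast
  then have w: "w \<in> U" "\<And>y. y \<in> U \<Longrightarrow> E y w \<longleftrightarrow> Num y" using * by blast+
  show ?thesis
    by (rule Def_cong[where P = "\<lambda>e. E (t e) w"]) (simp_all add: t w tv_in D0_mem)
next
  case False
  assume t: "tv t"
  show ?thesis
    by (rule Def_cong[OF D0_Loc[OF t]]) (use False tv_in[OF t] Num_def in blast)
qed

section \<open>\<open>\<Sigma>\<^sub>1\<close> predicates and collection\<close>

text \<open>With pairing, a block of existential quantifiers reduces to a single one that bounds all the
  witnesses.\<close>

definition S1 :: "((nat \<Rightarrow> 'a) \<Rightarrow> bool) \<Rightarrow> bool" where
  "S1 P \<longleftrightarrow> (\<exists>R. D0 R \<and> (\<forall>e. range e \<subseteq> U \<longrightarrow> P e = (\<exists>w\<in>U. R (case_nat w e))))"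

lemma S1I: "D0 R \<Longrightarrow> (\<And>e. range e \<subseteq> U \<Longrightarrow> P e = (\<exists>w\<in>U. R (case_nat w e))) \<Longrightarrow> S1 P"
  unfolding S1_def by blast

lemma S1_H: "S1 P \<Longrightarrow> H True (Suc 0) P"
proof -
  assume "S1 P"
  then obtain R where R: "D0 R" "\<And>e. range e \<subseteq> U \<Longrightarrow> P e = (\<exists>w\<in>U. R (case_nat w e))"
    unfolding S1_def by blast
  show ?thesis by (rule H_cong[OF H_ex[OF H_D0_any[OF R(1)]]]) (simp add: R(2))
qed

text \<open>Used to replace the witness variable of a matrix \<open>R\<close> by a variable that is
  bounded inside a larger witness.\<close>

lemma D0_cons: assumes "D0 R" "tv t" "\<And>i. tv (\<tau> i)" shows "D0 (\<lambda>e. R (case_nat (t e) (\<lambda>i. \<tau> i e)))"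
proof -
  have "D0 (\<lambda>e. R (\<lambda>i. case_nat t \<tau> i e))"
    using assms(2,3) by (intro Def_subst[OF assms(1), where \<tau> = "case_nat t \<tau>"]) (simp split: nat.split)
  moreover have "(\<lambda>i. case_nat t \<tau> i e) = case_nat (t e) (\<lambda>i. \<tau> i e)" for e
    by (rule ext) (simp split: nat.split)
  ultimately show ?thesis by simp
qed

lemma D0_cons2:
  assumes "D0 R" "tv s" "tv t" "\<And>i. tv (\<tau> i)"
  shows "D0 (\<lambda>e. R (case_nat (s e) (case_nat (t e) (\<lambda>i. \<tau> i e))))"
proof -
  have "D0 (\<lambda>e. R (case_nat (s e) (\<lambda>i. case_nat t \<tau> i e)))"
    using assms(3,4)
    by (intro D0_cons[OF assms(1,2), where \<tau> = "case_nat t \<tau>"]) (simp split: nat.split)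
  moreover have "(\<lambda>i. case_nat t \<tau> i e) = case_nat (t e) (\<lambda>i. \<tau> i e)" for e
    by (rule ext) (simp split: nat.split)
  ultimately show ?thesis by simp
qed

lemma S1_D0: assumes "D0 P" shows "S1 P"
proof (rule S1I)
  show "D0 (\<lambda>e. P (\<lambda>i. e (Suc i)))" by (rule Def_subst[OF assms]) simp
qed (use U_nonempty in auto)

lemma S1_conj: assumes "S1 P" "S1 Q" shows "S1 (\<lambda>e. P e \<and> Q e)"
proof -
  obtain R where R: "D0 R" "\<And>e. range e \<subseteq> U \<Longrightarrow> P e = (\<exists>w\<in>U. R (case_nat w e))"
    using assms(1) unfolding S1_def by blast
  obtain S where S: "D0 S" "\<And>e. range e \<subseteq> U \<Longrightarrow> Q e = (\<exists>w\<in>U. S (case_nat w e))"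
    using assms(2) unfolding S1_def by blast
  show ?thesis
  proof (rule S1I)
    show "D0 (\<lambda>e. \<exists>a\<in>U. E a (e 0) \<and> (\<exists>b\<in>U. E b (e 0) \<and>
        R (case_nat a (\<lambda>i. e (Suc i))) \<and> S (case_nat b (\<lambda>i. e (Suc i)))))"
      by (intro D0_connectives;
        ((rule D0_cons[OF R(1)] D0_cons[OF S(1)] D0_atoms; simp) | simp))
    fix e :: "nat \<Rightarrow> 'a" assume e: "range e \<subseteq> U"
    \<comment> \<open>Pairing supplies one set that contains both witnesses.\<close>
    have "\<exists>w\<in>U. E a w \<and> E b w" if "a \<in> U" "b \<in> U" for a b
      using that by (intro bexI[of _ "upair a b"]) auto
    then show "(P e \<and> Q e) = (\<exists>w\<in>U. \<exists>a\<in>U. E a (case_nat w e 0) \<and> (\<exists>b\<in>U. E b (case_nat w e 0) \<and>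
        R (case_nat a (\<lambda>i. case_nat w e (Suc i))) \<and> S (case_nat b (\<lambda>i. case_nat w e (Suc i)))))"
      unfolding R(2)[OF e] S(2)[OF e] by simp metis
  qed
qed

lemma S1_disj: assumes "S1 P" "S1 Q" shows "S1 (\<lambda>e. P e \<or> Q e)"
proof -
  obtain R where R: "D0 R" "\<And>e. range e \<subseteq> U \<Longrightarrow> P e = (\<exists>w\<in>U. R (case_nat w e))"
    using assms(1) unfolding S1_def by blast
  obtain S where S: "D0 S" "\<And>e. range e \<subseteq> U \<Longrightarrow> Q e = (\<exists>w\<in>U. S (case_nat w e))"
    using assms(2) unfolding S1_def by blast
  show ?thesis
    by (rule S1I[OF D0_disj[OF R(1) S(1)]]) (use R(2) S(2) in blast)
qed

lemma S1_ex:
  assumes "S1 (\<lambda>e. P (\<lambda>i. e (Suc i)) (e 0))"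
  shows "S1 (\<lambda>e. \<exists>x\<in>U. P e x)"
proof -
  obtain R where R: "D0 R"
    "\<And>e. range e \<subseteq> U \<Longrightarrow> P (\<lambda>i. e (Suc i)) (e 0) = (\<exists>w\<in>U. R (case_nat w e))"
    using assms unfolding S1_def by blast
  show ?thesis
  proof (rule S1I)
    show "D0 (\<lambda>e. \<exists>a\<in>U. E a (e 0) \<and> (\<exists>b\<in>U. E b (e 0) \<and>
        R (case_nat a (case_nat b (\<lambda>i. e (Suc i))))))"
      by (intro D0_connectives;
        ((rule D0_cons2[OF R(1)] D0_atoms; simp) | simp))
    fix e :: "nat \<Rightarrow> 'a" assume e: "range e \<subseteq> U"
    have *: "P e x = (\<exists>w\<in>U. R (case_nat w (case_nat x e)))" if "x \<in> U" for x
      using R(2)[OF env_cons[OF that e]] by simp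
    have "\<exists>w\<in>U. E a w \<and> E b w" if "a \<in> U" "b \<in> U" for a b
      using that by (intro bexI[of _ "upair a b"]) auto
    then show "(\<exists>x\<in>U. P e x) = (\<exists>w\<in>U. \<exists>a\<in>U. E a (case_nat w e 0) \<and> (\<exists>b\<in>U. E b (case_nat w e 0) \<and>
        R (case_nat a (case_nat b (\<lambda>i. case_nat w e (Suc i))))))"
      using * by simp metis
  qed
qed

lemma separable_S1: "S1 (\<lambda>e. Q (e 0)) \<Longrightarrow> separable Q"
  using separable_H_unary[OF S1_H] n_pos by simp

text \<open>Induction on the bound \<open>t\<close> collects the witnesses for \<open>x \<in> t\<close> in a single set.\<close>

lemma S1_ball:
  assumes P: "S1 (\<lambda>e. P (\<lambda>i. e (Suc i)) (e 0))" and t: "tv t"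
  shows "S1 (\<lambda>e. Num (t e) \<and> (\<forall>x\<in>U. E x (t e) \<longrightarrow> P e x))"
proof -
  obtain R where R: "D0 R"
    "\<And>e. range e \<subseteq> U \<Longrightarrow> P (\<lambda>i. e (Suc i)) (e 0) = (\<exists>w\<in>U. R (case_nat w e))"
    using P unfolding S1_def by blast
  show ?thesis
  proof (rule S1I)
    show "D0 (\<lambda>e. Num (t (\<lambda>i. e (Suc i))) \<and> (\<forall>x\<in>U. E x (t (\<lambda>i. e (Suc i))) \<longrightarrow>
        (\<exists>w\<in>U. E w (e 0) \<and> R (case_nat w (case_nat x (\<lambda>i. e (Suc i)))))))"
      by (intro D0_connectives;
        ((rule D0_cons2[OF R(1)] D0_Num D0_atoms; simp add: tv_shift[OF t] tv_shift[OF tv_shift[OF t]]) | simp add: tv_shift[OF t] tv_shift[OF tv_shift[OF t]]))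
    fix e :: "nat \<Rightarrow> 'a" assume e: "range e \<subseteq> U"
    have *: "P e x = (\<exists>w\<in>U. R (case_nat w (case_nat x e)))" if "x \<in> U" for x
      using R(2)[OF env_cons[OF that e]] by simp
    have "\<exists>v\<in>U. \<forall>x\<in>U. E x (t e) \<longrightarrow> (\<exists>w\<in>U. E w v \<and> R (case_nat w (case_nat x e)))"
      if N: "Num (t e)" and a: "\<forall>x\<in>U. E x (t e) \<longrightarrow> P e x"
    proof -
      \<comment> \<open>The induction runs over all numbers \<open>z\<close>, also those outside
        \<open>t e\<close>, so the restriction \<open>E x (t e)\<close> stays in the statement; at
        \<open>z = t e\<close> it repeats the other condition. This predicate of \<open>z\<close> is
        \<open>\<Sigma>\<^sub>1\<close>.\<close>
      let ?Q = "\<lambda>z. \<exists>v\<in>U. \<forall>x\<in>U. E x z \<longrightarrow> E x (t e) \<longrightarrow>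
        (\<exists>w\<in>U. E w v \<and> R (case_nat w (case_nat x e)))"
      have ei: "e i \<in> U" for i using e by auto
      have "tv (\<lambda>_. e i)" for i using ei by simp
      from D0_cons2[OF R(1) tv_proj tv_proj this]
      have "D0 (\<lambda>e'. R (case_nat (e' j) (case_nat (e' k) e)))" for j k by simp
      moreover have "D0 (\<lambda>e'. E (e' j) (t e))" for j
        by (rule D0_mem) (simp_all add: tv_in[OF t e])
      ultimately have "separable ?Q"
        by (intro separable_S1 S1_ex S1_D0 D0_connectives; ((rule D0_mem; simp; fail) | simp))
      from N this have "?Q (t e)"
      proof (rule Num_induct)
        show "?Q emp" by (intro bexI[of _ emp]) auto
        fix y assume y: "Num y" and "?Q y"
        then obtain v where v: "v \<in> U"
          "\<And>x. x \<in> U \<Longrightarrow> E x y \<Longrightarrow> E x (t e) \<Longrightarrow> \<exists>w\<in>U. E w v \<and> R (case_nat w (case_nat x e))"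
          by blast
        show "?Q (suc y)"
        proof (cases "E y (t e)")
          case True
          then obtain w where w: "w \<in> U" "R (case_nat w (case_nat y e))" using a *[OF Num_in[OF y]] Num_in[OF y] by blast
          \<comment> \<open>The collecting set \<open>v\<close> is enlarged by a witness for the new
            element \<open>y\<close>.\<close>
          have "\<exists>u\<in>U. E u (un v (sing w)) \<and> R (case_nat u (case_nat x e))"
            if "x \<in> U" "E x (suc y)" "E x (t e)" for x
          proof (cases "x = y")
            case True
            then show ?thesis using w v(1) by (intro bexI[of _ w]) auto
          next
            case False
            then have "E x y" using that y by auto
            then show ?thesis using v(2)[OF that(1) _ that(3)] v(1) w(1) by fastforce
          qed
          then show ?thesis using v w by (intro bexI[of _ "un v (sing w)"]) auto
        next
          case False
          then show ?thesis using v y by (intro bexI[of _ v]) auto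
        qed
      qed
      then show ?thesis by blast
    qed
    then show "(Num (t e) \<and> (\<forall>x\<in>U. E x (t e) \<longrightarrow> P e x)) =
      (\<exists>v\<in>U. Num (t (\<lambda>i. case_nat v e (Suc i))) \<and> (\<forall>x\<in>U. E x (t (\<lambda>i. case_nat v e (Suc i))) \<longrightarrow>
        (\<exists>w\<in>U. E w (case_nat v e 0) \<and>
          R (case_nat w (case_nat x (\<lambda>i. case_nat v e (Suc i)))))))"
      using * by auto
  qed
qed

section \<open>The order on numbers\<close>

lemma Num_transitive: "Num x \<Longrightarrow> y \<in> U \<Longrightarrow> z \<in> U \<Longrightarrow> E z y \<Longrightarrow> E y x \<Longrightarrow> E z x"
proof -
  have *: "\<forall>y\<in>U. E y x \<longrightarrow> (\<forall>z\<in>U. E z y \<longrightarrow> E z x)" if "Num x" for x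
    using that
  proof (rule Num_induct)
    show "separable (\<lambda>x. \<forall>y\<in>U. E y x \<longrightarrow> (\<forall>z\<in>U. E z y \<longrightarrow> E z x))"
      by (intro separable_D0_unary D0_connectives; ((rule D0_mem; simp; fail) | simp))
    show "\<forall>y\<in>U. E y (suc x) \<longrightarrow> (\<forall>z\<in>U. E z y \<longrightarrow> E z (suc x))"
      if "Num x" "\<forall>y\<in>U. E y x \<longrightarrow> (\<forall>z\<in>U. E z y \<longrightarrow> E z x)" for x
      using that(2) E_suc[OF _ Num_in[OF that(1)]] by blast
  qed simp
  then show "Num x \<Longrightarrow> y \<in> U \<Longrightarrow> z \<in> U \<Longrightarrow> E z y \<Longrightarrow> E y x \<Longrightarrow> E z x" by blast
qed

text \<open>Induction takes the place of Foundation: each of the two cases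
  \<open>suc y \<in> y\<close> and \<open>suc y = y\<close> leads to \<open>y \<in> y\<close>, the
  first by transitivity of \<open>y\<close>.\<close>

lemma Num_irrefl: "Num x \<Longrightarrow> \<not> E x x"
proof (rule Num_induct)
  show "separable (\<lambda>x. \<not> E x x)" by (intro separable_D0_unary D0_not D0_mem tv_proj)
  show "\<not> E (suc y) (suc y)" if "Num y" "\<not> E y y" for y
  proof
    assume "E (suc y) (suc y)"
    then have "E (suc y) y \<or> suc y = y" using that by simp
    moreover have y: "E y (suc y)" using that by simp
    moreover have "E y y" if "E (suc y) y"
      using Num_transitive[OF \<open>Num y\<close> _ _ y that] \<open>Num y\<close> by simp
    ultimately show False using that(2) by auto
  qed
qed auto

lemma suc_neq_emp [simp]: "x \<in> U \<Longrightarrow> suc x \<noteq> emp"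
  by (metis E_suc emp)

text \<open>Distinct \<open>x\<close> and \<open>y\<close> with the same successor would be elements
  of each other, and transitivity would give \<open>x \<in> x\<close>.\<close>

lemma suc_inject: "Num x \<Longrightarrow> Num y \<Longrightarrow> suc x = suc y \<longleftrightarrow> x = y"
proof
  assume x: "Num x" and y: "Num y" and eq: "suc x = suc y"
  show "x = y"
  proof (rule ccontr)
    assume "x \<noteq> y"
    moreover have "E x (suc y)" "E y (suc x)" using x y eq E_suc[of x x] E_suc[of y y] by auto
    ultimately have "E x y" "E y x" using x y by auto
    then show False using Num_transitive[OF x, of y x] Num_irrefl x y by auto
  qed
qed auto

text \<open>The predecessor is an element of its successor; bounding it by \<open>x\<close> makes
  the induction predicate \<open>\<Delta>\<^sub>0\<close>.\<close>

lemma Num_cases: assumes "Num x" obtains "x = emp" | y where "Num y" "x = suc y"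
proof -
  from assms have "x = emp \<or> (\<exists>y\<in>U. E y x \<and> x = suc y)"
  proof (rule Num_induct)
    show "separable (\<lambda>x. x = emp \<or> (\<exists>y\<in>U. E y x \<and> x = suc y))"
      by (intro separable_D0_unary D0_connectives; ((rule D0_suc D0_atoms; simp; fail) | simp))
  qed auto
  then show thesis using that Num_elem[OF assms] by blast
qed

lemma emp_less: "Num x \<Longrightarrow> x = emp \<or> E emp x"
proof (rule Num_induct)
  show "separable (\<lambda>x. x = emp \<or> E emp x)"
    by (intro separable_D0_unary D0_disj; (rule D0_atoms; simp))
qed auto

lemma suc_less_suc: "Num x \<Longrightarrow> y \<in> U \<Longrightarrow> E y x \<Longrightarrow> E (suc y) (suc x)"
  by (simp add: Num_def Loc_def del: E_suc Num_in)

text \<open>Induction on \<open>y\<close> for fixed \<open>x\<close>. If \<open>y\<close> is below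
  \<open>x\<close>, then \<open>suc y\<close> is an element of \<open>suc x\<close>, hence below or
  equal to \<open>x\<close>.\<close>

lemma Num_linear: "Num x \<Longrightarrow> Num y \<Longrightarrow> E x y \<or> x = y \<or> E y x"
proof -
  assume x: "Num x" and y: "Num y"
  from y show ?thesis
  proof (rule Num_induct)
    show "separable (\<lambda>y. E x y \<or> x = y \<or> E y x)"
      by (intro separable_D0_unary D0_disj; (rule D0_atoms; simp add: x))
    show "E x emp \<or> x = emp \<or> E emp x" using emp_less[OF x] by blast
    show "E x (suc y) \<or> x = suc y \<or> E (suc y) x" if "Num y" "E x y \<or> x = y \<or> E y x" for y
      using suc_less_suc[OF x, of y] that x by auto
  qed
qed

section \<open>Recursion on numbers\<close>

text \<open>\<open>f\<close> records a computation from the initial value \<open>c\<close> to the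
  value \<open>z\<close> at \<open>y\<close>, with step relation \<open>g\<close> and parameter
  \<open>a\<close>. The conjunct \<open>Num y\<close> gives the bounded quantifier the form to which
  \<open>S1_ball\<close> applies, and naming \<open>suc i\<close> by \<open>j\<close> keeps the
  atoms definable.\<close>

definition Rec :: "('a \<Rightarrow> 'a \<Rightarrow> 'a \<Rightarrow> bool) \<Rightarrow> 'a \<Rightarrow> 'a \<Rightarrow> 'a \<Rightarrow> 'a \<Rightarrow> bool" where
  "Rec g a c y z \<longleftrightarrow> (\<exists>f\<in>U. val f emp c \<and> val f y z \<and> Num y \<and>
    (\<forall>i\<in>U. E i y \<longrightarrow> (\<exists>u\<in>U. \<exists>v\<in>U. \<exists>j\<in>U. j = suc i \<and> val f i u \<and> val f j v \<and> g a u v)))"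

lemmas tv_shifts = tv_shift tv_shift[OF tv_shift] tv_shift[OF tv_shift[OF tv_shift]]
  tv_shift[OF tv_shift[OF tv_shift[OF tv_shift]]]
  tv_shift[OF tv_shift[OF tv_shift[OF tv_shift[OF tv_shift]]]]

lemma S1_Rec:
  assumes g: "\<And>a s t. tv a \<Longrightarrow> tv s \<Longrightarrow> tv t \<Longrightarrow> S1 (\<lambda>e. g (a e) (s e) (t e))"
    and tv: "tv a" "tv c" "tv y" "tv z"
  shows "S1 (\<lambda>e. Rec g (a e) (c e) (y e) (z e))"
  unfolding Rec_def
  by (rule S1_ex, rule S1_conj[OF S1_D0], rule D0_val, (simp_all add: tv tv_shifts)[3],
      rule S1_conj[OF S1_D0], rule D0_val, (simp_all add: tv tv_shifts)[3],
      rule S1_ball, (intro S1_ex S1_conj; (rule g S1_D0[OF D0_suc] S1_D0[OF D0_val]; simp add: tv tv_shifts)),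
      simp add: tv tv_shifts)

lemma Rec_emp: "c \<in> U \<Longrightarrow> z \<in> U \<Longrightarrow> Rec g a c emp z \<longleftrightarrow> z = c"
proof
  assume "c \<in> U" "z \<in> U" "Rec g a c emp z"
  then show "z = c" unfolding Rec_def using val_functional emp(1) by blast
next
  assume c: "c \<in> U" "z = c"
  \<comment> \<open>A computation of length 0: the empty set updated at argument 0.\<close>
  then obtain f where "f \<in> U" "val f emp c" using val_update[of emp emp c] by auto
  then show "Rec g a c emp z" using c by (auto simp: Rec_def)
qed

text \<open>From left to right the same \<open>f\<close> serves for \<open>y\<close>. Conversely, a
  computation for \<open>y\<close> is updated at \<open>suc y\<close> with value
  \<open>z\<close>.\<close>

lemma Rec_suc:
  assumes y: "Num y" and c: "c \<in> U" and z: "z \<in> U"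
  shows "Rec g a c (suc y) z \<longleftrightarrow> (\<exists>u\<in>U. Rec g a c y u \<and> g a u z)"
proof
  assume "Rec g a c (suc y) z"
  then obtain f where f: "f \<in> U" "val f emp c" "val f (suc y) z"
    and st: "\<And>i. i \<in> U \<Longrightarrow> E i (suc y) \<Longrightarrow> \<exists>u\<in>U. \<exists>v\<in>U. val f i u \<and> val f (suc i) v \<and> g a u v"
    unfolding Rec_def by blast
  obtain u v where u: "u \<in> U" "v \<in> U" "val f y u" "val f (suc y) v" "g a u v"
    using st[of y] y by auto
  have "v = z" using val_functional[of f "suc y" v z] f u y z by simp
  moreover have "Rec g a c y u"
    unfolding Rec_def
  proof (rule bexI[of _ f], intro conjI ballI impI)
    fix i assume "i \<in> U" "E i y"
    then show "\<exists>u\<in>U. \<exists>v\<in>U. \<exists>j\<in>U. j = suc i \<and> val f i u \<and> val f j v \<and> g a u v"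
      using st[of i] y by auto
  qed (use f u y in auto)
  ultimately show "\<exists>u\<in>U. Rec g a c y u \<and> g a u z" using u by blast
next
  assume "\<exists>u\<in>U. Rec g a c y u \<and> g a u z"
  then obtain u f where u: "u \<in> U" "g a u z" and f: "f \<in> U" "val f emp c" "val f y u"
    and st: "\<And>i. i \<in> U \<Longrightarrow> E i y \<Longrightarrow> \<exists>u\<in>U. \<exists>v\<in>U. val f i u \<and> val f (suc i) v \<and> g a u v"
    unfolding Rec_def by blast
  have yU: "y \<in> U" "suc y \<in> U" using y by simp_all
  obtain h where h: "h \<in> U" "val h (suc y) z"
    "\<And>j w. j \<in> U \<Longrightarrow> w \<in> U \<Longrightarrow> j \<noteq> suc y \<Longrightarrow> val f j w \<Longrightarrow> val h j w"
    using val_update[OF f(1) yU(2) z] by blast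
  have irr: "\<not> E y y" "\<not> E (suc y) (suc y)" using y Num_irrefl by simp_all
  show "Rec g a c (suc y) z"
    unfolding Rec_def
  proof (rule bexI[of _ h], intro conjI ballI impI)
    show "val h emp c" using h(3)[of emp c] f c suc_neq_emp[OF yU(1)] by auto
    fix i assume i: "i \<in> U" "E i (suc y)"
    have ne: "i \<noteq> suc y" using i irr by blast
    show "\<exists>u\<in>U. \<exists>v\<in>U. \<exists>j\<in>U. j = suc i \<and> val h i u \<and> val h j v \<and> g a u v"
    proof (cases "i = y")
      case True
      have "val h y u" using h(3)[of y u] yU u f ne True by simp
      then show ?thesis using True u z h(2) yU by blast
    next
      case False
      then have iy: "E i y" using i yU by simp
      then have Ni: "Num i" using Num_elem y i by blast
      obtain u v where uv: "u \<in> U" "v \<in> U" "val f i u" "val f (suc i) v" "g a u v"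
        using st[OF i(1) iy] by blast
      \<comment> \<open>Injectivity of the successor ensures that the update does not touch the
        value at \<open>suc i\<close>.\<close>
      have "suc i \<noteq> suc y" using suc_inject[OF Ni y] False by blast
      then have "val h i u" "val h (suc i) v" using h(3) uv i ne by simp_all
      then show ?thesis using uv suc_in[OF i(1)] by blast
    qed
  qed (use h y in auto)
qed

text \<open>Separating twice covers conjunctions of a \<open>\<Sigma>\<^sub>1\<close> and a
  \<open>\<Pi>\<^sub>1\<close> predicate, without placing them in one level of the
  hierarchy.\<close>

lemma separable_conj:
  assumes "separable P" "separable Q" shows "separable (\<lambda>x. P x \<and> Q x)"
  unfolding separable_def
proof
  fix a assume "a \<in> U"
  then obtain b where b: "b \<in> U" "\<And>x. x \<in> U \<Longrightarrow> E x b \<longleftrightarrow> E x a \<and> P x"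
    using separableD[OF assms(1)] by blast
  then obtain c where "c \<in> U" "\<And>x. x \<in> U \<Longrightarrow> E x c \<longleftrightarrow> E x b \<and> Q x"
    using separableD[OF assms(2) b(1)] by blast
  then show "\<exists>b\<in>U. \<forall>x\<in>U. E x b \<longleftrightarrow> E x a \<and> P x \<and> Q x" using b by (intro bexI[of _ c]) auto
qed

text \<open>Induction on \<open>y\<close> for existence and uniqueness at once. \<open>?Q\<close>
  states them as a \<open>\<Sigma>\<^sub>1\<close> and a negated \<open>\<Sigma>\<^sub>1\<close>
  predicate, which makes it separable; \<open>Q_iff\<close> translates to the form wanted.\<close>

lemma Rec_total:
  assumes g: "\<And>a s t. tv a \<Longrightarrow> tv s \<Longrightarrow> tv t \<Longrightarrow> S1 (\<lambda>e. g (a e) (s e) (t e))"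
    and tot: "\<And>u. Num u \<Longrightarrow> \<exists>v. Num v \<and> (\<forall>w\<in>U. g a u w \<longleftrightarrow> w = v)"
    and a: "a \<in> U" and c: "Num c" and y: "Num y"
  shows "\<exists>z. Num z \<and> (\<forall>w\<in>U. Rec g a c y w \<longleftrightarrow> w = z)"
proof -
  let ?R = "\<lambda>y z. Rec g a c y z"
  let ?Q = "\<lambda>y. (\<exists>z\<in>U. Num z \<and> ?R y z) \<and> \<not> (\<exists>z\<in>U. \<exists>w\<in>U. z \<noteq> w \<and> ?R y z \<and> ?R y w)"
  have cU: "c \<in> U" using c by simp
  have RS: "S1 (\<lambda>e. ?R (s e) (t e))" if "tv s" "tv t" for s t
    by (rule S1_Rec[OF g]) (use that a cU in simp_all)
  have "separable ?Q"
    by (intro separable_conj separable_not separable_S1 S1_ex S1_conj;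
        (rule RS S1_D0[OF D0_Num] S1_D0[OF D0_not[OF D0_eq]]; simp))
  have Q_iff: "?Q y \<longleftrightarrow> (\<exists>z. Num z \<and> (\<forall>w\<in>U. ?R y w \<longleftrightarrow> w = z))" for y
  proof
    assume Q: "?Q y"
    then obtain z where "z \<in> U" "Num z" "?R y z" by blast
    then show "\<exists>z. Num z \<and> (\<forall>w\<in>U. ?R y w \<longleftrightarrow> w = z)" using Q by (intro exI[of _ z]) blast
  next
    assume "\<exists>z. Num z \<and> (\<forall>w\<in>U. ?R y w \<longleftrightarrow> w = z)"
    then obtain z where "Num z" "\<forall>w\<in>U. ?R y w \<longleftrightarrow> w = z" by blast
    moreover from this have "z \<in> U" by simp
    ultimately show "?Q y" by (intro conjI bexI[of _ z]) auto
  qed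
  from y \<open>separable ?Q\<close> have "?Q y"
  proof (rule Num_induct)
    show "?Q emp" unfolding Q_iff using c cU by (intro exI[of _ c]) (simp add: Rec_emp)
    fix y assume y: "Num y" and "?Q y"
    then obtain z where z: "Num z" "\<forall>w\<in>U. ?R y w \<longleftrightarrow> w = z" unfolding Q_iff by blast
    obtain v where v: "Num v" "\<forall>w\<in>U. g a z w \<longleftrightarrow> w = v" using tot[OF z(1)] by blast
    have "\<forall>w\<in>U. ?R (suc y) w \<longleftrightarrow> w = v"
      using z v Num_in[OF z(1)] by (auto simp: Rec_suc[OF y cU])
    then show "?Q (suc y)" unfolding Q_iff using v by blast
  qed
  then show ?thesis unfolding Q_iff .
qed

section \<open>Addition and multiplication\<close>

definition plus :: "'a \<Rightarrow> 'a \<Rightarrow> 'a \<Rightarrow> bool" where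
  "plus x y z \<longleftrightarrow> Rec (\<lambda>a u v. v = suc u) x x y z"

definition times :: "'a \<Rightarrow> 'a \<Rightarrow> 'a \<Rightarrow> bool" where
  "times x y z \<longleftrightarrow> Rec (\<lambda>a u v. plus u a v) x emp y z"

definition pl :: "'a \<Rightarrow> 'a \<Rightarrow> 'a" where
  "pl x y = (THE z. Num z \<and> plus x y z)"

definition ti :: "'a \<Rightarrow> 'a \<Rightarrow> 'a" where
  "ti x y = (THE z. Num z \<and> times x y z)"

lemma S1_plus: "tv x \<Longrightarrow> tv y \<Longrightarrow> tv z \<Longrightarrow> S1 (\<lambda>e. plus (x e) (y e) (z e))"
  unfolding plus_def by (rule S1_Rec) (simp_all add: S1_D0 D0_suc)

lemma S1_times: "tv x \<Longrightarrow> tv y \<Longrightarrow> tv z \<Longrightarrow> S1 (\<lambda>e. times (x e) (y e) (z e))"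
  unfolding times_def by (rule S1_Rec) (simp_all add: S1_plus)

lemma plus_total: "Num x \<Longrightarrow> Num y \<Longrightarrow> \<exists>z. Num z \<and> (\<forall>w\<in>U. plus x y w \<longleftrightarrow> w = z)"
  unfolding plus_def
  by (rule Rec_total) (simp_all add: S1_D0 D0_suc, metis Num_suc)

lemma pl:
  assumes "Num x" "Num y"
  shows pl_Num [simp]: "Num (pl x y)" and plus_iff: "w \<in> U \<Longrightarrow> plus x y w \<longleftrightarrow> w = pl x y"
proof -
  obtain z where z: "Num z" "\<forall>w\<in>U. plus x y w \<longleftrightarrow> w = z" using plus_total[OF assms] by blast
  then have "pl x y = z" unfolding pl_def by (intro the_equality) auto
  then show "Num (pl x y)" "w \<in> U \<Longrightarrow> plus x y w \<longleftrightarrow> w = pl x y" using z by simp_all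
qed

lemma times_total: "Num x \<Longrightarrow> Num y \<Longrightarrow> \<exists>z. Num z \<and> (\<forall>w\<in>U. times x y w \<longleftrightarrow> w = z)"
  unfolding times_def
  by (rule Rec_total, auto simp: S1_plus plus_iff) (metis pl_Num)

lemma ti:
  assumes "Num x" "Num y"
  shows ti_Num [simp]: "Num (ti x y)" and times_iff: "w \<in> U \<Longrightarrow> times x y w \<longleftrightarrow> w = ti x y"
proof -
  obtain z where z: "Num z" "\<forall>w\<in>U. times x y w \<longleftrightarrow> w = z" using times_total[OF assms] by blast
  then have "ti x y = z" unfolding ti_def by (intro the_equality) auto
  then show "Num (ti x y)" "w \<in> U \<Longrightarrow> times x y w \<longleftrightarrow> w = ti x y" using z by simp_all
qed

lemma pl_emp [simp]: "Num x \<Longrightarrow> pl x emp = x"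
  using plus_iff[of x emp x] by (simp add: plus_def Rec_emp)

lemma pl_suc [simp]: assumes "Num x" "Num y" shows "pl x (suc y) = suc (pl x y)"
proof -
  have "Rec (\<lambda>a u v. v = suc u) x x y (pl x y)"
    using plus_iff[OF assms, of "pl x y"] assms by (simp add: plus_def)
  then have "plus x (suc y) (suc (pl x y))"
    unfolding plus_def using assms Num_in[OF pl_Num[OF assms]] by (subst Rec_suc) auto
  then show ?thesis using plus_iff[of x "suc y" "suc (pl x y)"] assms by simp
qed

lemma ti_emp [simp]: "Num x \<Longrightarrow> ti x emp = emp"
  using times_iff[of x emp emp] by (simp add: times_def Rec_emp)

lemma ti_suc [simp]: assumes "Num x" "Num y" shows "ti x (suc y) = pl (ti x y) x"
proof -
  have "Rec (\<lambda>a u v. plus u a v) x emp y (ti x y)"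
    using times_iff[OF assms, of "ti x y"] assms by (simp add: times_def)
  moreover have "plus (ti x y) x (pl (ti x y) x)" using assms by (simp add: plus_iff)
  ultimately have "times x (suc y) (pl (ti x y) x)"
    unfolding times_def using assms Num_in[OF ti_Num[OF assms]] by (subst Rec_suc) auto
  then show ?thesis using times_iff[of x "suc y" "pl (ti x y) x"] assms by simp
qed

section \<open>The arithmetical structure of the numbers\<close>

definition N :: "(arith_fun, arith_rel, 'a) struct" where
  "N = \<lparr> univ = Collect Num,
     fun_int = (\<lambda>f xs. case f of Zero \<Rightarrow> emp | One \<Rightarrow> suc emp
       | Add \<Rightarrow> pl (xs ! 0) (xs ! 1) | Mult \<Rightarrow> ti (xs ! 0) (xs ! 1)),
     rel_int = (\<lambda>_ xs. E (xs ! 0) (xs ! 1)) \<rparr>"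

lemma N_simps [simp]:
  "univ N = Collect Num"
  "fun_int N Zero xs = emp" "fun_int N One xs = suc emp"
  "fun_int N Add [x, y] = pl x y" "fun_int N Mult [x, y] = ti x y"
  "rel_int N r [x, y] = E x y"
  by (simp_all add: N_def)

lemma is_struct_N: "is_struct arith_lang N"
  unfolding is_struct_def
proof (intro conjI allI impI)
  show "univ N \<noteq> {}" using Num_emp by (simp only: N_simps) blast
  fix f and xs :: "'a list"
  assume f: "fun_arity arith_lang f = Some (length xs)" and xs: "set xs \<subseteq> univ N"
  have "Num (xs ! i)" if "i < length xs" for i using nth_mem[OF that] xs by auto
  then show "fun_int N f xs \<in> univ N"
    using f by (cases f) (simp_all add: arith_lang_def N_def)
qed

section \<open>\<open>\<Sigma>\<^sub>1\<close> predicates of numbers\<close>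

abbreviation Num_env :: "(nat \<Rightarrow> 'a) \<Rightarrow> bool" where
  "Num_env e \<equiv> \<forall>i. Num (e i)"

lemma Num_env_range: "Num_env e \<Longrightarrow> range e \<subseteq> U"
  by auto

lemma Num_env_cons: "Num x \<Longrightarrow> Num_env e \<Longrightarrow> Num_env (case_nat x e)"
  by (simp split: nat.split)

lemma eval_N: "wf_tm arith_lang t \<Longrightarrow> Num_env e \<Longrightarrow> Num (eval N e t)"
  using eval_in_univ[OF is_struct_N, of e t] by auto

text \<open>Agreement is asked only on environments of numbers, because \<open>pl\<close> and
  \<open>ti\<close> are known to agree with the graphs \<open>plus\<close> and \<open>times\<close>
  only there.\<close>

definition S1N :: "((nat \<Rightarrow> 'a) \<Rightarrow> bool) \<Rightarrow> bool" where
  "S1N P \<longleftrightarrow> (\<exists>A. S1 A \<and> (\<forall>e. Num_env e \<longrightarrow> P e = A e))"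

lemma S1NI: "S1 A \<Longrightarrow> (\<And>e. Num_env e \<Longrightarrow> P e = A e) \<Longrightarrow> S1N P"
  unfolding S1N_def by blast

lemma S1N_cong:
  assumes "S1N P" "\<And>e. Num_env e \<Longrightarrow> Q e = P e" shows "S1N Q"
proof -
  obtain A where A: "S1 A" "\<And>e. Num_env e \<Longrightarrow> P e = A e" using assms(1) unfolding S1N_def by blast
  show ?thesis by (rule S1NI[OF A(1)]) (simp add: A(2) assms(2))
qed

lemma S1N_S1: "S1 P \<Longrightarrow> S1N P"
  by (rule S1NI) (assumption, rule refl)

lemma S1N_conj: assumes "S1N P" "S1N Q" shows "S1N (\<lambda>e. P e \<and> Q e)"
proof -
  obtain A where A: "S1 A" "\<And>e. Num_env e \<Longrightarrow> P e = A e" using assms(1) unfolding S1N_def by blast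
  obtain B where B: "S1 B" "\<And>e. Num_env e \<Longrightarrow> Q e = B e" using assms(2) unfolding S1N_def by blast
  show ?thesis by (rule S1NI[OF S1_conj[OF A(1) B(1)]]) (simp add: A(2) B(2))
qed

lemma S1N_disj: assumes "S1N P" "S1N Q" shows "S1N (\<lambda>e. P e \<or> Q e)"
proof -
  obtain A where A: "S1 A" "\<And>e. Num_env e \<Longrightarrow> P e = A e" using assms(1) unfolding S1N_def by blast
  obtain B where B: "S1 B" "\<And>e. Num_env e \<Longrightarrow> Q e = B e" using assms(2) unfolding S1N_def by blast
  show ?thesis by (rule S1NI[OF S1_disj[OF A(1) B(1)]]) (simp add: A(2) B(2))
qed

lemma case_nat_eta: "case_nat (e 0) (\<lambda>i. e (Suc i)) = e"
  by (rule ext) (simp split: nat.split)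

lemma S1N_ex: assumes "S1N (\<lambda>e. P (\<lambda>i. e (Suc i)) (e 0))" shows "S1N (\<lambda>e. \<exists>x\<in>Collect Num. P e x)"
proof -
  obtain A where A: "S1 A" "\<And>e. Num_env e \<Longrightarrow> P (\<lambda>i. e (Suc i)) (e 0) = A e"
    using assms unfolding S1N_def by blast
  have *: "S1 (\<lambda>e. \<exists>x\<in>U. Num x \<and> A (case_nat x e))"
    by (rule S1_ex, rule S1_conj) (simp_all add: S1_D0 D0_Num case_nat_eta A(1))
  show ?thesis
  proof (rule S1NI[OF *])
    fix e assume e: "Num_env e"
    have "P e x = A (case_nat x e)" if "Num x" for x
      using A(2)[OF Num_env_cons[OF that e]] by simp
    then show "(\<exists>x\<in>Collect Num. P e x) = (\<exists>x\<in>U. Num x \<and> A (case_nat x e))" by auto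
  qed
qed

text \<open>Elements of a number are numbers, so the quantifier may range over the whole universe,
  and \<open>S1_ball\<close> applies with bound \<open>e k\<close>.\<close>

lemma S1N_ball:
  assumes "S1N (\<lambda>e. P (\<lambda>i. e (Suc i)) (e 0))"
  shows "S1N (\<lambda>e. \<forall>x\<in>Collect Num. E x (e k) \<longrightarrow> P e x)"
proof -
  obtain A where A: "S1 A" "\<And>e. Num_env e \<Longrightarrow> P (\<lambda>i. e (Suc i)) (e 0) = A e"
    using assms unfolding S1N_def by blast
  have *: "S1 (\<lambda>e. Num (e k) \<and> (\<forall>x\<in>U. E x (e k) \<longrightarrow> A (case_nat x e)))"
    by (rule S1_ball) (simp_all add: case_nat_eta A(1))
  show ?thesis
  proof (rule S1NI[OF *])
    fix e assume e: "Num_env e"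
    have "P e x = A (case_nat x e)" if "Num x" for x
      using A(2)[OF Num_env_cons[OF that e]] by simp
    moreover have "Num x" if "x \<in> U" "E x (e k)" for x using Num_elem e that by blast
    ultimately show "(\<forall>x\<in>Collect Num. E x (e k) \<longrightarrow> P e x) =
      (Num (e k) \<and> (\<forall>x\<in>U. E x (e k) \<longrightarrow> A (case_nat x e)))" using e by auto
  qed
qed

section \<open>Terms and \<open>\<Delta>\<^sub>0\<close> formulas of arithmetic\<close>

lemma S1_rename: assumes "S1 P" shows "S1 (\<lambda>e. P (\<lambda>i. e (r i)))"
proof -
  obtain R where R: "D0 R" "\<And>e. range e \<subseteq> U \<Longrightarrow> P e = (\<exists>w\<in>U. R (case_nat w e))"
    using assms unfolding S1_def by blast
  have eq: "(\<lambda>i. case_nat w e (case_nat 0 (\<lambda>i. Suc (r i)) i)) = case_nat w (\<lambda>i. e (r i))"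
    for w :: 'a and e
    by (rule ext) (simp split: nat.split)
  show ?thesis
  proof (rule S1I)
    show "D0 (\<lambda>e. R (\<lambda>i. e (case_nat 0 (\<lambda>i. Suc (r i)) i)))" by (rule Def_subst[OF R(1)]) simp
    fix e :: "nat \<Rightarrow> 'a" assume "range e \<subseteq> U"
    then have "range (\<lambda>i. e (r i)) \<subseteq> U" by auto
    from R(2)[OF this] show "P (\<lambda>i. e (r i)) =
      (\<exists>w\<in>U. R (\<lambda>i. case_nat w e (case_nat 0 (\<lambda>i. Suc (r i)) i)))" by (simp only: eq)
  qed
qed

lemma S1N_rename: assumes "S1N P" shows "S1N (\<lambda>e. P (\<lambda>i. e (r i)))"
proof -
  obtain A where A: "S1 A" "\<And>e. Num_env e \<Longrightarrow> P e = A e" using assms unfolding S1N_def by blast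
  show ?thesis by (rule S1NI[OF S1_rename[OF A(1), of r]]) (simp add: A(2))
qed

text \<open>Induction on the term: the values of the two arguments are named by existential
  quantifiers and fed into the \<open>\<Sigma>\<^sub>1\<close> graph \<open>G\<close> of the
  operation.\<close>

lemma S1N_eval0: "wf_tm arith_lang t \<Longrightarrow> S1N (\<lambda>e. e 0 = eval N (\<lambda>i. e (Suc i)) t)"
proof (induction t)
  case (Var k)
  show ?case by (simp add: S1N_S1 S1_D0 D0_eq)
next
  case (Fn f ts)
  have bin: "S1N (\<lambda>e. e 0 = h (eval N (\<lambda>i. e (Suc i)) s) (eval N (\<lambda>i. e (Suc i)) t))"
    if IH: "S1N (\<lambda>e. e 0 = eval N (\<lambda>i. e (Suc i)) s)" "S1N (\<lambda>e. e 0 = eval N (\<lambda>i. e (Suc i)) t)"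
      and wf: "wf_tm arith_lang s" "wf_tm arith_lang t"
      and h: "S1 (\<lambda>e. G (e 1) (e 0) (e 2))"
        "\<And>x y w. Num x \<Longrightarrow> Num y \<Longrightarrow> Num w \<Longrightarrow> G x y w \<longleftrightarrow> w = h x y"
    for h s t G
  proof (rule S1N_cong)
    \<comment> \<open>Under the two new quantifiers \<open>y\<close> has index 0, \<open>x\<close>
      index 1, the value of the whole term index 2, and the variables of the terms start at
      3.\<close>
    have "S1N (\<lambda>e. e 1 = eval N (\<lambda>i. e (Suc (Suc (Suc i)))) s)"
      using S1N_rename[OF IH(1), of "case_nat 1 (\<lambda>i. Suc (Suc (Suc i)))"] by simp
    moreover have "S1N (\<lambda>e. e 0 = eval N (\<lambda>i. e (Suc (Suc (Suc i)))) t)"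
      using S1N_rename[OF IH(2), of "case_nat 0 (\<lambda>i. Suc (Suc (Suc i)))"] by simp
    ultimately show "S1N (\<lambda>e. \<exists>x\<in>Collect Num. \<exists>y\<in>Collect Num. x = eval N (\<lambda>i. e (Suc i)) s \<and>
        y = eval N (\<lambda>i. e (Suc i)) t \<and> G x y (e 0))"
      using h(1) by (intro S1N_ex S1N_conj) (simp_all add: numeral_2_eq_2 S1N_S1)
    fix e :: "nat \<Rightarrow> 'a" assume e: "Num_env e"
    then have "Num (eval N (\<lambda>i. e (Suc i)) s)" "Num (eval N (\<lambda>i. e (Suc i)) t)"
      using wf eval_N by auto
    then show "(e 0 = h (eval N (\<lambda>i. e (Suc i)) s) (eval N (\<lambda>i. e (Suc i)) t)) =
      (\<exists>x\<in>Collect Num. \<exists>y\<in>Collect Num. x = eval N (\<lambda>i. e (Suc i)) s \<and>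
        y = eval N (\<lambda>i. e (Suc i)) t \<and> G x y (e 0))"
      using h(2) e by auto
  qed
  show ?case
  proof (cases f)
    case Zero
    then show ?thesis by (simp add: S1N_S1 S1_D0 D0_eq)
  next
    case One
    then show ?thesis by (simp add: S1N_S1 S1_D0 D0_eq)
  next
    case Add
    then have "length ts = 2" using Fn.prems by (simp add: arith_lang_def)
    then obtain s t where ts: "ts = [s, t]" by (auto simp: numeral_2_eq_2 length_Suc_conv)
    have "S1N (\<lambda>e. e 0 = pl (eval N (\<lambda>i. e (Suc i)) s) (eval N (\<lambda>i. e (Suc i)) t))"
      by (rule bin[where G = plus]) (use Fn ts in \<open>auto simp: S1_plus plus_iff\<close>)
    then show ?thesis using Add ts by simp
  next
    case Mult
    then have "length ts = 2" using Fn.prems by (simp add: arith_lang_def)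
    then obtain s t where ts: "ts = [s, t]" by (auto simp: numeral_2_eq_2 length_Suc_conv)
    have "S1N (\<lambda>e. e 0 = ti (eval N (\<lambda>i. e (Suc i)) s) (eval N (\<lambda>i. e (Suc i)) t))"
      by (rule bin[where G = times]) (use Fn ts in \<open>auto simp: S1_times times_iff\<close>)
    then show ?thesis using Mult ts by simp
  qed
qed

lemma S1N_eval: "wf_tm arith_lang t \<Longrightarrow> S1N (\<lambda>e. e k = eval N (\<lambda>i. e (r i)) t)"
  using S1N_rename[OF S1N_eval0, of t "case_nat k r"] by simp

text \<open>Evaluation is total and single-valued on numbers, so naming the two values existentially
  is faithful for an atomic formula and equally for its negation.\<close>

lemma S1N_let2:
  assumes "wf_tm arith_lang s" "wf_tm arith_lang t" "S1 (\<lambda>e. G (e 1) (e 0))"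
  shows "S1N (\<lambda>e. G (eval N e s) (eval N e t))"
proof (rule S1N_cong)
  show "S1N (\<lambda>e. \<exists>x\<in>Collect Num. \<exists>y\<in>Collect Num. x = eval N e s \<and> y = eval N e t \<and> G x y)"
    using assms by (intro S1N_ex S1N_conj) (simp_all add: S1N_eval S1N_S1)
qed (use assms eval_N in auto)

text \<open>The value of the bounding term is first named by \<open>b\<close>, so that the bound
  becomes a variable. In \<open>P'\<close> the index shift skips \<open>b\<close>.\<close>

lemma S1N_bounded:
  assumes t: "wf_tm arith_lang t" and P: "S1N P"
  shows "S1N (\<lambda>e. \<forall>x\<in>Collect Num. E x (eval N e t) \<longrightarrow> P (case_nat x e))"
    "S1N (\<lambda>e. \<exists>x\<in>Collect Num. E x (eval N e t) \<and> P (case_nat x e))"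
proof -
  have P': "S1N (\<lambda>e. P (case_nat (e 0) (\<lambda>i. e (Suc (Suc i)))))"
    using S1N_rename[OF P, of "case_nat 0 (\<lambda>i. Suc (Suc i))"]
    by (rule S1N_cong) (intro arg_cong[of _ _ P] ext, simp split: nat.split)
  show "S1N (\<lambda>e. \<forall>x\<in>Collect Num. E x (eval N e t) \<longrightarrow> P (case_nat x e))"
  proof (rule S1N_cong)
    show "S1N (\<lambda>e. \<exists>b\<in>Collect Num. b = eval N e t \<and> (\<forall>x\<in>Collect Num. E x b \<longrightarrow> P (case_nat x e)))"
      by (intro S1N_ex S1N_conj S1N_eval t S1N_ball P')
  qed (use eval_N[OF t] in auto)
  show "S1N (\<lambda>e. \<exists>x\<in>Collect Num. E x (eval N e t) \<and> P (case_nat x e))"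
  proof (rule S1N_cong)
    show "S1N (\<lambda>e. \<exists>b\<in>Collect Num. b = eval N e t \<and> (\<exists>x\<in>Collect Num. E x b \<and> P (case_nat x e)))"
      by (intro S1N_ex S1N_conj S1N_eval t P') (simp add: S1N_S1 S1_D0 D0_mem)
  qed (use eval_N[OF t] in auto)
qed

lemma wf_lift_tm: "wf_tm L (lift_tm t) = wf_tm L t"
  by (induction t) (auto simp: list_all_iff)

lemma eval_lift_tm: "eval K (case_nat a e) (lift_tm t) = eval K e t"
  by (simp add: eval_subst)

text \<open>Both claims are proved in one induction: negation exchanges them, and the complement of
  a bounded quantifier is the dual quantifier over the complement.\<close>

lemma S1N_Delta0:
  assumes "\<phi> \<in> arith_Delta0"
  shows "S1N (\<lambda>e. sat N e \<phi>)" "S1N (\<lambda>e. \<not> sat N e \<phi>)"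
proof -
  have "S1N (\<lambda>e. sat N e \<phi>) \<and> S1N (\<lambda>e. \<not> sat N e \<phi>)"
    if "\<phi> \<in> Delta0 {less_fm (Var 0) (lift_tm t) | t. True}" "wf_fm arith_lang \<phi>" for \<phi> :: arith_fm
    using that
  proof (induction \<phi>)
    case (1 r ts)
    then have "length ts = 2" by (simp add: arith_lang_def)
    then obtain s t where ts: "ts = [s, t]" by (auto simp: numeral_2_eq_2 length_Suc_conv)
    then have wf: "wf_tm arith_lang s" "wf_tm arith_lang t" using 1 by auto
    show ?case
      using S1N_let2[OF wf, of E] S1N_let2[OF wf, of "\<lambda>x y. \<not> E x y"]
      by (simp add: ts S1_D0 D0_mem D0_not)
  next
    case (2 s t)
    then have wf: "wf_tm arith_lang s" "wf_tm arith_lang t" by auto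
    show ?case
      using S1N_let2[OF wf, of "(=)"] S1N_let2[OF wf, of "(\<noteq>)"]
      by (simp add: S1_D0 D0_eq D0_not)
  next
    case (7 \<gamma> \<phi>)
    then obtain t where \<gamma>: "\<gamma> = less_fm (Var 0) (lift_tm t)" by blast
    have t: "wf_tm arith_lang t" using 7 \<gamma> by (simp add: wf_lift_tm)
    have IH: "S1N (\<lambda>e. sat N e \<phi>)" "S1N (\<lambda>e. \<not> sat N e \<phi>)" using 7 by auto
    show ?case using S1N_bounded(1)[OF t IH(1)] S1N_bounded(2)[OF t IH(2)]
      by (simp add: \<gamma> eval_lift_tm)
  next
    case (8 \<gamma> \<phi>)
    then obtain t where \<gamma>: "\<gamma> = less_fm (Var 0) (lift_tm t)" by blast
    have t: "wf_tm arith_lang t" using 8 \<gamma> by (simp add: wf_lift_tm)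
    have IH: "S1N (\<lambda>e. sat N e \<phi>)" "S1N (\<lambda>e. \<not> sat N e \<phi>)" using 8 by auto
    have "S1N (\<lambda>e. \<not> sat N e (Ex (Conj \<gamma> \<phi>)))"
      by (rule S1N_cong[OF S1N_bounded(1)[OF t IH(2)]]) (auto simp: \<gamma> eval_lift_tm)
    then show ?case using S1N_bounded(2)[OF t IH(1)] by (simp add: \<gamma> eval_lift_tm)
  next
    case (4 \<phi> \<psi>)
    then have IH: "S1N (\<lambda>e. sat N e \<phi>)" "S1N (\<lambda>e. \<not> sat N e \<phi>)"
      "S1N (\<lambda>e. sat N e \<psi>)" "S1N (\<lambda>e. \<not> sat N e \<psi>)" by auto
    have "S1N (\<lambda>e. sat N e (Conj \<phi> \<psi>))" by (rule S1N_cong[OF S1N_conj[OF IH(1,3)]]) auto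
    moreover have "S1N (\<lambda>e. \<not> sat N e (Conj \<phi> \<psi>))" by (rule S1N_cong[OF S1N_disj[OF IH(2,4)]]) auto
    ultimately show ?case by blast
  next
    case (5 \<phi> \<psi>)
    then have IH: "S1N (\<lambda>e. sat N e \<phi>)" "S1N (\<lambda>e. \<not> sat N e \<phi>)"
      "S1N (\<lambda>e. sat N e \<psi>)" "S1N (\<lambda>e. \<not> sat N e \<psi>)" by auto
    have "S1N (\<lambda>e. sat N e (Disj \<phi> \<psi>))" by (rule S1N_cong[OF S1N_disj[OF IH(1,3)]]) auto
    moreover have "S1N (\<lambda>e. \<not> sat N e (Disj \<phi> \<psi>))" by (rule S1N_cong[OF S1N_conj[OF IH(2,4)]]) auto
    ultimately show ?case by blast
  next
    case (6 \<phi> \<psi>)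
    then have IH: "S1N (\<lambda>e. sat N e \<phi>)" "S1N (\<lambda>e. \<not> sat N e \<phi>)"
      "S1N (\<lambda>e. sat N e \<psi>)" "S1N (\<lambda>e. \<not> sat N e \<psi>)" by auto
    have "S1N (\<lambda>e. sat N e (Imp \<phi> \<psi>))" by (rule S1N_cong[OF S1N_disj[OF IH(2,3)]]) auto
    moreover have "S1N (\<lambda>e. \<not> sat N e (Imp \<phi> \<psi>))" by (rule S1N_cong[OF S1N_conj[OF IH(1,4)]]) auto
    ultimately show ?case by blast
  qed simp
  then show "S1N (\<lambda>e. sat N e \<phi>)" "S1N (\<lambda>e. \<not> sat N e \<phi>)"
    using assms unfolding arith_Delta0_def by blast+
qed

section \<open>The arithmetical hierarchy on numbers\<close>

definition HN :: "bool \<Rightarrow> nat \<Rightarrow> ((nat \<Rightarrow> 'a) \<Rightarrow> bool) \<Rightarrow> bool" where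
  "HN b k P \<longleftrightarrow> (\<exists>A. H b k A \<and> (\<forall>e. Num_env e \<longrightarrow> P e = A e))"

lemma HN_E:
  assumes "HN b k P"
  shows "\<exists>A. H b k A \<and> (\<forall>e. Num_env e \<longrightarrow> P e = A e)"
  using assms by (simp add: HN_def)

lemma HN_S1N: "S1N P \<Longrightarrow> HN True (Suc 0) P"
  unfolding S1N_def HN_def using S1_H by blast

lemma HN_not:
  assumes "HN b k P" shows "HN (\<not> b) k (\<lambda>e. \<not> P e)"
proof -
  obtain A where "H b k A" "\<forall>e. Num_env e \<longrightarrow> P e = A e" using HN_E[OF assms] by blast
  then show ?thesis unfolding HN_def using H_not by (intro exI[of _ "\<lambda>e. \<not> A e"]) simp
qed

lemma HN_Suc: "HN (\<not> b) k P \<Longrightarrow> HN b (Suc k) P"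
  unfolding HN_def using H_Suc by blast

text \<open>Relativising to \<open>Num\<close> adds only a \<open>\<Delta>\<^sub>0\<close> conjunct
  by \<open>D0_Num\<close>, so the level does not rise.\<close>

lemma HN_ex:
  assumes "HN True (Suc k) P"
  shows "HN True (Suc k) (\<lambda>e. \<exists>x\<in>Collect Num. P (case_nat x e))"
proof -
  obtain A where A: "H True (Suc k) A" "\<And>e. Num_env e \<Longrightarrow> P e = A e" using HN_E[OF assms] by blast
  have *: "H True (Suc k) (\<lambda>e. \<exists>x\<in>U. A (case_nat x e) \<and> Num (case_nat x e 0))"
    by (rule H_ex, rule H_conj_D0) (simp_all add: A(1) D0_Num U_nonempty)
  show ?thesis unfolding HN_def
  proof (intro exI conjI allI impI, rule *)
    fix e assume e: "Num_env e"
    have "P (case_nat x e) = A (case_nat x e)" if "Num x" for x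
      by (rule A(2)[OF Num_env_cons[OF that e]])
    then show "(\<exists>x\<in>Collect Num. P (case_nat x e)) = (\<exists>x\<in>U. A (case_nat x e) \<and> Num (case_nat x e 0))"
      by auto
  qed
qed

lemma HN_all:
  assumes "HN False (Suc k) P"
  shows "HN False (Suc k) (\<lambda>e. \<forall>x\<in>Collect Num. P (case_nat x e))"
  using HN_not[OF HN_ex[of k "\<lambda>e. \<not> P e"]] HN_not[OF assms] by simp

text \<open>The induction starts at level 1, because arithmetical \<open>\<Delta>\<^sub>0\<close>
  formulas are shown to be \<open>\<Delta>\<^sub>1\<close> in set theory. From there on, each block
  of quantifiers is relativised to the numbers.\<close>

lemma HN_hierarchy:
  "(\<forall>\<phi>\<in>Sigma_over arith_Delta0 (Suc k). HN True (Suc k) (\<lambda>e. sat N e \<phi>)) \<and>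
   (\<forall>\<phi>\<in>Pi_over arith_Delta0 (Suc k). HN False (Suc k) (\<lambda>e. sat N e \<phi>))"
proof -
  have ex: "HN True (Suc k) (\<lambda>e. sat N e ((Ex ^^ m) \<phi>))" if "HN True (Suc k) (\<lambda>e. sat N e \<phi>)" for m k \<phi>
    using that
  proof (induction m)
    case (Suc m)
    from HN_ex[OF Suc.IH[OF Suc.prems]] show ?case by simp
  qed simp
  have all: "HN False (Suc k) (\<lambda>e. sat N e ((All ^^ m) \<phi>))" if "HN False (Suc k) (\<lambda>e. sat N e \<phi>)" for m k \<phi>
    using that
  proof (induction m)
    case (Suc m)
    from HN_all[OF Suc.IH[OF Suc.prems]] show ?case by simp
  qed simp
  show ?thesis
  proof (induction k)
    case 0
    have "HN True (Suc 0) (\<lambda>e. sat N e \<phi>)" "HN False (Suc 0) (\<lambda>e. sat N e \<phi>)"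
      if "\<phi> \<in> arith_Delta0" for \<phi>
      using HN_S1N[OF S1N_Delta0(1)[OF that]] HN_not[OF HN_S1N[OF S1N_Delta0(2)[OF that]]] by simp_all
    then show ?case using ex all by auto
  next
    case (Suc k)
    have "HN True (Suc (Suc k)) (\<lambda>e. sat N e \<phi>)" if "\<phi> \<in> Pi_over arith_Delta0 (Suc k)" for \<phi>
      by (rule HN_Suc) (use Suc that in simp)
    moreover have "HN False (Suc (Suc k)) (\<lambda>e. sat N e \<phi>)" if "\<phi> \<in> Sigma_over arith_Delta0 (Suc k)" for \<phi>
      by (rule HN_Suc) (use Suc that in simp)
    ultimately show ?case using ex all
      by (simp only: Sigma_over.simps(2)[of _ "Suc k"] Pi_over.simps(2)[of _ "Suc k"]) blast
  qed
qed

section \<open>Induction in the structure of numbers\<close>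

lemma N_induct:
  assumes P: "HN b k P" "k \<le> n" and e: "Num_env e" and x: "Num x"
    and zero: "P (case_nat emp e)"
    and step: "\<And>y. Num y \<Longrightarrow> P (case_nat y e) \<Longrightarrow> P (case_nat (suc y) e)"
  shows "P (case_nat x e)"
proof -
  obtain A where A: "H b k A" "\<And>e. Num_env e \<Longrightarrow> P e = A e" using HN_E[OF P(1)] by blast
  have eq: "P (case_nat y e) = A (case_nat y e)" if "Num y" for y
    by (rule A(2)[OF Num_env_cons[OF that e]])
  have sep: "separable (\<lambda>y. A (case_nat y e))"
    by (rule separable_H[OF A(1) P(2) Num_env_range[OF e]])
  from x sep have "A (case_nat x e)"
    by (rule Num_induct) (use zero step eq in auto)
  then show ?thesis using eq x by simp
qed

lemma sat_ax_induction:
  assumes \<phi>: "\<phi> \<in> arith_Sigma n" and e: "Num_env e"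
  shows "sat N e (ax_induction \<phi>)"
proof -
  \<comment> \<open>\<open>HN_hierarchy\<close> starts at level 1, and here \<open>n \<ge> 1\<close>
    is used.\<close>
  obtain k where n: "n = Suc k" using n_pos by (cases n) auto
  have HN: "HN True n (\<lambda>e. sat N e \<phi>)"
    using HN_hierarchy \<phi> unfolding arith_Sigma_def n by blast
  have 0: "(\<lambda>i. eval N e (case_nat zero_tm Var i)) = case_nat emp e"
    by (rule ext) (simp split: nat.split)
  have S: "(\<lambda>i. eval N (case_nat y e) (case_nat (add_tm (Var 0) one_tm) (\<lambda>i. Var (Suc i)) i)) =
      case_nat (suc y) e" if "Num y" for y
    using that by (intro ext) (simp split: nat.split)
  have "sat N (case_nat x e) \<phi>"
    if "sat N (case_nat emp e) \<phi>" "\<And>y. Num y \<Longrightarrow> sat N (case_nat y e) \<phi> \<Longrightarrow> sat N (case_nat (suc y) e) \<phi>"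
      "Num x" for x
    by (rule N_induct[OF HN order_refl e that(3)]) (use that in auto)
  then show ?thesis by (simp add: ax_induction_def sat_subst 0 S)
qed

text \<open>The laws below are written as arithmetical formulas, with the induction variable at
  index 0 and parameters in the environment; definability of the induction predicate then comes for
  free.\<close>

lemma N_induct_Delta0:
  assumes \<phi>: "\<phi> \<in> arith_Delta0" and e: "Num_env e" and x: "Num x"
    and zero: "sat N (case_nat emp e) \<phi>"
    and step: "\<And>y. Num y \<Longrightarrow> sat N (case_nat y e) \<phi> \<Longrightarrow> sat N (case_nat (suc y) e) \<phi>"
  shows "sat N (case_nat x e) \<phi>"
  by (rule N_induct[OF HN_S1N[OF S1N_Delta0(1)[OF \<phi>]] _ e x]) (use n_pos zero step in auto)

lemma arith_Delta0_atoms: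
  "wf_tm arith_lang s \<Longrightarrow> wf_tm arith_lang t \<Longrightarrow> Eq s t \<in> arith_Delta0"
  "wf_tm arith_lang s \<Longrightarrow> wf_tm arith_lang t \<Longrightarrow> less_fm s t \<in> arith_Delta0"
  by (auto simp: arith_Delta0_def arith_lang_def intro: Delta0.intros)

lemma Num_case [simp]: "(\<forall>i. Num (case_nat x e i)) \<longleftrightarrow> Num x \<and> Num_env e"
  by (auto split: nat.split)

section \<open>Laws of addition, multiplication and order\<close>

lemma pl_assoc: assumes [simp]: "Num x" "Num y" "Num z" shows "pl (pl x y) z = pl x (pl y z)"
proof -
  have "sat N (case_nat z (case_nat x (\<lambda>_. y)))
    (Eq (add_tm (add_tm (Var 1) (Var 2)) (Var 0)) (add_tm (Var 1) (add_tm (Var 2) (Var 0))))"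
    by (rule N_induct_Delta0) (simp_all add: arith_Delta0_atoms numeral_2_eq_2)
  then show ?thesis by (simp add: numeral_2_eq_2)
qed

lemma emp_pl [simp]: assumes [simp]: "Num z" shows "pl emp z = z"
proof -
  have "sat N (case_nat z (\<lambda>_. emp)) (Eq (add_tm zero_tm (Var 0)) (Var 0))"
    by (rule N_induct_Delta0) (simp_all add: arith_Delta0_atoms)
  then show ?thesis by simp
qed

lemma suc_pl [simp]: assumes [simp]: "Num x" "Num z" shows "pl (suc x) z = suc (pl x z)"
proof -
  have "sat N (case_nat z (\<lambda>_. x))
    (Eq (add_tm (add_tm (Var 1) one_tm) (Var 0)) (add_tm (add_tm (Var 1) (Var 0)) one_tm))"
    by (rule N_induct_Delta0) (simp_all add: arith_Delta0_atoms)
  then show ?thesis by simp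
qed

lemma pl_comm: assumes [simp]: "Num x" "Num z" shows "pl x z = pl z x"
proof -
  have "sat N (case_nat z (\<lambda>_. x)) (Eq (add_tm (Var 1) (Var 0)) (add_tm (Var 0) (Var 1)))"
    by (rule N_induct_Delta0) (simp_all add: arith_Delta0_atoms)
  then show ?thesis by simp
qed

lemma emp_ti [simp]: assumes [simp]: "Num z" shows "ti emp z = emp"
proof -
  have "sat N (case_nat z (\<lambda>_. emp)) (Eq (mult_tm zero_tm (Var 0)) zero_tm)"
    by (rule N_induct_Delta0) (simp_all add: arith_Delta0_atoms)
  then show ?thesis by simp
qed

lemma suc_ti [simp]: assumes [simp]: "Num x" "Num z" shows "ti (suc x) z = pl (ti x z) z"
proof -
  have "sat N (case_nat z (\<lambda>_. x)) (Eq (mult_tm (add_tm (Var 1) one_tm) (Var 0))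
    (add_tm (mult_tm (Var 1) (Var 0)) (Var 0)))"
    by (rule N_induct_Delta0) (simp_all add: arith_Delta0_atoms pl_assoc pl_comm[of x])
  then show ?thesis by simp
qed

lemma ti_comm: assumes [simp]: "Num x" "Num z" shows "ti x z = ti z x"
proof -
  have "sat N (case_nat z (\<lambda>_. x)) (Eq (mult_tm (Var 1) (Var 0)) (mult_tm (Var 0) (Var 1)))"
    by (rule N_induct_Delta0) (simp_all add: arith_Delta0_atoms)
  then show ?thesis by simp
qed

lemma ti_pl: assumes [simp]: "Num x" "Num y" "Num z" shows "ti x (pl y z) = pl (ti x y) (ti x z)"
proof -
  have "sat N (case_nat z (case_nat x (\<lambda>_. y)))
    (Eq (mult_tm (Var 1) (add_tm (Var 2) (Var 0)))
      (add_tm (mult_tm (Var 1) (Var 2)) (mult_tm (Var 1) (Var 0))))"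
    by (rule N_induct_Delta0) (simp_all add: arith_Delta0_atoms numeral_2_eq_2 pl_assoc)
  then show ?thesis by (simp add: numeral_2_eq_2)
qed

lemma ti_assoc: assumes [simp]: "Num x" "Num y" "Num z" shows "ti (ti x y) z = ti x (ti y z)"
proof -
  have "sat N (case_nat z (case_nat x (\<lambda>_. y)))
    (Eq (mult_tm (mult_tm (Var 1) (Var 2)) (Var 0)) (mult_tm (Var 1) (mult_tm (Var 2) (Var 0))))"
    by (rule N_induct_Delta0) (simp_all add: arith_Delta0_atoms numeral_2_eq_2 ti_pl)
  then show ?thesis by (simp add: numeral_2_eq_2)
qed

lemma pl_mono: assumes [simp]: "Num x" "Num y" "Num z" and less: "E x y" shows "E (pl x z) (pl y z)"
proof -
  have "sat N (case_nat z (case_nat x (\<lambda>_. y)))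
    (less_fm (add_tm (Var 1) (Var 0)) (add_tm (Var 2) (Var 0)))"
    by (rule N_induct_Delta0) (simp_all add: arith_Delta0_atoms numeral_2_eq_2 less suc_less_suc del: E_suc)
  then show ?thesis by (simp add: numeral_2_eq_2)
qed

text \<open>Writing \<open>z = suc w\<close> and inducting on \<open>w\<close> builds positivity
  into the claim. The step is the chain \<open>x(v+1) + x < y(v+1) + x < y(v+1) + y\<close>.\<close>

lemma ti_mono:
  assumes [simp]: "Num x" "Num y" "Num z" and pos: "E emp z" and less: "E x y"
  shows "E (ti x z) (ti y z)"
proof -
  obtain w where w [simp]: "Num w" "z = suc w"
    using Num_cases[OF assms(3)] pos by (metis emp(1,2))
  have "sat N (case_nat w (case_nat x (\<lambda>_. y)))
    (less_fm (mult_tm (Var 1) (add_tm (Var 0) one_tm)) (mult_tm (Var 2) (add_tm (Var 0) one_tm)))"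
  proof (rule N_induct_Delta0)
    fix v assume v [simp]: "Num v" and IH: "sat N (case_nat v (case_nat x (\<lambda>_. y)))
      (less_fm (mult_tm (Var 1) (add_tm (Var 0) one_tm)) (mult_tm (Var 2) (add_tm (Var 0) one_tm)))"
    let ?a = "ti x (suc v)" and ?b = "ti y (suc v)"
    have N: "Num ?a" "Num ?b" by (simp_all del: ti_suc)
    have "E ?a ?b" using IH by (simp add: numeral_2_eq_2 del: ti_suc)
    then have 1: "E (pl ?a x) (pl ?b x)" using N by (intro pl_mono) simp_all
    have 2: "E (pl ?b x) (pl ?b y)"
      using pl_mono[OF _ _ N(2) less] pl_comm[of x ?b] pl_comm[of y ?b] N(2) by simp
    have "E (pl ?a x) (pl ?b y)"
      by (rule Num_transitive[OF _ _ _ 1 2]) (use N in \<open>simp_all del: ti_suc\<close>)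
    then show "sat N (case_nat (suc v) (case_nat x (\<lambda>_. y)))
      (less_fm (mult_tm (Var 1) (add_tm (Var 0) one_tm)) (mult_tm (Var 2) (add_tm (Var 0) one_tm)))"
      by (simp add: numeral_2_eq_2)
  qed (simp_all add: arith_Delta0_atoms numeral_2_eq_2 less)
  then show ?thesis by (simp add: numeral_2_eq_2)
qed

text \<open>\<open>\<Sigma>\<^sub>1\<close> induction on \<open>y\<close> for fixed
  \<open>x\<close>. Passing from \<open>v\<close> to \<open>suc v\<close>, the difference is 1 if
  \<open>x = v\<close>, and otherwise the successor of the previous one.\<close>

lemma difference_exists:
  assumes [simp]: "Num x" "Num y" and less: "E x y" shows "\<exists>z. Num z \<and> pl x z = y"
proof -
  \<comment> \<open>Variables 0, 1 and 2 are the difference \<open>z\<close>, the bound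
    \<open>y\<close> and the number \<open>x\<close>. The hypothesis is inside the quantifier, so
    that the matrix is \<open>\<Delta>\<^sub>0\<close>.\<close>
  let ?\<psi> = "Imp (less_fm (Var 2) (Var 1)) (Eq (add_tm (Var 2) (Var 0)) (Var 1)) :: arith_fm"
  have "?\<psi> \<in> arith_Delta0"
    by (auto simp: arith_Delta0_def arith_lang_def intro: Delta0.intros)
  from HN_ex[OF HN_S1N[OF S1N_Delta0(1)[OF this]]]
  have *: "HN True (Suc 0) (\<lambda>e. \<exists>z\<in>Collect Num. E (e 1) (e 0) \<longrightarrow> pl (e 1) z = e 0)"
    (is "HN _ _ ?P") by (simp add: numeral_2_eq_2)
  have "?P (case_nat y (\<lambda>_. x))"
  proof (rule N_induct[OF *])
    show "Suc 0 \<le> n" using n_pos by simp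
    show "?P (case_nat emp (\<lambda>_. x))" by (rule bexI[of _ emp]) auto
    fix v assume v [simp]: "Num v" and "?P (case_nat v (\<lambda>_. x))"
    then obtain z where z: "Num z" "E x v \<longrightarrow> pl x z = v" by auto
    have "\<exists>z. Num z \<and> (E x (suc v) \<longrightarrow> pl x z = suc v)"
    proof (cases "x = v")
      case True
      then show ?thesis by (intro exI[of _ "suc emp"]) simp
    next
      case False
      then show ?thesis using z by (intro exI[of _ "suc z"]) simp
    qed
    then show "?P (case_nat (suc v) (\<lambda>_. x))" by auto
  qed auto
  then show ?thesis using less by auto
qed

section \<open>The axioms of \<open>I\<Sigma>\<^sub>n\<close>\<close>

lemma models_N: "models arith_lang (ISigma n) N"
  unfolding models_def
proof (intro conjI ballI allI impI)
  fix \<phi> and e :: "nat \<Rightarrow> 'a" assume \<phi>: "\<phi> \<in> ISigma n" and "range e \<subseteq> univ N"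
  then have e [simp]: "Num_env e" by auto
  have e' [simp]: "Num (e i)" for i using e by blast
  show "sat N e \<phi>"
  proof (cases "\<phi> \<in> PA_minus")
    case True
    have linear: "E (e 0) (e 1) \<or> e 0 = e 1 \<or> E (e 1) (e 0)" by (rule Num_linear) auto
    have discrete: "E (suc emp) (e 0) \<or> suc emp = e 0" if "E emp (e 0)"
    proof -
      \<comment> \<open>A positive number is the successor of some \<open>w\<close>, and
        \<open>w\<close> is 0 or positive.\<close>
      have "e 0 \<noteq> emp" using that by auto
      then obtain w where w: "Num w" "e 0 = suc w" using Num_cases[OF e'[of 0]] by blast
      then show ?thesis using emp_less[OF w(1)] suc_less_suc[OF w(1), of emp] by auto
    qed
    have zero: "E emp (e 0) \<or> emp = e 0" using emp_less[OF e'[of 0]] by auto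
    have trans: "E (e 0) (e 2)" if "E (e 0) (e 1)" "E (e 1) (e 2)"
      by (rule Num_transitive[OF _ _ _ that]) simp_all
    have diff: "\<exists>z. Num z \<and> pl (e 0) z = e 1" if "E (e 0) (e 1)"
      by (rule difference_exists[OF _ _ that]) simp_all
    note mono = pl_mono[OF e' e' e', of 0 1 2] ti_mono[OF e' e' e', of 2 0 1]
    note assoc = pl_assoc[OF e' e' e', of 0 1 2] ti_assoc[OF e' e' e', of 0 1 2]
    have one: "E emp (suc emp)" by simp
    note comm = pl_comm[OF e' e', of 0 1] ti_comm[OF e' e', of 0 1]
    show ?thesis
      using True unfolding PA_minus_def Let_def
      by (elim insertE emptyE;
          use linear discrete zero one trans diff mono assoc comm Num_irrefl[OF e'[of 0]] in
            \<open>simp add: eval_lift_tm ti_pl del: E_suc\<close>)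
  next
    case False
    then show ?thesis using \<phi> sat_ax_induction[OF _ e] by (auto simp: ISigma_def)
  qed
qed (rule is_struct_N)

end

section \<open>The interpretation\<close>

text \<open>The arguments of this and the following formula constructors are de Bruijn indices,
  which grow by one under each binder.\<close>

definition fEmp :: "nat \<Rightarrow> set_fm" where
  "fEmp i = All (Neg (Mem 0 (Suc i)))"

definition fSuc :: "nat \<Rightarrow> nat \<Rightarrow> set_fm" where
  "fSuc i j = All (Iff (Mem 0 (Suc j)) (Disj (Mem 0 (Suc i)) (EqV 0 (Suc i))))"

definition fUpair :: "nat \<Rightarrow> nat \<Rightarrow> nat \<Rightarrow> set_fm" where
  "fUpair c a b = All (Iff (Mem 0 (Suc c)) (Disj (EqV 0 (Suc a)) (EqV 0 (Suc b))))"

text \<open>Under the binders, variable 1 is the singleton and variable 0 the unordered pair of the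
  Kuratowski pair.\<close>

definition fPr :: "nat \<Rightarrow> nat \<Rightarrow> nat \<Rightarrow> set_fm" where
  "fPr p a b = Ex (Ex (Conj (fUpair 1 (a + 2) (a + 2))
     (Conj (fUpair 0 (a + 2) (b + 2)) (fUpair (p + 2) 1 0))))"

definition fVal :: "nat \<Rightarrow> nat \<Rightarrow> nat \<Rightarrow> set_fm" where
  "fVal f i u = Conj (Ex (Conj (fPr 0 (Suc i) (Suc u)) (Mem 0 (Suc f))))
     (All (Imp (Mem 0 (Suc f)) (Imp (Ex (Conj (fUpair 0 (i + 2) (i + 2)) (Mem 0 1)))
       (fPr 0 (Suc i) (Suc u)))))"

definition fNum :: "nat \<Rightarrow> set_fm" where
  "fNum x = Conj
     (Conj (Ex (Conj (fEmp 0) (Ex (Conj (fSuc (x + 2) 0) (Mem 1 0)))))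
       (All (Imp (Mem 0 (Suc x)) (Ex (Conj (fSuc 1 0) (Ex (Conj (fSuc (x + 3) 0) (Mem 1 0))))))))
     (All (Imp (Ex (Conj (fEmp 0) (Mem 0 1)))
       (Imp (All (Imp (Mem 0 (x + 2)) (Imp (Mem 0 1) (Ex (Conj (fSuc 1 0) (Mem 0 2))))))
         (Mem (Suc x) 0))))"

text \<open>In the innermost scope \<open>j\<close>, \<open>v\<close>, \<open>u\<close>,
  \<open>i\<close>, \<open>f\<close> of \<open>Rec\<close> are the variables 0 to 4, and the outer
  parameter \<open>a\<close> is shifted by 5.\<close>

definition fRec :: "(nat \<Rightarrow> nat \<Rightarrow> nat \<Rightarrow> set_fm) \<Rightarrow> nat \<Rightarrow> nat \<Rightarrow> nat \<Rightarrow> nat \<Rightarrow> set_fm" where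
  "fRec g a c y z = Ex (Conj (Ex (Conj (fEmp 0) (fVal 1 0 (c + 2))))
     (Conj (fVal 0 (Suc y) (Suc z)) (Conj (fNum (Suc y))
       (All (Imp (Mem 0 (y + 2)) (Ex (Ex (Ex (Conj (fSuc 3 0)
         (Conj (fVal 4 3 2) (Conj (fVal 4 0 1) (g (a + 5) 2 1))))))))))))"

definition fPlus :: "nat \<Rightarrow> nat \<Rightarrow> nat \<Rightarrow> set_fm" where
  "fPlus x y z = fRec (\<lambda>a u v. fSuc u v) x x y z"

text \<open>The language has no constant for the empty set; the initial value 0 is introduced by a
  quantifier and occupies variable 0.\<close>

definition fTimes :: "nat \<Rightarrow> nat \<Rightarrow> nat \<Rightarrow> set_fm" where
  "fTimes x y z = Ex (Conj (fEmp 0) (fRec (\<lambda>a u v. fPlus u a v) (Suc x) 0 (Suc y) (Suc z)))"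

section \<open>Free variables and well-formedness\<close>

lemma fv_set_fms [simp]:
  "fv (fEmp i) = {i}"
  "fv (fSuc i j) = {i, j}"
  "fv (fUpair c a b) = {c, a, b}"
  by (auto simp: fEmp_def fSuc_def fUpair_def)

lemma fv_fPr [simp]: "fv (fPr p a b) = {p, a, b}"
  by (auto simp: fPr_def)

lemma fv_fVal [simp]: "fv (fVal f i u) = {f, i, u}"
  by (auto simp: fVal_def)

lemma fv_fNum [simp]: "fv (fNum x) = {x}"
  by (auto simp: fNum_def)

lemma fv_fPlus [simp]: "fv (fPlus x y z) = {x, y, z}"
  by (auto simp: fPlus_def fRec_def)

lemma fv_fTimes [simp]: "fv (fTimes x y z) = {x, y, z}"
  by (auto simp: fTimes_def fRec_def)

lemma set_arity [simp]: "rel_arity set_lang r = Some (Suc (Suc 0))"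
  by (simp add: set_lang_def numeral_2_eq_2)

lemma wf_set_fms [simp]:
  "wf_fm set_lang (fEmp i)" "wf_fm set_lang (fNum x)"
  "wf_fm set_lang (fSuc x y)" "wf_fm set_lang (fPlus x y z)" "wf_fm set_lang (fTimes x y z)"
  by (simp_all add: fEmp_def fNum_def fSuc_def fPlus_def fTimes_def fRec_def fVal_def fPr_def fUpair_def)

lemma length_eq_two: "Suc (Suc 0) = length xs \<longleftrightarrow> (\<exists>x y. xs = [x, y])"
  by (cases xs; cases "tl xs") auto

text \<open>Equality is interpreted by identity, so the classes of the quotient are
  singletons.\<close>

definition arith_interp :: "(unit, set_rel, arith_fun, arith_rel) interp" where
  "arith_interp = \<lparr> dom_fm = fNum 0, eq_fm = EqV 0 1,
     fun_fm = (\<lambda>f. case f of Zero \<Rightarrow> fEmp 0 | One \<Rightarrow> Ex (Conj (fEmp 0) (fSuc 0 1))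
       | Add \<Rightarrow> fPlus 0 1 2 | Mult \<Rightarrow> fTimes 0 1 2),
     rel_fm = (\<lambda>_. Mem 0 1) \<rparr>"

lemma wf_arith_interp: "wf_interp set_lang arith_lang arith_interp"
proof -
  have "wf_fm set_lang (fun_fm arith_interp g) \<and> fv (fun_fm arith_interp g) \<subseteq> {..<Suc k}"
    if "fun_arity arith_lang g = Some k" for g k
    using that by (cases g) (auto simp: arith_interp_def)
  moreover have "wf_fm set_lang (rel_fm arith_interp r) \<and> fv (rel_fm arith_interp r) \<subseteq> {..<k}"
    if "rel_arity arith_lang r = Some k" for r k
    using that by (auto simp: arith_interp_def)
  moreover have "wf_fm set_lang (dom_fm arith_interp)" "fv (dom_fm arith_interp) \<subseteq> {..<1}"
    "wf_fm set_lang (eq_fm arith_interp)" "fv (eq_fm arith_interp) \<subseteq> {..<2}"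
    by (simp_all add: arith_interp_def)
  ultimately show ?thesis unfolding wf_interp_def by blast
qed

section \<open>Meaning of the formulas in a model\<close>

context set_theory_model
begin

lemma sat_fEmp [simp]: assumes "e i \<in> U" shows "sat M e (fEmp i) \<longleftrightarrow> e i = emp"
proof
  assume "sat M e (fEmp i)"
  then have "\<not> E x (e i)" if "x \<in> U" for x using that by (simp add: fEmp_def)
  then show "e i = emp" by (intro extensionality assms emp) simp
qed (simp add: fEmp_def)

lemma sat_fSuc [simp]: "e i \<in> U \<Longrightarrow> e j \<in> U \<Longrightarrow> sat M e (fSuc i j) \<longleftrightarrow> e j = suc (e i)"
  by (simp only: suc_eq_iff) (auto simp: fSuc_def)

lemma sat_fUpair [simp]:
  "e c \<in> U \<Longrightarrow> e a \<in> U \<Longrightarrow> e b \<in> U \<Longrightarrow> sat M e (fUpair c a b) \<longleftrightarrow> e c = upair (e a) (e b)"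
  by (simp only: upair_eq_iff) (auto simp: fUpair_def)

lemma sat_fPr [simp]:
  "e p \<in> U \<Longrightarrow> e a \<in> U \<Longrightarrow> e b \<in> U \<Longrightarrow> sat M e (fPr p a b) \<longleftrightarrow> e p = pr (e a) (e b)"
  by (simp add: fPr_def pr_def)

lemma sat_fVal [simp]:
  "e f \<in> U \<Longrightarrow> e i \<in> U \<Longrightarrow> e u \<in> U \<Longrightarrow> sat M e (fVal f i u) \<longleftrightarrow> val (e f) (e i) (e u)"
  by (simp add: fVal_def val_def)

lemma sat_fNum [simp]: "e x \<in> U \<Longrightarrow> sat M e (fNum x) \<longleftrightarrow> Num (e x)"
  by (simp add: fNum_def Num_def Loc_def numeral_2_eq_2 numeral_3_eq_3 del: E_suc Num_in)

lemma sat_fRec: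
  assumes "\<And>e a u v. e a \<in> U \<Longrightarrow> e u \<in> U \<Longrightarrow> e v \<in> U \<Longrightarrow> sat M e (g a u v) \<longleftrightarrow> G (e a) (e u) (e v)"
    and "e a \<in> U" "e c \<in> U" "e y \<in> U" "e z \<in> U"
  shows "sat M e (fRec g a c y z) \<longleftrightarrow> Rec G (e a) (e c) (e y) (e z)"
  using assms
  by (simp add: fRec_def Rec_def eval_nat_numeral)

lemma sat_fPlus [simp]:
  "e x \<in> U \<Longrightarrow> e y \<in> U \<Longrightarrow> e z \<in> U \<Longrightarrow> sat M e (fPlus x y z) \<longleftrightarrow> plus (e x) (e y) (e z)"
  unfolding fPlus_def plus_def by (rule sat_fRec) simp_all

lemma sat_fTimes [simp]:
  assumes "e x \<in> U" "e y \<in> U" "e z \<in> U"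
  shows "sat M e (fTimes x y z) \<longleftrightarrow> times (e x) (e y) (e z)"
proof -
  have "sat M (case_nat a e) (fRec (\<lambda>a u v. fPlus u a v) (Suc x) 0 (Suc y) (Suc z)) \<longleftrightarrow>
      Rec (\<lambda>a u v. plus u a v) (e x) a (e y) (e z)" if "a \<in> U" for a
    using sat_fRec[of "\<lambda>a u v. fPlus u a v" "\<lambda>a u v. plus u a v" "case_nat a e" "Suc x" 0 "Suc y" "Suc z"]
      assms that by simp
  then show ?thesis by (auto simp: fTimes_def times_def)
qed

lemma rel_fm_arith [simp]: "rel_fm arith_interp r = Mem 0 1"
  by (simp add: arith_interp_def)

lemma idom_arith: "idom arith_interp M = Collect Num"
  by (auto simp: idom_def arith_interp_def)

lemma ieq_arith: "(x, y) \<in> ieq arith_interp M \<longleftrightarrow> Num x \<and> x = y"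
  by (auto simp: ieq_def idom_arith) (auto simp: arith_interp_def)

lemma ieq_arith_lists:
  "list_all2 (\<lambda>x y. (x, y) \<in> ieq arith_interp M) xs ys \<longleftrightarrow> set xs \<subseteq> Collect Num \<and> xs = ys"
  by (induction xs arbitrary: ys) (auto simp: ieq_arith list_all2_Cons1)

lemma ieq_class: "Num x \<Longrightarrow> ieq arith_interp M `` {x} = {x}"
  by (auto simp: ieq_arith)

lemma sat_fun_fm:
  assumes "fun_arity arith_lang g = Some (length xs)" "set xs \<subseteq> Collect Num" "Num u"
  shows "sat_list M (xs @ [u]) (fun_fm arith_interp g) \<longleftrightarrow> u = fun_int N g xs"
proof (cases g)
  case Zero
  then show ?thesis using assms by (simp add: arith_interp_def)
next
  case One
  then show ?thesis using assms by (auto simp: arith_interp_def)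
next
  case Add
  then obtain x y where "xs = [x, y]" using assms(1) Add by (auto simp: length_eq_two)
  then show ?thesis using assms Add by (simp add: arith_interp_def numeral_2_eq_2 plus_iff)
next
  case Mult
  then obtain x y where "xs = [x, y]" using assms(1) Mult by (auto simp: length_eq_two)
  then show ?thesis using assms Mult by (simp add: arith_interp_def numeral_2_eq_2 times_iff)
qed

lemma fun_int_N:
  "fun_arity arith_lang g = Some (length xs) \<Longrightarrow> set xs \<subseteq> Collect Num \<Longrightarrow> Num (fun_int N g xs)"
  using is_struct_N unfolding is_struct_def by auto

lemma defines_quotient_arith: "defines_quotient arith_lang arith_interp M"
  unfolding defines_quotient_def ieq_arith_lists idom_arith
proof (intro conjI allI impI)
  show "Collect Num \<noteq> {}" using Num_emp by blast
  show "equiv (Collect Num) (ieq arith_interp M)"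
    by (auto simp: equiv_def refl_on_def sym_def trans_def ieq_arith)
  fix g xs assume g: "fun_arity arith_lang g = Some (length xs)" "set xs \<subseteq> Collect Num"
  note sat = sat_fun_fm[OF g]
  show "\<exists>u\<in>Collect Num. sat_list M (xs @ [u]) (fun_fm arith_interp g)"
    using sat fun_int_N[OF g] by (intro bexI[of _ "fun_int N g xs"]) simp_all
  show "\<forall>u\<in>Collect Num. \<forall>v\<in>Collect Num. sat_list M (xs @ [u]) (fun_fm arith_interp g) \<longrightarrow>
      sat_list M (xs @ [v]) (fun_fm arith_interp g) \<longrightarrow> (u, v) \<in> ieq arith_interp M"
    using sat by (simp add: ieq_arith)
qed auto

text \<open>The map \<open>x \<mapsto> {x}\<close> is an isomorphism from \<open>N\<close> onto the
  quotient. \<open>tarski_vaught\<close> transfers truth along it, its witness condition being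
  immediate from surjectivity.\<close>

lemma models_quotient: "models arith_lang (ISigma n) (quotient_struct arith_interp M)"
  unfolding models_def
proof (intro conjI ballI allI impI)
  let ?Q = "quotient_struct arith_interp M"
  note reps = quotient_struct_reps[OF defines_quotient_arith]
  show "is_struct arith_lang ?Q" by (rule is_struct_quotient[OF defines_quotient_arith])
  have univ: "univ ?Q = (\<lambda>x. {x}) ` Collect Num"
    by (auto simp: quotient_struct_def quotient_def idom_arith ieq_class)
  have cls: "map (\<lambda>x. ieq arith_interp M `` {x}) xs = map (\<lambda>x. {x}) xs" if "set xs \<subseteq> Collect Num" for xs
    by (rule map_cong[OF refl], rule ieq_class) (use that in auto)
  fix \<phi> and e :: "nat \<Rightarrow> 'a set" assume \<phi>: "\<phi> \<in> ISigma n" and e: "range e \<subseteq> univ ?Q"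
  have "\<exists>x. Num x \<and> e i = {x}" for i using e unfolding univ by blast
  then obtain d where d: "\<And>i. Num (d i)" "\<And>i. e i = {d i}" by metis
  have "sat ?Q ((\<lambda>x. {x}) \<circ> d) \<phi> = sat N d \<phi>"
  proof (rule tarski_vaught[OF is_struct_N])
    show "(\<lambda>x. {x}) ` univ N \<subseteq> univ ?Q" unfolding univ by simp
    show "inj_on (\<lambda>x. {x}) (univ N)" by simp
    show "fun_int ?Q g (map (\<lambda>x. {x}) xs) = {fun_int N g xs}"
      if "fun_arity arith_lang g = Some (length xs)" "set xs \<subseteq> univ N" for g xs
    proof -
      have xs: "set xs \<subseteq> Collect Num" using that(2) by simp
      have "Num (fun_int N g xs)" by (rule fun_int_N[OF that(1) xs])
      then show ?thesis
        using reps(2)[of xs g "fun_int N g xs"] sat_fun_fm[OF that(1) xs] that(1) xs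
        by (simp add: idom_arith cls ieq_class)
    qed
    show "rel_int ?Q r (map (\<lambda>x. {x}) xs) = rel_int N r xs"
      if r: "rel_arity arith_lang r = Some (length xs)" and "set xs \<subseteq> univ N" for r xs
    proof -
      have xs: "set xs \<subseteq> Collect Num" using that(2) by simp
      obtain x y where "xs = [x, y]" using r by (auto simp: length_eq_two)
      then show ?thesis
        using reps(1)[of xs r] r xs cls[OF xs] by (simp add: idom_arith)
    qed
    show "\<exists>a\<in>univ N. sat ?Q (case_nat {a} ((\<lambda>x. {x}) \<circ> e')) \<psi>"
      if "b \<in> univ ?Q" "sat ?Q (case_nat b ((\<lambda>x. {x}) \<circ> e')) \<psi>" for \<psi> e' b
      using that unfolding univ by auto
    show "wf_fm arith_lang \<phi>" by (rule wf_ISigma[OF \<phi>])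
    show "range d \<subseteq> univ N" using d(1) by auto
  qed
  moreover have "sat N d \<phi>" using models_N \<phi> d(1) unfolding models_def by auto
  moreover have "(\<lambda>x. {x}) \<circ> d = e" using d(2) by auto
  ultimately show "sat ?Q e \<phi>" by simp
qed

end

lemma interprets_via_arith:
  assumes "n \<ge> 1"
  shows "interprets_via TYPE('a) set_lang (ReS0 \<union> Sep (set_Sigma n)) arith_lang (ISigma n) arith_interp"
  unfolding interprets_via_def
proof (intro conjI allI impI wf_arith_interp)
  fix M :: "(unit, set_rel, 'a) struct"
  assume "models set_lang (ReS0 \<union> Sep (set_Sigma n)) M"
  with assms interpret set_theory_model M n by unfold_locales
  show "defines_quotient arith_lang arith_interp M" by (rule defines_quotient_arith)
  show "models arith_lang (ISigma n) (quotient_struct arith_interp M)" by (rule models_quotient)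
qed

theorem theorem4p3:
  fixes n :: nat
  assumes "n \<ge> 1"
  shows "interprets TYPE('a) set_lang (ReS0 \<union> Sep (set_Sigma n)) arith_lang (ISigma n)"
  unfolding interprets_def
  using interprets_via_arith[OF assms, where 'a = 'a] interprets_via_arith[OF assms, where 'a = nat]
  by (intro exI[of _ arith_interp] conjI)

end
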